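(* Let $(Y_{ij})_{i,j\ge 1}$ be i.i.d. real-valued random variables with $\mathbb{E}|Y_{11}-\mathbb{E}Y_{11}|^2=1$. For each $m\in\mathbb{N}^*$ let $n=n(m)$ be a positive integer with $m/n\to y>0$ as $m\to+\infty$, let $Y_m=[Y_{ij}]_{1\le i\le m,\,1\le j\le n}$, and let $T_m$ be an $m\times m$ symmetric nonnegative definite random matrix independent of the $Y_{ij}$'s, such that there exists a sequence of strictly positive numbers $(\mu_k)_{k\in\mathbb{N}^*}$ with $\frac1m\operatorname{tr}T_m^k\to\mu_k$ almost surely as $m\to+\infty$ for every $k\in\mathbb{N}^*$, and $\sum_{k\in\mathbb{N}^*}\mu_{2k}^{-1/(2k)}=+\infty$. Let $H$ be the unique distribution function with moments $(\mu_k)_{k\in\mathbb{N}^*}$, let $M_m=\frac1n Y_mY_m^\top T_m$, and let $F$ be the nonrandom distribution function to which, almost surely, $(F^{M_m})_{m\ge1}$ converges weakly (see context). Then $F$ is continuous on $]0,+\infty[$. Moreover, if $H$ places no mass at $0$, then almost surely $(F^{M_m})_{m\ge1}$ converges to $F$ uniformly on $\mathbb{R}$.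
   Context: A distribution function (d.f.) is a right-continuous nondecreasing function $F$ on $\mathbb{R}$ with limits $0$ at $-\infty$ and $1$ at $+\infty$. For an $m\times m$ random matrix $M$ with real eigenvalues $\Lambda_1,\dots,\Lambda_m$, its empirical d.f. is $F^M(x)=\frac1m\#\{i:\Lambda_i\le x\}$ (the eigenvalues of $M_m$ are real and nonnegative since they coincide with those of $\frac1n T_m^{1/2}Y_mY_m^\top T_m^{1/2}$). It is a known result (Yin, 1986) that under the stated hypotheses, almost surely $(F^{M_m})_{m\ge1}$ converges weakly to a nonrandom d.f. $F$ whose moments are $\nu_k=\sum_{w=1}^{k}y^{k-w}\sum\frac{k!}{m_1!\cdots m_w!\,w!}\mu_1^{m_1}\cdots\mu_w^{m_w}$, where the inner sum is over all $w$-tuples of positive integers $(m_1,\dots,m_w)$ with $\sum_i m_i=k-w+1$ and $\sum_i i\,m_i=k$; these moments determine $F$ uniquely. *)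

theory Defs
  imports "HOL-Probability.Probability" "Jordan_Normal_Form.Char_Poly"
begin

definition mtrace :: "real mat \<Rightarrow> real" where
  "mtrace A = (\<Sum>i<dim_row A. A $$ (i, i))"

text \<open>Empirical distribution function of a square real matrix whose eigenvalues
  are real: F(x) = (1/m) * number of eigenvalues (with algebraic multiplicity) that are <= x.
  Algebraic multiplicity of a real eigenvalue r is its order as a root of the
  characteristic polynomial.\<close>
definition esd :: "real mat \<Rightarrow> real \<Rightarrow> real" where
  "esd A x = (\<Sum>r\<in>{r. poly (char_poly A) r = 0 \<and> r \<le> x}. real (order r (char_poly A)))
              / real (dim_row A)"

definition is_df :: "(real \<Rightarrow> real) \<Rightarrow> bool" where
  "is_df F \<longleftrightarrow> mono F \<and> (\<forall>x. continuous (at_right x) F)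
     \<and> (F \<longlongrightarrow> 0) at_bot \<and> (F \<longlongrightarrow> 1) at_top"

definition Ymat :: "(nat \<Rightarrow> nat \<Rightarrow> 'a \<Rightarrow> real) \<Rightarrow> nat \<Rightarrow> nat \<Rightarrow> 'a \<Rightarrow> real mat" where
  "Ymat Y m n \<omega> = mat m n (\<lambda>(i, j). Y i j \<omega>)"

definition Tmat :: "(nat \<Rightarrow> nat \<Rightarrow> nat \<Rightarrow> 'a \<Rightarrow> real) \<Rightarrow> nat \<Rightarrow> 'a \<Rightarrow> real mat" where
  "Tmat T m \<omega> = mat m m (\<lambda>(i, j). T m i j \<omega>)"

definition Mmat :: "(nat \<Rightarrow> nat \<Rightarrow> 'a \<Rightarrow> real) \<Rightarrow> (nat \<Rightarrow> nat \<Rightarrow> nat \<Rightarrow> 'a \<Rightarrow> real)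
    \<Rightarrow> nat \<Rightarrow> nat \<Rightarrow> 'a \<Rightarrow> real mat" where
  "Mmat Y T m n \<omega> = (1 / real n) \<cdot>\<^sub>m (Ymat Y m n \<omega> * transpose_mat (Ymat Y m n \<omega>) * Tmat T m \<omega>)"

end

theory Submission
  imports Defs "HOL-Real_Asymp.Real_Asymp"
begin

text \<open>Write q_j for the columns of Y divided by sqrt n, S for the sum of the q_j q_j^T, and M
  = S T. All estimates go through the bilinear form x^T T y, for which M is symmetric, so no square
  root of T appears and T may be singular. Let W = (M - z)^(-1) at z = x + i \<epsilon>. The
  quantity G = \<epsilon> Im tr W is the sum over the eigenvalues e of \<epsilon>^2 / ((e - x)^2 +
  \<epsilon>^2), so a jump of F at x forces G \<ge> \<kappa> m for all large m, however small
  \<epsilon> is.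

  Let W_j be the resolvent without column j. The rank-one update formula gives m + z tr W = n -
  sum_j \<beta>_j with \<beta>_j = 1 / (1 + q_j^T T W_j q_j) (\<open>leave_one_out\<close>). Put B_j
  = \<epsilon> Im (T W_j) = \<epsilon>^2 W_j^* T W_j, a form between 0 and T. The denominator of
  \<beta>_j has imaginary part q_j^T B_j q_j / \<epsilon>, so q_j^T B_j q_j \<ge> t implies
  |\<beta>_j| \<le> \<epsilon> / t. As B_j is independent of q_j, this lower bound holds for most
  columns once tr B_j \<ge> c m (\<open>quadratic_form_lower_tail\<close>, which needs two moments
  of the entries only); the fourth spectral moment of T keeps the Frobenius norm of B_j negligible
  against m.

  It remains to bound tr B_j below with c independent of \<epsilon>; then t is independent of
  \<epsilon> too, and \<epsilon> can be sent to 0 afterwards. For x > 0 an atom does it: tr (S B) is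
  about \<epsilon> Im (z tr W), and Cauchy-Schwarz with B S B \<le> (x + \<epsilon>) B yields tr B
  \<ge> c m (\<open>loo_form_trace_pos\<close>). The imaginary part of the identity then makes x G
  small against m, a contradiction (\<open>no_positive_atom\<close>). For x = 0, if H has no mass at
  0, few eigenvalues of T are small, so a large G again makes tr B large
  (\<open>loo_form_trace_zero\<close>), and the real part of the identity gives F 0 \<le> max 0 (1 -
  1/y) (\<open>mass_at_zero\<close>).

  Conversely M has at least m - n zero eigenvalues. Hence the empirical mass at 0 converges to F 0,
  convergence is pointwise on the half-line where F is continuous, and monotonicity makes it
  uniform.

  Two further ingredients. Convergence of the traces of the powers of T is turned into weak
  convergence of its spectral distribution by Carleman's criterion, proved through Bang's
  quasi-analyticity argument. And since F is nonrandom, a contradiction at one outcome suffices: the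
  exceptional events have probability at most 1/4, so some outcome of the almost sure set avoids
  them for infinitely many m (\<open>frequently_escape\<close>).\<close>

section \<open>Bilinear forms and positive semidefinite forms\<close>

text \<open>Vectors and matrices are plain functions of which only the entries below
  \<open>m\<close> count, so the same notion serves T and the forms derived from its resolvents
  without carrier conditions.\<close>

definition rform :: "nat \<Rightarrow> (nat \<Rightarrow> nat \<Rightarrow> real) \<Rightarrow> (nat \<Rightarrow> real) \<Rightarrow> (nat \<Rightarrow> real) \<Rightarrow> real" where
  "rform m T x y = (\<Sum>i<m. \<Sum>k<m. x i * T i k * y k)"

text \<open>Bilinear, not sesquilinear: conjugates are written out where an energy is wanted, so
  that identities between two resolvent solutions stay symmetric.\<close>

definition cform :: "nat \<Rightarrow> (nat \<Rightarrow> nat \<Rightarrow> real) \<Rightarrow> (nat \<Rightarrow> complex) \<Rightarrow> (nat \<Rightarrow> complex) \<Rightarrow> complex" where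
  "cform m T x y = (\<Sum>i<m. \<Sum>k<m. x i * of_real (T i k) * y k)"

lemma rform_cong:
  "(\<And>i. i < m \<Longrightarrow> x i = x' i) \<Longrightarrow> (\<And>i. i < m \<Longrightarrow> y i = y' i) \<Longrightarrow> rform m T x y = rform m T x' y'"
  unfolding rform_def by (intro sum.cong refl) auto

lemma cform_cong:
  "(\<And>i. i < m \<Longrightarrow> x i = x' i) \<Longrightarrow> (\<And>i. i < m \<Longrightarrow> y i = y' i) \<Longrightarrow> cform m T x y = cform m T x' y'"
  unfolding cform_def by (intro sum.cong refl) auto

lemma rform_linear:
  "rform m T (\<lambda>i. x i + x' i) y = rform m T x y + rform m T x' y"
  "rform m T x (\<lambda>i. y i + y' i) = rform m T x y + rform m T x y'"
  "rform m T (\<lambda>i. c * x i) y = c * rform m T x y"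
  "rform m T x (\<lambda>i. c * y i) = c * rform m T x y"
  "rform m T (\<lambda>i. \<Sum>j\<in>J. f j i) y = (\<Sum>j\<in>J. rform m T (f j) y)"
  "rform m T x (\<lambda>i. \<Sum>j\<in>J. f j i) = (\<Sum>j\<in>J. rform m T x (f j))"
proof -
  show "rform m T (\<lambda>i. \<Sum>j\<in>J. f j i) y = (\<Sum>j\<in>J. rform m T (f j) y)"
    unfolding rform_def sum_distrib_right sum.swap[of _ J] ..
  have "rform m T x (\<lambda>i. \<Sum>j\<in>J. f j i) = (\<Sum>i<m. \<Sum>k<m. \<Sum>j\<in>J. x i * T i k * f j k)"
    unfolding rform_def sum_distrib_left ..
  also have "\<dots> = (\<Sum>j\<in>J. rform m T x (f j))"
    unfolding rform_def sum.swap[of _ J] ..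
  finally show "rform m T x (\<lambda>i. \<Sum>j\<in>J. f j i) = (\<Sum>j\<in>J. rform m T x (f j))" .
qed (auto simp: rform_def sum.distrib sum_distrib_left algebra_simps)

lemma cform_linear:
  "cform m T (\<lambda>i. x i + x' i) y = cform m T x y + cform m T x' y"
  "cform m T x (\<lambda>i. y i + y' i) = cform m T x y + cform m T x y'"
  "cform m T (\<lambda>i. x i - x' i) y = cform m T x y - cform m T x' y"
  "cform m T x (\<lambda>i. y i - y' i) = cform m T x y - cform m T x y'"
  "cform m T (\<lambda>i. c * x i) y = c * cform m T x y"
  "cform m T x (\<lambda>i. c * y i) = c * cform m T x y"
  "cform m T (\<lambda>i. \<Sum>j\<in>J. f j i) y = (\<Sum>j\<in>J. cform m T (f j) y)"
  "cform m T x (\<lambda>i. \<Sum>j\<in>J. f j i) = (\<Sum>j\<in>J. cform m T x (f j))"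
proof -
  show "cform m T (\<lambda>i. \<Sum>j\<in>J. f j i) y = (\<Sum>j\<in>J. cform m T (f j) y)"
    unfolding cform_def sum_distrib_right sum.swap[of _ J] ..
  have "cform m T x (\<lambda>i. \<Sum>j\<in>J. f j i) = (\<Sum>i<m. \<Sum>k<m. \<Sum>j\<in>J. x i * of_real (T i k) * f j k)"
    unfolding cform_def sum_distrib_left ..
  also have "\<dots> = (\<Sum>j\<in>J. cform m T x (f j))"
    unfolding cform_def sum.swap[of _ J] ..
  finally show "cform m T x (\<lambda>i. \<Sum>j\<in>J. f j i) = (\<Sum>j\<in>J. cform m T x (f j))" .
qed (auto simp: cform_def sum.distrib sum_subtractf sum_distrib_left algebra_simps)

lemma cform_cnj: "cform m T (\<lambda>i. cnj (x i)) (\<lambda>i. cnj (y i)) = cnj (cform m T x y)"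
  by (simp add: cform_def)

lemma cform_Re_Im:
  "cform m T x y = Complex
    (rform m T (\<lambda>i. Re (x i)) (\<lambda>i. Re (y i)) - rform m T (\<lambda>i. Im (x i)) (\<lambda>i. Im (y i)))
    (rform m T (\<lambda>i. Re (x i)) (\<lambda>i. Im (y i)) + rform m T (\<lambda>i. Im (x i)) (\<lambda>i. Re (y i)))"
  by (simp add: complex_eq_iff cform_def rform_def sum.distrib sum_subtractf algebra_simps)

locale psd_form =
  fixes m :: nat and T :: "nat \<Rightarrow> nat \<Rightarrow> real"
  assumes T_sym: "i < m \<Longrightarrow> k < m \<Longrightarrow> T i k = T k i"
    and T_psd: "0 \<le> rform m T x x"
begin

abbreviation "rf \<equiv> rform m T"
abbreviation "cf \<equiv> cform m T"

lemma rform_commute: "rf x y = rf y x"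
proof -
  have "rf x y = (\<Sum>k<m. \<Sum>i<m. x i * T i k * y k)"
    unfolding rform_def by (rule sum.swap)
  also have "\<dots> = rf y x"
    unfolding rform_def by (intro sum.cong refl) (auto simp: T_sym)
  finally show ?thesis .
qed

lemma cform_commute: "cf x y = cf y x"
  unfolding cform_Re_Im by (simp add: rform_commute[of "\<lambda>i. Re (y i)"] rform_commute[of "\<lambda>i. Im (y i)"])

lemma rform_lin_comb: "rf (\<lambda>i. x i + t * y i) (\<lambda>i. x i + t * y i) = rf x x + 2 * t * rf x y + t\<^sup>2 * rf y y"
  by (simp add: rform_linear rform_commute[of y x] power2_eq_square algebra_simps)

lemma rform_abs_le: "2 * \<bar>rf x y\<bar> \<le> rf x x + rf y y"
  using T_psd[of "\<lambda>i. x i + 1 * y i"] T_psd[of "\<lambda>i. x i + (-1) * y i"]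
  unfolding rform_lin_comb by auto

lemma rform_Cauchy_Schwarz: "(rf x y)\<^sup>2 \<le> rf x x * rf y y"
proof (cases "rf y y = 0")
  case True
  have "rf x y = 0"
  proof (rule ccontr)
    assume *: "rf x y \<noteq> 0"
    \<comment> \<open>With y of form value 0 the form at x + t y is affine in t; this t would give
      it the value -1.\<close>
    have "0 \<le> rf x x + 2 * (- (rf x x + 1) / (2 * rf x y)) * rf x y"
      using T_psd[of "\<lambda>i. x i + (- (rf x x + 1) / (2 * rf x y)) * y i"]
      unfolding rform_lin_comb True by simp
    moreover have "2 * (- (rf x x + 1) / (2 * rf x y)) * rf x y = - (rf x x + 1)"
      using * by simp
    ultimately show False by linarith
  qed
  with True show ?thesis by simp
next
  case False
  then have pos: "rf y y > 0" using T_psd[of y] by simp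
  have "0 \<le> rf x x + 2 * (- rf x y / rf y y) * rf x y + (- rf x y / rf y y)\<^sup>2 * rf y y"
    using T_psd[of "\<lambda>i. x i + (- rf x y / rf y y) * y i"] unfolding rform_lin_comb .
  then have "0 \<le> rf x x - (rf x y)\<^sup>2 / rf y y"
    using pos by (simp add: power2_eq_square field_simps)
  then show ?thesis using pos by (simp add: field_simps)
qed

text \<open>This is x^* T x, the square of a seminorm that degenerates when T is singular.\<close>

definition nsq :: "(nat \<Rightarrow> complex) \<Rightarrow> real" where
  "nsq x = rf (\<lambda>i. Re (x i)) (\<lambda>i. Re (x i)) + rf (\<lambda>i. Im (x i)) (\<lambda>i. Im (x i))"

lemma nsq_nonneg: "0 \<le> nsq x"
  unfolding nsq_def using T_psd by (simp add: add_nonneg_nonneg)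

lemma cform_cnj_self: "cf (\<lambda>i. cnj (x i)) x = of_real (nsq x)"
proof -
  have "rf (\<lambda>i. - Im (x i)) y = - rf (\<lambda>i. Im (x i)) y" for y
    using rform_linear(3)[of m T "-1"] by simp
  then show ?thesis
    unfolding cform_Re_Im nsq_def
    by (simp add: complex_eq_iff rform_commute)
qed

text \<open>With a, b the form values at the real and imaginary parts and c their pairing, |a - b +
  2 i c|^2 \<le> (a + b)^2 is just c^2 \<le> a b.\<close>

lemma norm_cform_self_le: "cmod (cf x x) \<le> nsq x"
proof -
  let ?a = "rf (\<lambda>i. Re (x i)) (\<lambda>i. Re (x i))" and ?b = "rf (\<lambda>i. Im (x i)) (\<lambda>i. Im (x i))"
    and ?c = "rf (\<lambda>i. Re (x i)) (\<lambda>i. Im (x i))"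
  have "?c\<^sup>2 \<le> ?a * ?b" by (rule rform_Cauchy_Schwarz)
  moreover have "cmod (cf x x) = sqrt ((?a - ?b)\<^sup>2 + (2 * ?c)\<^sup>2)"
    unfolding cform_Re_Im
    by (simp add: cmod_def rform_commute[of "\<lambda>i. Im (x i)" "\<lambda>i. Re (x i)"])
  moreover have "(?a - ?b)\<^sup>2 + (2 * ?c)\<^sup>2 \<le> (?a + ?b)\<^sup>2"
    using \<open>?c\<^sup>2 \<le> ?a * ?b\<close> by (simp add: power2_eq_square algebra_simps)
  ultimately show ?thesis
    unfolding nsq_def using T_psd by (metis add_nonneg_nonneg real_sqrt_le_iff real_sqrt_unique)
qed

text \<open>Null vectors of the seminorm pair to zero with everything, by Cauchy-Schwarz. This is
  what replaces invertibility of T below.\<close>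

lemma nsq_eq_0_cform: "nsq x = 0 \<Longrightarrow> cf y x = 0"
proof -
  assume "nsq x = 0"
  then have *: "rf (\<lambda>i. Re (x i)) (\<lambda>i. Re (x i)) = 0" "rf (\<lambda>i. Im (x i)) (\<lambda>i. Im (x i)) = 0"
    unfolding nsq_def using T_psd by (simp_all add: add_nonneg_eq_0_iff)
  have "rf y (\<lambda>i. Re (x i)) = 0" "rf y (\<lambda>i. Im (x i)) = 0" for y
    using rform_Cauchy_Schwarz[of y "\<lambda>i. Re (x i)"] rform_Cauchy_Schwarz[of y "\<lambda>i. Im (x i)"] *
    by simp_all
  then show "cf y x = 0" unfolding cform_Re_Im by (simp add: complex_eq_iff)
qed

end

section \<open>The resolvent equation of a sample matrix\<close>

locale sample_form = psd_form +
  fixes q :: "nat \<Rightarrow> nat \<Rightarrow> real"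
begin

abbreviation cq :: "nat \<Rightarrow> nat \<Rightarrow> complex" where "cq j \<equiv> (\<lambda>i. complex_of_real (q j i))"

text \<open>The action of the sum of the \<open>q j (q j)^T T\<close> over \<open>J\<close>. The
  column set is a parameter because single columns get removed.\<close>

definition samp_op :: "nat set \<Rightarrow> (nat \<Rightarrow> complex) \<Rightarrow> nat \<Rightarrow> complex" where
  "samp_op J x i = (\<Sum>j\<in>J. complex_of_real (q j i) * cf (cq j) x)"

definition res_sol :: "nat set \<Rightarrow> complex \<Rightarrow> (nat \<Rightarrow> complex) \<Rightarrow> (nat \<Rightarrow> complex) \<Rightarrow> bool" where
  "res_sol J z w x \<longleftrightarrow> (\<forall>i<m. samp_op J x i - z * x i = w i)"

lemma samp_op_linear:
  "samp_op J (\<lambda>i. x i + y i) = (\<lambda>i. samp_op J x i + samp_op J y i)"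
  "samp_op J (\<lambda>i. x i - y i) = (\<lambda>i. samp_op J x i - samp_op J y i)"
  "samp_op J (\<lambda>i. c * x i) = (\<lambda>i. c * samp_op J x i)"
  "samp_op J (\<lambda>i. \<Sum>l\<in>L. f l i) = (\<lambda>i. \<Sum>l\<in>L. samp_op J (f l) i)"
     apply (simp_all add: samp_op_def cform_linear fun_eq_iff algebra_simps sum.distrib sum_subtractf
      sum_distrib_left sum_distrib_right)
  apply (intro allI, rule sum.swap)
  done

lemma samp_op_cong: "(\<And>i. i < m \<Longrightarrow> x i = y i) \<Longrightarrow> samp_op J x = samp_op J y"
  unfolding samp_op_def by (intro ext sum.cong refl arg_cong2[of _ _ _ _ times] cform_cong) auto

text \<open>The right-hand side is symmetric in x and y: the operator is self-adjoint for the form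
  of T although its matrix is not symmetric.\<close>

lemma cform_samp_op: "cf y (samp_op J x) = (\<Sum>j\<in>J. cf (cq j) y * cf (cq j) x)"
proof -
  have "cf y (samp_op J x) = cf y (\<lambda>i. \<Sum>j\<in>J. cf (cq j) x * cq j i)"
    unfolding samp_op_def by (simp add: mult.commute)
  also have "\<dots> = (\<Sum>j\<in>J. cf (cq j) x * cf y (cq j))"
    by (simp add: cform_linear)
  finally show ?thesis by (simp add: mult.commute cform_commute[of y])
qed

lemma cform_cq_cnj: "cf (cq j) (\<lambda>i. cnj (x i)) = cnj (cf (cq j) x)"
  using cform_cnj[of m T "cq j" x] by simp

text \<open>The equation paired with the conjugate solution in the form of T. Its real and imaginary
  parts are the source of all bounds on the resolvent.\<close>

lemma res_sol_energy:
  assumes "res_sol J z w x"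
  shows "cf (\<lambda>i. cnj (x i)) w = of_real (\<Sum>j\<in>J. (cmod (cf (cq j) x))\<^sup>2) - z * of_real (nsq x)"
proof -
  have "cf (\<lambda>i. cnj (x i)) w = cf (\<lambda>i. cnj (x i)) (\<lambda>i. samp_op J x i - z * x i)"
    using assms unfolding res_sol_def by (intro cform_cong) auto
  also have "\<dots> = (\<Sum>j\<in>J. cf (cq j) (\<lambda>i. cnj (x i)) * cf (cq j) x) - z * of_real (nsq x)"
    by (simp add: cform_linear cform_samp_op cform_cnj_self)
  also have "(\<Sum>j\<in>J. cf (cq j) (\<lambda>i. cnj (x i)) * cf (cq j) x) = of_real (\<Sum>j\<in>J. (cmod (cf (cq j) x))\<^sup>2)"
    unfolding of_real_sum cform_cq_cnj
    by (intro sum.cong refl) (simp only: complex_norm_square mult.commute)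
  finally show ?thesis .
qed

lemma res_sol_energy_real:
  assumes "res_sol J z (\<lambda>i. of_real (w i)) x"
  shows "cf (\<lambda>i. of_real (w i)) x = of_real (\<Sum>j\<in>J. (cmod (cf (cq j) x))\<^sup>2) - cnj z * of_real (nsq x)"
proof -
  have "cf (\<lambda>i. of_real (w i)) x = cnj (cf (\<lambda>i. cnj (x i)) (\<lambda>i. of_real (w i)))"
    using cform_cnj[of m T "\<lambda>i. cnj (x i)" "\<lambda>i. of_real (w i)"] by (simp add: cform_commute)
  then show ?thesis unfolding res_sol_energy[OF assms] by simp
qed

text \<open>The imaginary part of the energy identity only gives \<open>nsq x = 0\<close>, but then
  the operator term vanishes as well, and z x = 0 remains.\<close>

lemma res_sol_zero:
  assumes "res_sol J z (\<lambda>i. 0) x" "Im z > 0" "i < m"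
  shows "x i = 0"
proof -
  have "cf (\<lambda>i. cnj (x i)) (\<lambda>i. 0) = 0" by (simp add: cform_def)
  then have "Im (of_real (\<Sum>j\<in>J. (cmod (cf (cq j) x))\<^sup>2) - z * of_real (nsq x)) = 0"
    using res_sol_energy[OF assms(1)] by simp
  then have "nsq x = 0" using assms(2) by simp
  then have "samp_op J x i = 0" by (simp add: samp_op_def nsq_eq_0_cform)
  then have "z * x i = 0" using assms(1,3) unfolding res_sol_def by auto
  then show ?thesis using assms(2) by auto
qed

lemma res_sol_diff:
  "res_sol J z w x \<Longrightarrow> res_sol J z w' x' \<Longrightarrow> res_sol J z (\<lambda>i. w i - c * w' i) (\<lambda>i. x i - c * x' i)"
  unfolding res_sol_def by (simp add: samp_op_linear algebra_simps)

lemma res_sol_unique: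
  assumes "res_sol J z w x" "res_sol J z w' x'" "Im z > 0" "\<And>i. i < m \<Longrightarrow> w i = c * w' i" "i < m"
  shows "x i = c * x' i"
proof -
  have "res_sol J z (\<lambda>i. 0) (\<lambda>i. x i - c * x' i)"
    using res_sol_diff[OF assms(1,2), of c] assms(4) unfolding res_sol_def by auto
  from res_sol_zero[OF this assms(3,5)] show ?thesis by simp
qed

text \<open>Says that T W is a complex symmetric matrix when W is the resolvent.\<close>

lemma res_sol_symmetric:
  assumes "res_sol J z w x" "res_sol J z w' x'"
  shows "cf w x' = cf w' x"
proof -
  have "cf w x' = cf x' (\<lambda>i. samp_op J x i - z * x i)"
    using assms(1) unfolding res_sol_def by (subst cform_commute) (intro cform_cong, auto)
  also have "\<dots> = cf x (\<lambda>i. samp_op J x' i - z * x' i)"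
    by (simp add: cform_linear cform_samp_op cform_commute[of x x'] mult.commute)
  also have "\<dots> = cf x w'"
    using assms(2) unfolding res_sol_def by (intro cform_cong) auto
  finally show ?thesis by (simp add: cform_commute)
qed

text \<open>The column added last: \<open>x0\<close> solves the equation without it, \<open>x\<close> with it.\<close>

lemma res_sol_insert:
  assumes "finite J" "j \<notin> J" "res_sol J z (cq j) x0" "res_sol (insert j J) z (cq j) x" "Im z > 0"
  shows "i < m \<Longrightarrow> x0 i = (1 + cf (cq j) x0) * x i"
    and "(1 + cf (cq j) x0) * (1 - cf (cq j) x) = 1"
proof -
  have op: "samp_op (insert j J) x0 i = cf (cq j) x0 * cq j i + samp_op J x0 i" for i
    using assms(1,2) by (simp add: samp_op_def mult.commute)
  \<comment> \<open>In the equation with the new column, \<open>x0\<close> has a right-hand side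
    proportional to that of \<open>x\<close>; uniqueness makes the solutions proportional.\<close>
  have "res_sol (insert j J) z (\<lambda>i. (1 + cf (cq j) x0) * cq j i) x0"
    using assms(3) unfolding res_sol_def op by (auto simp: algebra_simps)
  from res_sol_unique[OF this assms(4,5) refl]
  show *: "x0 i = (1 + cf (cq j) x0) * x i" if "i < m" for i
    using that by blast
  have "cf (cq j) x0 = cf (cq j) (\<lambda>i. (1 + cf (cq j) x0) * x i)"
    by (intro cform_cong refl *)
  then have "cf (cq j) x0 = (1 + cf (cq j) x0) * cf (cq j) x"
    by (simp add: cform_linear)
  then show "(1 + cf (cq j) x0) * (1 - cf (cq j) x) = 1"
    by (simp add: algebra_simps)
qed

end

section \<open>Resolvent matrices, rank-one updates, and the form Im z * Im (T W)\<close>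

definition ind_vec :: "nat \<Rightarrow> nat \<Rightarrow> 'a::zero_neq_one" where
  "ind_vec k i = (if i = k then 1 else 0)"

lemma sum_ind_vec [simp]:
  fixes f :: "nat \<Rightarrow> 'a::semiring_1"
  shows "k < m \<Longrightarrow> (\<Sum>i<m. f i * ind_vec k i) = f k"
    "k < m \<Longrightarrow> (\<Sum>i<m. ind_vec k i * f i) = f k"
proof -
  assume "k < m"
  have "(\<Sum>i<m. f i * ind_vec k i) = (\<Sum>i<m. if i = k then f i else 0)"
    "(\<Sum>i<m. ind_vec k i * f i) = (\<Sum>i<m. if i = k then f i else 0)"
    by (intro sum.cong refl, simp add: ind_vec_def)+
  then show "(\<Sum>i<m. f i * ind_vec k i) = f k" "(\<Sum>i<m. ind_vec k i * f i) = f k"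
    using \<open>k < m\<close> by simp_all
qed

definition mvec :: "nat \<Rightarrow> (nat \<Rightarrow> nat \<Rightarrow> 'a::comm_semiring_0) \<Rightarrow> (nat \<Rightarrow> 'a) \<Rightarrow> nat \<Rightarrow> 'a" where
  "mvec m A x i = (\<Sum>k<m. A i k * x k)"

lemma mvec_ind_vec: "k < m \<Longrightarrow> mvec m A (ind_vec k) = (\<lambda>i. A i k)" for A :: "nat \<Rightarrow> nat \<Rightarrow> 'a::comm_semiring_1"
  by (simp add: fun_eq_iff mvec_def)

text \<open>For a resolvent W at z and \<epsilon> = Im z this is also \<epsilon>^2 W^* T W
  (\<open>res_form_quadratic\<close>). Being linear in W it has a computable trace, being a square
  it is positive; both sides are used. It is the B of the overview.\<close>

definition res_form :: "nat \<Rightarrow> (nat \<Rightarrow> nat \<Rightarrow> real) \<Rightarrow> real \<Rightarrow> (nat \<Rightarrow> nat \<Rightarrow> complex) \<Rightarrow> nat \<Rightarrow> nat \<Rightarrow> real" where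
  "res_form m T \<epsilon> W i k = \<epsilon> * Im (\<Sum>l<m. complex_of_real (T i l) * W l k)"

lemma rform_mvec: "rform m B y w = (\<Sum>i<m. y i * mvec m B w i)"
  unfolding rform_def mvec_def by (simp add: sum_distrib_left mult.assoc)

context sample_form
begin

definition resolvent :: "nat set \<Rightarrow> complex \<Rightarrow> (nat \<Rightarrow> nat \<Rightarrow> complex) \<Rightarrow> bool" where
  "resolvent J z W \<longleftrightarrow> (\<forall>k<m. res_sol J z (ind_vec k) (\<lambda>i. W i k))"

lemma resolvent_apply:
  assumes "resolvent J z W"
  shows "res_sol J z w (mvec m W w)"
  unfolding res_sol_def
proof (intro allI impI)
  fix i assume i: "i < m"
  have "samp_op J (mvec m W w) i = (\<Sum>k<m. w k * samp_op J (\<lambda>i. W i k) i)"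
  proof -
    have "mvec m W w = (\<lambda>i. \<Sum>k<m. w k * W i k)"
      by (simp add: mvec_def fun_eq_iff mult.commute)
    then show ?thesis by (simp only: samp_op_linear)
  qed
  moreover have "z * mvec m W w i = (\<Sum>k<m. w k * (z * W i k))"
    by (simp add: mvec_def sum_distrib_left algebra_simps)
  ultimately have "samp_op J (mvec m W w) i - z * mvec m W w i
      = (\<Sum>k<m. w k * (samp_op J (\<lambda>i. W i k) i - z * W i k))"
    by (simp add: sum_subtractf right_diff_distrib)
  also have "\<dots> = (\<Sum>k<m. w k * ind_vec k i)"
    using assms i unfolding resolvent_def res_sol_def by (intro sum.cong refl) auto
  also have "\<dots> = w i" using i by (simp add: ind_vec_def if_distrib cong: if_cong)
  finally show "samp_op J (mvec m W w) i - z * mvec m W w i = w i" .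
qed

text \<open>The trace of M W = I + z W, where M W is a sum of rank-one matrices.\<close>

lemma resolvent_trace:
  assumes "resolvent J z W"
  shows "(\<Sum>j\<in>J. cf (cq j) (mvec m W (cq j))) = of_nat m + z * (\<Sum>k<m. W k k)"
proof -
  have "(\<Sum>j\<in>J. cf (cq j) (mvec m W (cq j))) = (\<Sum>j\<in>J. \<Sum>k<m. cq j k * cf (cq j) (\<lambda>i. W i k))"
  proof (intro sum.cong refl)
    fix j
    have "mvec m W (cq j) = (\<lambda>i. \<Sum>k<m. cq j k * W i k)"
      by (simp add: mvec_def fun_eq_iff mult.commute)
    then show "cf (cq j) (mvec m W (cq j)) = (\<Sum>k<m. cq j k * cf (cq j) (\<lambda>i. W i k))"
      by (simp only: cform_linear)
  qed
  also have "\<dots> = (\<Sum>k<m. samp_op J (\<lambda>i. W i k) k)"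
    unfolding samp_op_def by (rule sum.swap)
  also have "\<dots> = (\<Sum>k<m. 1 + z * W k k)"
    using assms unfolding resolvent_def res_sol_def
    by (intro sum.cong refl) (auto simp: ind_vec_def algebra_simps)
  finally show ?thesis by (simp add: sum.distrib sum_distrib_left)
qed

context
  fixes J z j x0
  assumes x0: "res_sol J z (cq j) x0" and z: "Im z > 0"
begin

private lemma rho: "cf (cq j) x0 = of_real (\<Sum>j\<in>J. (cmod (cf (cq j) x0))\<^sup>2) - cnj z * of_real (nsq x0)"
  using res_sol_energy_real[OF x0] .

lemma Im_one_plus: "Im (1 + cf (cq j) x0) = Im z * nsq x0"
  by (subst rho) simp

text \<open>Multiplication by z turns the term with cnj z into a real one, so only Im z and a
  nonnegative sum contribute.\<close>

lemma Im_z_one_plus: "Im z \<le> Im (z * (1 + cf (cq j) x0))"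
proof -
  let ?S = "\<Sum>j\<in>J. (cmod (cf (cq j) x0))\<^sup>2"
  have "Im (z * (1 + cf (cq j) x0)) = Im z + Im z * ?S"
    by (subst rho) (simp add: algebra_simps)
  moreover have "0 \<le> Im z * ?S" using z by (intro mult_nonneg_nonneg sum_nonneg) auto
  ultimately show ?thesis by simp
qed

lemma one_plus_nonzero: "1 + cf (cq j) x0 \<noteq> 0"
  using Im_z_one_plus z by force

text \<open>Strong when \<open>nsq x0\<close> is large; this is the bound for the typical
  columns.\<close>

lemma norm_inverse_one_plus_nsq: "cmod (inverse (1 + cf (cq j) x0)) * (Im z * nsq x0) \<le> 1"
proof -
  have "Im z * nsq x0 \<le> cmod (1 + cf (cq j) x0)"
    using abs_Im_le_cmod[of "1 + cf (cq j) x0"] Im_one_plus by linarith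
  moreover have "cmod (1 + cf (cq j) x0) > 0" using one_plus_nonzero by simp
  ultimately have "Im z * nsq x0 / cmod (1 + cf (cq j) x0) \<le> 1"
    by (simp only: divide_le_eq_1 simp_thms)
  then show ?thesis unfolding norm_inverse by (simp add: divide_inverse mult.commute)
qed

text \<open>A crude bound valid for every column, kept for the few exceptional ones.\<close>

lemma norm_inverse_one_plus: "cmod (inverse (1 + cf (cq j) x0)) * Im z \<le> cmod z"
proof -
  have "Im z \<le> cmod z * cmod (1 + cf (cq j) x0)"
    using abs_Im_le_cmod[of "z * (1 + cf (cq j) x0)"] Im_z_one_plus by (simp add: norm_mult)
  moreover have "cmod (1 + cf (cq j) x0) > 0" using one_plus_nonzero by simp
  ultimately have "Im z / cmod (1 + cf (cq j) x0) \<le> cmod z"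
    by (simp only: pos_divide_le_eq)
  then show ?thesis unfolding norm_inverse by (simp add: divide_inverse mult.commute)
qed

lemma Re_inverse_one_plus: "Re z = 0 \<Longrightarrow> 0 \<le> Re (inverse (1 + cf (cq j) x0))"
proof -
  assume "Re z = 0"
  then have "Re (1 + cf (cq j) x0) = 1 + (\<Sum>j\<in>J. (cmod (cf (cq j) x0))\<^sup>2)"
    by (subst rho) simp
  moreover have "0 \<le> (\<Sum>j\<in>J. (cmod (cf (cq j) x0))\<^sup>2)" by (intro sum_nonneg) auto
  ultimately have "0 \<le> Re (1 + cf (cq j) x0)" by linarith
  then show ?thesis by (simp only: inverse_complex.simps zero_le_divide_iff) simp
qed

end

text \<open>The rank-one update changes the trace by b times \<open>cf x0 x0\<close> with b the
  inverse denominator; the modulus of that form value is at most \<open>nsq x0\<close>, which the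
  denominator compensates.\<close>

lemma resolvent_insert_trace:
  assumes J: "finite J" "j \<notin> J" and z: "Im z > 0"
    and W0: "resolvent J z W0" and W: "resolvent (insert j J) z W"
  shows "cmod ((\<Sum>k<m. W0 k k) - (\<Sum>k<m. W k k)) \<le> 1 / Im z"
proof -
  define x0 where "x0 = mvec m W0 (cq j)"
  define x where "x = mvec m W (cq j)"
  note sol0 = resolvent_apply[OF W0, of "cq j", folded x0_def]
  note sol = resolvent_apply[OF W, of "cq j", folded x_def]
  note nz = one_plus_nonzero[OF sol0 z]
  define b where "b = inverse (1 + cf (cq j) x0)"
  have x_eq: "x i = b * x0 i" if "i < m" for i
    using res_sol_insert(1)[OF J sol0 sol z that] nz by (simp add: b_def field_simps)
  have entry: "W0 k k - W k k = b * (cf (cq j) (\<lambda>i. W0 i k) * x0 k)" if k: "k < m" for k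
  proof -
    let ?c = "cf (cq j) (\<lambda>i. W0 i k)"
    have op: "samp_op (insert j J) (\<lambda>i. W0 i k) i = ?c * cq j i + samp_op J (\<lambda>i. W0 i k) i" for i
      using J by (simp add: samp_op_def mult.commute)
    \<comment> \<open>Column k of W0 satisfies the enlarged equation with an extra multiple of q_j
      on the right; adding the same multiple of \<open>x\<close> to column k of W gives another
      solution.\<close>
    have "res_sol (insert j J) z (\<lambda>i. ind_vec k i + ?c * cq j i) (\<lambda>i. W0 i k)"
      using W0 k unfolding resolvent_def res_sol_def op by (auto simp: algebra_simps)
    moreover have "res_sol (insert j J) z (\<lambda>i. ind_vec k i + ?c * cq j i) (\<lambda>i. W i k + ?c * x i)"
      using W k sol unfolding resolvent_def res_sol_def samp_op_linear by (auto simp: algebra_simps)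
    ultimately have "W0 k k = 1 * (W k k + ?c * x k)"
      by (rule res_sol_unique[OF _ _ z _ k]) simp
    then show ?thesis by (simp add: x_eq[OF k])
  qed
  have "(\<Sum>k<m. W0 k k) - (\<Sum>k<m. W k k) = b * (\<Sum>k<m. cf (cq j) (\<lambda>i. W0 i k) * x0 k)"
    unfolding sum_subtractf[symmetric] sum_distrib_left by (intro sum.cong refl entry) auto
  also have "(\<Sum>k<m. cf (cq j) (\<lambda>i. W0 i k) * x0 k) = cf (cq j) (mvec m W0 x0)"
  proof -
    have "mvec m W0 x0 = (\<lambda>i. \<Sum>k<m. x0 k * W0 i k)"
      by (simp add: mvec_def fun_eq_iff mult.commute)
    then show ?thesis by (simp add: cform_linear mult.commute)
  qed
  also have "\<dots> = cf x0 x0"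
    using res_sol_symmetric[OF sol0 resolvent_apply[OF W0]] .
  finally have eq: "(\<Sum>k<m. W0 k k) - (\<Sum>k<m. W k k) = b * cf x0 x0" .
  have "cmod (b * cf x0 x0) * Im z \<le> cmod b * (Im z * nsq x0)"
    using mult_left_mono[OF norm_cform_self_le[of x0], of "cmod b * Im z"] z
    by (simp add: norm_mult algebra_simps)
  also have "\<dots> \<le> 1"
    unfolding b_def by (rule norm_inverse_one_plus_nsq[OF sol0 z])
  finally show ?thesis unfolding eq using z by (simp add: field_simps)
qed

lemma res_form_apply:
  "mvec m (res_form m T \<epsilon> W) w i = \<epsilon> * (\<Sum>l<m. T i l * Im (mvec m W (\<lambda>k. of_real (w k)) l))"
proof -
  have "mvec m (res_form m T \<epsilon> W) w i = \<epsilon> * (\<Sum>k<m. \<Sum>l<m. T i l * (Im (W l k) * w k))"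
    unfolding mvec_def res_form_def
    by (simp add: sum_distrib_left sum_distrib_right algebra_simps)
  also have "(\<Sum>k<m. \<Sum>l<m. T i l * (Im (W l k) * w k)) = (\<Sum>l<m. T i l * (\<Sum>k<m. Im (W l k) * w k))"
    unfolding sum_distrib_left by (rule sum.swap)
  finally show ?thesis by (simp add: mvec_def)
qed

lemma res_form_pairing:
  "(\<Sum>i<m. y i * mvec m (res_form m T \<epsilon> W) w i) = \<epsilon> * rf y (\<lambda>i. Im (mvec m W (\<lambda>k. of_real (w k)) i))"
  unfolding res_form_apply rform_def by (simp add: sum_distrib_left algebra_simps)

lemma rform_res_form:
  "rform m (res_form m T \<epsilon> W) y w = \<epsilon> * rf y (\<lambda>i. Im (mvec m W (\<lambda>k. of_real (w k)) i))"
  unfolding rform_mvec[of m "res_form m T \<epsilon> W"] res_form_pairing ..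

lemma Im_cform_real: "Im (cf (\<lambda>i. of_real (y i)) x) = rf y (\<lambda>i. Im (x i))"
proof -
  have "rf (\<lambda>i. 0) u = 0" for u by (simp add: rform_def)
  then show ?thesis unfolding cform_Re_Im by simp
qed

context
  fixes J z W
  assumes W: "resolvent J z W" and z: "Im z > 0"
begin

text \<open>The imaginary part of the energy identity; positivity of the form follows.\<close>

lemma res_form_quadratic:
  "rform m (res_form m T (Im z) W) w w = (Im z)\<^sup>2 * nsq (mvec m W (\<lambda>k. of_real (w k)))"
  unfolding rform_res_form Im_cform_real[symmetric]
    res_sol_energy_real[OF resolvent_apply[OF W]] by (simp add: power2_eq_square)

lemma res_form_sym:
  assumes "i < m" "k < m"
  shows "res_form m T (Im z) W i k = res_form m T (Im z) W k i"
proof -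
  have *: "cf (ind_vec i) x = (\<Sum>l<m. of_real (T i l) * x l)" if "i < m" for i x
  proof -
    have "cf (ind_vec i) x = (\<Sum>l<m. (\<Sum>i'<m. ind_vec i i' * of_real (T i' l)) * x l)"
      unfolding cform_def sum_distrib_right by (rule sum.swap)
    then show ?thesis using that by simp
  qed
  show ?thesis
    unfolding res_form_def using res_sol_symmetric[of J z "ind_vec i" "\<lambda>l. W l i" "ind_vec k" "\<lambda>l. W l k"]
      W assms * unfolding resolvent_def by simp
qed

lemma res_form_psd_form: "psd_form m (res_form m T (Im z) W)"
  by unfold_locales (auto simp: res_form_sym res_form_quadratic nsq_nonneg)

text \<open>By the arithmetic-geometric inequality twice B(w,w) is at most T(w,w) plus (Im z)^2 T(Im
  x, Im x), and the last term is at most B(w,w) again, so one copy is absorbed.\<close>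

lemma res_form_le: "rform m (res_form m T (Im z) W) w w \<le> rf w w"
proof -
  define x where "x = mvec m W (\<lambda>k. complex_of_real (w k))"
  have "rform m (res_form m T (Im z) W) w w = rf w (\<lambda>i. Im z * Im (x i))"
    unfolding rform_res_form x_def by (simp add: rform_linear)
  also have "2 * \<dots> \<le> rf w w + rf (\<lambda>i. Im z * Im (x i)) (\<lambda>i. Im z * Im (x i))"
    using rform_abs_le[of w "\<lambda>i. Im z * Im (x i)"] by linarith
  also have "rf (\<lambda>i. Im z * Im (x i)) (\<lambda>i. Im z * Im (x i)) \<le> (Im z)\<^sup>2 * nsq x"
    using T_psd[of "\<lambda>i. Re (x i)"]
    using z by (simp add: rform_linear nsq_def power2_eq_square mult.assoc)
  also have "\<dots> = rform m (res_form m T (Im z) W) w w"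
    unfolding res_form_quadratic x_def ..
  finally show ?thesis by simp
qed

text \<open>In matrix terms B S B \<le> (Re z + Im z) B. The imaginary part of the resolvent
  equation expresses S T (Im x) through Im x and Re x; pairing with Im x leaves terms bounded by
  \<open>nsq x\<close>.\<close>

lemma res_form_samples:
  assumes "Re z \<ge> 0"
  shows "(\<Sum>j\<in>J. (\<Sum>i<m. q j i * mvec m (res_form m T (Im z) W) w i)\<^sup>2)
     \<le> (Re z + Im z) * rform m (res_form m T (Im z) W) w w"
proof -
  define x where "x = mvec m W (\<lambda>k. complex_of_real (w k))"
  define u where "u = (\<lambda>i. Re (x i))"
  define v where "v = (\<lambda>i. Im (x i))"
  have sol: "res_sol J z (\<lambda>k. of_real (w k)) x"
    unfolding x_def by (rule resolvent_apply[OF W])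
  have "(\<Sum>j\<in>J. (rf (q j) v)\<^sup>2) = rf v (\<lambda>i. \<Sum>j\<in>J. rf (q j) v * q j i)"
    unfolding rform_linear by (simp add: power2_eq_square rform_commute[of v])
  also have "\<dots> = rf v (\<lambda>i. Re z * v i + Im z * u i)"
  proof (intro rform_cong refl)
    fix i assume "i < m"
    then have "Im (samp_op J x i - z * x i) = Im (of_real (w i))"
      using sol unfolding res_sol_def by metis
    then show "(\<Sum>j\<in>J. rf (q j) v * q j i) = Re z * v i + Im z * u i"
      by (simp add: samp_op_def Im_cform_real u_def v_def algebra_simps)
  qed
  also have "\<dots> = Re z * rf v v + Im z * rf v u" by (simp add: rform_linear)
  also have "\<dots> \<le> Re z * nsq x + Im z * nsq x"
  proof (intro add_mono mult_left_mono)
    show "rf v v \<le> nsq x" using T_psd[of u] unfolding nsq_def u_def v_def by simp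
    show "rf v u \<le> nsq x" using rform_abs_le[of v u] T_psd[of u] T_psd[of v]
      unfolding nsq_def u_def[symmetric] v_def[symmetric] by linarith
  qed (use assms z in auto)
  finally have "(Im z)\<^sup>2 * (\<Sum>j\<in>J. (rf (q j) v)\<^sup>2) \<le> (Im z)\<^sup>2 * (Re z * nsq x + Im z * nsq x)"
    by (intro mult_left_mono) auto
  then show ?thesis
    unfolding res_form_quadratic res_form_pairing x_def[symmetric] v_def[symmetric]
    by (simp add: power_mult_distrib sum_distrib_left algebra_simps)
qed

lemma res_form_trace_samples:
  "(\<Sum>j\<in>J. rform m (res_form m T (Im z) W) (q j) (q j)) = Im z * Im (z * (\<Sum>k<m. W k k))"
proof -
  have "(\<Sum>j\<in>J. rform m (res_form m T (Im z) W) (q j) (q j)) = (\<Sum>j\<in>J. Im z * Im (cf (cq j) (mvec m W (cq j))))"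
    unfolding rform_res_form Im_cform_real ..
  also have "\<dots> = Im z * Im (\<Sum>j\<in>J. cf (cq j) (mvec m W (cq j)))"
    by (simp add: sum_distrib_left)
  finally show ?thesis unfolding resolvent_trace[OF W] by simp
qed

text \<open>tr (S B) pairs the entries of the vectors q_j with those of B q_j, so its square is at
  most tr S times tr (B S B). Testing the previous operator inequality on the basis vectors bounds
  the second factor by a multiple of tr B.\<close>

lemma res_form_trace_lower:
  assumes "Re z \<ge> 0" "finite J"
  shows "(\<Sum>j\<in>J. rform m (res_form m T (Im z) W) (q j) (q j))\<^sup>2
     \<le> (\<Sum>j\<in>J. \<Sum>i<m. (q j i)\<^sup>2) * ((Re z + Im z) * (\<Sum>i<m. res_form m T (Im z) W i i))"
proof -
  let ?B = "res_form m T (Im z) W"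
  interpret B: psd_form m ?B by (rule res_form_psd_form)
  have eq: "(\<Sum>j\<in>J. rform m ?B (q j) (q j)) = (\<Sum>(j, i)\<in>J \<times> {..<m}. q j i * mvec m ?B (q j) i)"
    unfolding rform_mvec by (rule sum.cartesian_product)
  have "(\<Sum>j\<in>J. rform m ?B (q j) (q j))\<^sup>2 \<le> (\<Sum>(j, i)\<in>J \<times> {..<m}. (q j i)\<^sup>2) * (\<Sum>(j, i)\<in>J \<times> {..<m}. (mvec m ?B (q j) i)\<^sup>2)"
    unfolding eq case_prod_unfold by (rule Cauchy_Schwarz_ineq_sum)
  also have "\<dots> = (\<Sum>j\<in>J. \<Sum>i<m. (q j i)\<^sup>2) * (\<Sum>i<m. \<Sum>j\<in>J. (mvec m ?B (q j) i)\<^sup>2)"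
  proof (rule arg_cong2[of _ _ _ _ times])
    show "(\<Sum>(j, i)\<in>J \<times> {..<m}. (q j i)\<^sup>2) = (\<Sum>j\<in>J. \<Sum>i<m. (q j i)\<^sup>2)"
      by (rule sum.cartesian_product[symmetric])
    have "(\<Sum>(j, i)\<in>J \<times> {..<m}. (mvec m ?B (q j) i)\<^sup>2) = (\<Sum>j\<in>J. \<Sum>i<m. (mvec m ?B (q j) i)\<^sup>2)"
      by (rule sum.cartesian_product[symmetric])
    also have "\<dots> = (\<Sum>i<m. \<Sum>j\<in>J. (mvec m ?B (q j) i)\<^sup>2)"
      by (rule sum.swap)
    finally show "(\<Sum>(j, i)\<in>J \<times> {..<m}. (mvec m ?B (q j) i)\<^sup>2) = (\<Sum>i<m. \<Sum>j\<in>J. (mvec m ?B (q j) i)\<^sup>2)" .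
  qed
  also have "\<dots> \<le> (\<Sum>j\<in>J. \<Sum>i<m. (q j i)\<^sup>2) * (\<Sum>i<m. (Re z + Im z) * ?B i i)"
  proof (intro mult_left_mono sum_mono)
    fix i assume "i \<in> {..<m}"
    then have i: "i < m" by simp
    have row: "mvec m ?B y i = (\<Sum>k<m. y k * mvec m ?B (ind_vec i) k)" for y
      unfolding mvec_ind_vec[OF i] unfolding mvec_def
      using i by (intro sum.cong refl) (simp add: res_form_sym)
    have "(\<Sum>j\<in>J. (mvec m ?B (q j) i)\<^sup>2) \<le> (Re z + Im z) * rform m ?B (ind_vec i) (ind_vec i)"
      unfolding row by (rule res_form_samples[OF assms(1)])
    also have "rform m ?B (ind_vec i) (ind_vec i) = ?B i i"
      unfolding rform_mvec mvec_ind_vec[OF i] using i by simp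
    finally show "(\<Sum>j\<in>J. (mvec m ?B (q j) i)\<^sup>2) \<le> (Re z + Im z) * ?B i i" .
  qed (intro sum_nonneg, auto)
  finally show ?thesis by (simp add: sum_distrib_left)
qed

end
end

section \<open>Eigenvalues of the sample matrix and the trace of its resolvent\<close>

definition samp_mat :: "nat \<Rightarrow> (nat \<Rightarrow> nat \<Rightarrow> real) \<Rightarrow> (nat \<Rightarrow> nat \<Rightarrow> real) \<Rightarrow> nat set \<Rightarrow> nat \<Rightarrow> nat \<Rightarrow> real" where
  "samp_mat m T q J i k = (\<Sum>j\<in>J. q j i * (\<Sum>l<m. q j l * T l k))"

definition pencil :: "nat \<Rightarrow> (nat \<Rightarrow> nat \<Rightarrow> real) \<Rightarrow> (nat \<Rightarrow> nat \<Rightarrow> real) \<Rightarrow> nat set \<Rightarrow> complex \<Rightarrow> complex mat" where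
  "pencil m T q J z = Matrix.mat m m (\<lambda>(i, k). (if i = k then z else 0) - of_real (samp_mat m T q J i k))"

text \<open>Cramer's rule for the inverse of M - z. An explicit rational formula makes the entries
  measurable functions of the data.\<close>

definition res_mat :: "nat \<Rightarrow> (nat \<Rightarrow> nat \<Rightarrow> real) \<Rightarrow> (nat \<Rightarrow> nat \<Rightarrow> real) \<Rightarrow> nat set \<Rightarrow> complex \<Rightarrow> nat \<Rightarrow> nat \<Rightarrow> complex" where
  "res_mat m T q J z i k = - (adj_mat (pencil m T q J z) $$ (i, k)) / Determinant.det (pencil m T q J z)"

lemma poly_char_poly:
  fixes A :: "complex mat"
  assumes A: "A \<in> carrier_mat n n"
  shows "poly (char_poly A) z = Determinant.det (Matrix.mat n n (\<lambda>(i, k). (if i = k then z else 0) - A $$ (i, k)))"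
  unfolding char_poly_def
  by (rule poly_det_cong[of _ n]) (use A in \<open>auto simp: char_poly_matrix_def\<close>)

text \<open>The logarithmic derivative of a split polynomial, needed because it is minus the trace
  of the resolvent.\<close>

lemma pderiv_linear_factors:
  fixes z :: "'a::field_char_0"
  assumes "z \<notin> set es"
  shows "poly (pderiv (\<Prod>a\<leftarrow>es. [:- a, 1:])) z = poly (\<Prod>a\<leftarrow>es. [:- a, 1:]) z * (\<Sum>a\<leftarrow>es. 1 / (z - a))"
  using assms
proof (induction es)
  case (Cons a es)
  let ?P = "\<Prod>a\<leftarrow>es. [:- a, 1:]"
  have nz: "z - a \<noteq> 0" using Cons.prems by auto
  have "poly (pderiv ([:- a, 1:] * ?P)) z = poly ?P z + (z - a) * poly (pderiv ?P) z"
    unfolding pderiv_mult by (simp add: pderiv_pCons algebra_simps)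
  also have "\<dots> = (z - a) * poly ?P z * (1 / (z - a) + (\<Sum>a\<leftarrow>es. 1 / (z - a)))"
    using Cons nz by (simp add: distrib_left mult.assoc)
  also have "\<dots> = poly ([:- a, 1:] * ?P) z * (\<Sum>a\<leftarrow>a # es. 1 / (z - a))"
    unfolding poly_mult by simp
  finally show ?case by (simp only: list.map prod_list.Cons)
qed simp

lemma poly_linear_factors: "poly (\<Prod>a\<leftarrow>es. [:- a, 1:]) z = (\<Prod>a\<leftarrow>es. z - a)"
  for z :: "'a::comm_ring_1"
  by (simp add: poly_prod_list o_def)

lemma order_linear_factors:
  "order (r::real) (\<Prod>a\<leftarrow>es. [:- a, 1:]) = count_list es r"
proof -
  have "order r (\<Prod>a\<leftarrow>es. [:- a, 1:]) = (\<Sum>a\<leftarrow>es. if a = r then 1 else 0)"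
    by (subst order_prod_list) (auto simp: o_def order_linear' intro!: arg_cong[of _ _ sum_list])
  also have "\<dots> = count_list es r" by (induction es) auto
  finally show ?thesis .
qed

lemma sum_count_list_filter:
  "(\<Sum>r\<in>{r \<in> set es. P r}. real (count_list es r)) = real (length (filter P es))"
proof -
  have "(\<Sum>r\<in>{r \<in> set es. P r}. count_list es r) = (\<Sum>r\<in>set (filter P es). count_list (filter P es) r)"
    by (rule sum.cong) (auto simp: count_list_eq_length_filter intro!: arg_cong[of _ _ length] filter_cong)
  also have "\<dots> = length (filter P es)" by (rule sum_count_set) auto
  finally show ?thesis by (metis of_nat_sum)
qed

lemma esd_linear_factors:
  assumes "char_poly A = (\<Prod>a\<leftarrow>es. [:- a, 1:])" "dim_row A = length es"
  shows "esd A x = real (length (filter (\<lambda>r. r \<le> x) es)) / real (length es)"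
proof -
  have "{r. poly (char_poly A) r = 0 \<and> r \<le> x} = {r \<in> set es. r \<le> x}"
    unfolding assms(1) poly_linear_factors by (auto simp: prod_list_zero_iff)
  then show ?thesis
    unfolding esd_def assms by (simp add: order_linear_factors sum_count_list_filter)
qed

context sample_form
begin

lemma samp_op_mat: "samp_op J x i = (\<Sum>k<m. of_real (samp_mat m T q J i k) * x k)"
proof -
  have "cf (cq j) x = (\<Sum>k<m. of_real (\<Sum>l<m. q j l * T l k) * x k)" for j
    unfolding cform_def by (simp add: sum_distrib_right) (rule sum.swap)
  then have "samp_op J x i = (\<Sum>j\<in>J. \<Sum>k<m. of_real (q j i * (\<Sum>l<m. q j l * T l k)) * x k)"
    unfolding samp_op_def of_real_mult by (simp add: sum_distrib_left mult.assoc del: of_real_sum)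
  also have "\<dots> = (\<Sum>k<m. \<Sum>j\<in>J. of_real (q j i * (\<Sum>l<m. q j l * T l k)) * x k)"
    by (rule sum.swap)
  finally show ?thesis
    unfolding samp_mat_def of_real_sum sum_distrib_right .
qed

lemma pencil_mult:
  assumes "i < m"
  shows "(\<Sum>k<m. pencil m T q J z $$ (i, k) * x k) = z * x i - samp_op J x i"
proof -
  have "(\<Sum>k<m. pencil m T q J z $$ (i, k) * x k)
      = (\<Sum>k<m. (if k = i then z * x k else 0) - of_real (samp_mat m T q J i k) * x k)"
    using assms unfolding pencil_def by (intro sum.cong refl) (auto simp: algebra_simps)
  then show ?thesis using assms by (simp add: sum_subtractf samp_op_mat)
qed

lemma det_pencil_eq_0:
  assumes "Determinant.det (pencil m T q J z) = 0"
  obtains x where "res_sol J z (\<lambda>i. 0) x" "\<exists>i<m. x i \<noteq> 0"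
proof -
  have C: "pencil m T q J z \<in> carrier_mat m m" by (simp add: pencil_def)
  obtain v where v: "v \<in> carrier_vec m" "v \<noteq> 0\<^sub>v m" "pencil m T q J z *\<^sub>v v = 0\<^sub>v m"
    using assms det_0_iff_vec_prod_zero[OF C] by auto
  have "z * (v $ i) - samp_op J (($) v) i = 0" if i: "i < m" for i
  proof -
    have "(pencil m T q J z *\<^sub>v v) $ i = 0" using v i by simp
    then show ?thesis
      using pencil_mult[OF i, of J z "($) v"] v(1) i C
      by (simp add: scalar_prod_def atLeast0LessThan)
  qed
  then have "res_sol J z (\<lambda>i. 0) (($) v)" by (auto simp: res_sol_def)
  moreover have "\<exists>i<m. v $ i \<noteq> 0"
  proof (rule ccontr)
    assume "\<not> ?thesis"
    then have "v = 0\<^sub>v m" using v(1) by (intro eq_vecI) auto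
    then show False using v(2) by simp
  qed
  ultimately show ?thesis using that by blast
qed

lemma det_pencil: "Im z > 0 \<Longrightarrow> Determinant.det (pencil m T q J z) \<noteq> 0"
  using det_pencil_eq_0 res_sol_zero by metis

lemma resolvent_res_mat:
  assumes "Im z > 0"
  shows "resolvent J z (res_mat m T q J z)"
  unfolding resolvent_def res_sol_def
proof (intro allI impI)
  fix k i assume ki: "k < m" "i < m"
  let ?A = "pencil m T q J z"
  have C: "?A \<in> carrier_mat m m" by (simp add: pencil_def)
  have "(?A * adj_mat ?A) $$ (i, k) = (\<Sum>l<m. ?A $$ (i, l) * adj_mat ?A $$ (l, k))"
    using ki C adj_mat(1)[OF C] by (simp add: scalar_prod_def atLeast0LessThan)
  then have "(\<Sum>l<m. ?A $$ (i, l) * adj_mat ?A $$ (l, k)) = Determinant.det ?A * ind_vec k i"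
    using ki unfolding adj_mat(2)[OF C] by (simp add: ind_vec_def)
  then have "(\<Sum>l<m. ?A $$ (i, l) * res_mat m T q J z l k) = - ind_vec k i"
    using det_pencil[OF assms, of J] unfolding res_mat_def
    by (simp add: sum_negf flip: sum_divide_distrib)
  then show "samp_op J (\<lambda>i. res_mat m T q J z i k) i - z * res_mat m T q J z i k = ind_vec k i"
    using pencil_mult[OF ki(2), of J z "\<lambda>i. res_mat m T q J z i k"] by (simp add: algebra_simps minus_equation_iff)
qed

text \<open>For an eigenvector x with eigenvalue c the energy identity reads c *
  \<open>nsq x\<close> = a nonnegative real, so c is real and nonnegative. For the trace formula,
  the diagonal entries of the adjugate are characteristic polynomials of minors, whose sum is the
  derivative of the characteristic polynomial.\<close>

lemma samp_mat_eigenvalues: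
  assumes "finite J"
  obtains es where "length es = m" "\<And>e. e \<in> set es \<Longrightarrow> 0 \<le> e"
    "char_poly (Matrix.mat m m (\<lambda>(i, k). samp_mat m T q J i k)) = (\<Prod>e\<leftarrow>es. [:- e, 1:])"
    "\<And>z. Im z > 0 \<Longrightarrow> (\<Sum>k<m. res_mat m T q J z k k) = (\<Sum>e\<leftarrow>es. 1 / (of_real e - z))"
proof -
  define A where "A = Matrix.mat m m (\<lambda>(i, k). samp_mat m T q J i k)"
  define C where "C = map_mat complex_of_real A"
  have A: "A \<in> carrier_mat m m" and C: "C \<in> carrier_mat m m" by (auto simp: A_def C_def)
  have pencil: "pencil m T q J z = Matrix.mat m m (\<lambda>(i, k). (if i = k then z else 0) - C $$ (i, k))" for z
    unfolding pencil_def A_def C_def by (intro eq_matI) auto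
  obtain cs where cs: "char_poly C = (\<Prod>a\<leftarrow>cs. [:- a, 1:])" "length cs = m"
    using char_poly_factorized[OF C] by blast
  have real: "\<exists>e\<ge>0. c = complex_of_real e" if c: "c \<in> set cs" for c
  proof -
    have "poly (char_poly C) c = 0"
      unfolding cs(1) poly_linear_factors using c by (auto simp: prod_list_zero_iff)
    then have "Determinant.det (pencil m T q J c) = 0"
      unfolding poly_char_poly[OF C] pencil .
    then obtain x where x: "res_sol J c (\<lambda>i. 0) x" "\<exists>i<m. x i \<noteq> 0"
      by (rule det_pencil_eq_0)
    have "cf (\<lambda>i. cnj (x i)) (\<lambda>i. 0) = 0" by (simp add: cform_def)
    then have eq: "of_real (\<Sum>j\<in>J. (cmod (cf (cq j) x))\<^sup>2) = c * of_real (nsq x)"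
      using res_sol_energy[OF x(1)] by simp
    show ?thesis
    proof (cases "nsq x = 0")
      \<comment> \<open>A null vector of the form is annihilated by the operator, so its eigenvalue
        is 0.\<close>
      case True
      obtain i where "i < m" "x i \<noteq> 0" using x(2) by blast
      moreover have "\<forall>i<m. c * x i = 0" using x(1) True
        unfolding res_sol_def by (simp add: samp_op_def nsq_eq_0_cform)
      ultimately have "c = complex_of_real 0" by auto
      then show ?thesis by blast
    next
      case False
      then have "c = of_real ((\<Sum>j\<in>J. (cmod (cf (cq j) x))\<^sup>2) / nsq x)"
        using eq by (simp add: field_simps)
      then show ?thesis using nsq_nonneg[of x]
        by (intro exI[of _ "(\<Sum>j\<in>J. (cmod (cf (cq j) x))\<^sup>2) / nsq x"]) (auto intro!: divide_nonneg_nonneg sum_nonneg)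
    qed
  qed
  define es where "es = map Re cs"
  have cs_es: "cs = map complex_of_real es"
    unfolding es_def map_map by (rule sym, rule map_idI) (use real in fastforce)
  have cp: "char_poly A = (\<Prod>e\<leftarrow>es. [:- e, 1:])"
  proof -
    have "complex_of_real (poly (char_poly A) x) = complex_of_real (poly (\<Prod>e\<leftarrow>es. [:- e, 1:]) x)" for x
    proof -
      have "complex_of_real (poly (char_poly A) x) = poly (char_poly C) (of_real x)"
        unfolding C_def of_real_hom.char_poly_hom[OF A] by simp
      also have "\<dots> = complex_of_real (poly (\<Prod>e\<leftarrow>es. [:- e, 1:]) x)"
        unfolding cs(1) cs_es poly_linear_factors by (induction es) auto
      finally show ?thesis .
    qed
    then have "poly (char_poly A) = poly (\<Prod>e\<leftarrow>es. [:- e, 1:])"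
      unfolding of_real_eq_iff by (rule ext)
    then show ?thesis by (simp only: poly_eq_poly_eq_iff)
  qed
  have tr: "(\<Sum>k<m. res_mat m T q J z k k) = (\<Sum>e\<leftarrow>es. 1 / (of_real e - z))" if z: "Im z > 0" for z
  proof -
    let ?P = "pencil m T q J z"
    have P: "?P \<in> carrier_mat m m" by (simp add: pencil_def)
    have notin: "z \<notin> set cs" using z unfolding cs_es by auto
    have det: "Determinant.det ?P = poly (char_poly C) z" unfolding poly_char_poly[OF C] pencil ..
    have minor: "adj_mat ?P $$ (i, i) = poly (char_poly (mat_delete C i i)) z" if i: "i < m" for i
    proof -
      have D: "mat_delete C i i \<in> carrier_mat (m - 1) (m - 1)" using C by (rule mat_delete_carrier)
      have "mat_delete ?P i i = Matrix.mat (m - 1) (m - 1) (\<lambda>(a, b). (if a = b then z else 0) - mat_delete C i i $$ (a, b))"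
        using C i unfolding pencil mat_delete_def by (intro eq_matI) auto
      then show ?thesis
        unfolding poly_char_poly[OF D] using i P by (simp add: adj_mat_def cofactor_def power_add[symmetric] flip: mult_2)
    qed
    have "(\<Sum>k<m. res_mat m T q J z k k) = - (\<Sum>k<m. poly (char_poly (mat_delete C k k)) z) / Determinant.det ?P"
      unfolding res_mat_def by (simp add: minor sum_negf flip: sum_divide_distrib)
    also have "(\<Sum>k<m. poly (char_poly (mat_delete C k k)) z) = poly (pderiv (char_poly C)) z"
      unfolding pderiv_char_poly[OF C] by (simp add: poly_sum)
    also have "\<dots> = Determinant.det ?P * (\<Sum>a\<leftarrow>cs. 1 / (z - a))"
      unfolding det cs(1) by (rule pderiv_linear_factors[OF notin])
    finally have "(\<Sum>k<m. res_mat m T q J z k k) = - (\<Sum>a\<leftarrow>cs. 1 / (z - a))"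
      using det_pencil[OF z, of J] by simp
    also have "\<dots> = (\<Sum>a\<leftarrow>cs. 1 / (a - z))"
    proof -
      have "- (\<Sum>a\<leftarrow>cs. 1 / (z - a)) = (\<Sum>a\<leftarrow>cs. - (1 / (z - a)))"
        by (induction cs) auto
      also have "(\<lambda>a. - (1 / (z - a))) = (\<lambda>a. 1 / (a - z))"
        by (simp add: fun_eq_iff flip: divide_minus_right)
      finally show ?thesis .
    qed
    finally show ?thesis unfolding cs_es by (simp add: o_def)
  qed
  show ?thesis
  proof (rule that)
    show "length es = m" using cs(2) by (simp add: es_def)
    show "0 \<le> e" if "e \<in> set es" for e using that real unfolding es_def by fastforce
    show "char_poly (Matrix.mat m m (\<lambda>(i, k). samp_mat m T q J i k)) = (\<Prod>e\<leftarrow>es. [:- e, 1:])"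
      using cp unfolding A_def .
  qed (rule tr)
qed

end

section \<open>Spectral theorem for real symmetric matrices\<close>

lemma rform_expand_right:
  "rform n A x y = (\<Sum>l<n. y l * rform n A x (ind_vec l))"
proof -
  have "rform n A x (ind_vec l) = (\<Sum>i<n. x i * A i l)" if "l < n" for l
    unfolding rform_def using that by simp
  then have "(\<Sum>l<n. y l * rform n A x (ind_vec l)) = (\<Sum>l<n. \<Sum>i<n. x i * A i l * y l)"
    by (simp add: sum_distrib_left algebra_simps)
  also have "\<dots> = rform n A x y" unfolding rform_def by (rule sum.swap)
  finally show ?thesis ..
qed

lemma rform_symmetric:
  assumes "\<And>i k. i < n \<Longrightarrow> k < n \<Longrightarrow> A i k = A k i"
  shows "rform n A x y = rform n A y x"
proof -
  have "rform n A x y = (\<Sum>k<n. \<Sum>i<n. x i * A i k * y k)"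
    unfolding rform_def by (rule sum.swap)
  also have "\<dots> = rform n A y x"
    unfolding rform_def by (intro sum.cong refl) (auto simp: assms)
  finally show ?thesis .
qed

text \<open>A complex eigenvector x exists, and x^* A x = c |x|^2 is real by symmetry, so c is real.
  Then the real and imaginary parts of x both satisfy the eigenvector equation, and one of them is
  nonzero.\<close>

lemma real_symmetric_unit_eigenvector:
  fixes A :: "nat \<Rightarrow> nat \<Rightarrow> real"
  assumes sym: "\<And>i k. i < n \<Longrightarrow> k < n \<Longrightarrow> A i k = A k i" and "0 < n"
  obtains v e where "(\<Sum>i<n. (v i)\<^sup>2) = 1" "\<And>i. i < n \<Longrightarrow> mvec n A v i = e * v i"
proof -
  define C where "C = Matrix.mat n n (\<lambda>(i, k). complex_of_real (A i k))"
  have C: "C \<in> carrier_mat n n" by (simp add: C_def)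
  obtain cs where cs: "char_poly C = (\<Prod>a\<leftarrow>cs. [:- a, 1:])" "length cs = n"
    using char_poly_factorized[OF C] by blast
  then have "poly (char_poly C) (hd cs) = 0" using \<open>0 < n\<close>
    unfolding poly_linear_factors by (cases cs) auto
  then have "eigenvalue C (hd cs)" using eigenvalue_root_char_poly[OF C] by simp
  then obtain c w where w: "w \<in> carrier_vec n" "w \<noteq> 0\<^sub>v n" "C *\<^sub>v w = c \<cdot>\<^sub>v w"
    unfolding eigenvalue_def eigenvector_def using C by auto
  define x where "x = (\<lambda>i. w $ i)"
  have eq: "(\<Sum>k<n. of_real (A i k) * x k) = c * x i" if i: "i < n" for i
  proof -
    have "(C *\<^sub>v w) $ i = c * x i" unfolding w(3) using i w(1) by (simp add: x_def)
    then show ?thesis using i w(1) by (simp add: C_def x_def scalar_prod_def atLeast0LessThan)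
  qed
  obtain i0 where i0: "i0 < n" "x i0 \<noteq> 0"
  proof (rule ccontr)
    assume "\<not> thesis"
    then have "w = 0\<^sub>v n" using w(1) that by (intro eq_vecI) (auto simp: x_def)
    then show False using w(2) by simp
  qed
  have form: "cform n A (\<lambda>i. cnj (x i)) x = c * of_real (\<Sum>i<n. (cmod (x i))\<^sup>2)"
  proof -
    have "cform n A (\<lambda>i. cnj (x i)) x = (\<Sum>i<n. cnj (x i) * (\<Sum>k<n. of_real (A i k) * x k))"
      unfolding cform_def by (simp add: sum_distrib_left mult.assoc)
    also have "\<dots> = (\<Sum>i<n. c * of_real ((cmod (x i))\<^sup>2))"
    proof (intro sum.cong refl)
      fix i assume "i \<in> {..<n}"
      then have "cnj (x i) * (\<Sum>k<n. of_real (A i k) * x k) = c * (x i * cnj (x i))"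
        by (simp add: eq)
      then show "cnj (x i) * (\<Sum>k<n. of_real (A i k) * x k) = c * of_real ((cmod (x i))\<^sup>2)"
        by (simp only: complex_norm_square)
    qed
    finally show ?thesis by (simp add: sum_distrib_left)
  qed
  have "Im (cform n A (\<lambda>i. cnj (x i)) x) = 0"
  proof -
    have "rform n A (\<lambda>i. - Im (x i)) (\<lambda>i. Re (x i)) = - rform n A (\<lambda>i. Im (x i)) (\<lambda>i. Re (x i))"
      using rform_linear(3)[of n A "-1"] by simp
    then show ?thesis
      unfolding cform_Re_Im using rform_symmetric[of n A "\<lambda>i. Im (x i)" "\<lambda>i. Re (x i)"] sym by simp
  qed
  moreover have "(\<Sum>i<n. (cmod (x i))\<^sup>2) \<noteq> 0"
    using i0 by (subst sum_nonneg_eq_0_iff) auto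
  ultimately have c: "Im c = 0" unfolding form by (simp flip: of_real_sum)
  define u where "u = (if \<exists>i<n. Re (x i) \<noteq> 0 then (\<lambda>i. Re (x i)) else (\<lambda>i. Im (x i)))"
  have u: "mvec n A u i = Re c * u i" if "i < n" for i
    using arg_cong[OF eq[OF that], of Re] arg_cong[OF eq[OF that], of Im] c
    by (simp add: mvec_def u_def)
  have "\<exists>i<n. u i \<noteq> 0" using i0 unfolding u_def by (auto simp: complex_eq_iff)
  define N where "N = (\<Sum>i<n. (u i)\<^sup>2)"
  have "N > 0"
    using \<open>\<exists>i<n. u i \<noteq> 0\<close> unfolding N_def by (auto intro!: sum_pos2)
  show ?thesis
  proof (rule that[of "\<lambda>i. u i / sqrt N" "Re c"])
    show "(\<Sum>i<n. (u i / sqrt N)\<^sup>2) = 1"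
      using \<open>N > 0\<close> unfolding power_divide by (simp flip: sum_divide_distrib N_def)
    show "mvec n A (\<lambda>i. u i / sqrt N) i = Re c * (u i / sqrt N)" if "i < n" for i
      using u[OF that] unfolding mvec_def by (simp flip: sum_divide_distrib)
  qed
qed

text \<open>Deflation: the Householder reflection exchanging \<open>e\<^sub>0\<close> and a unit eigenvector block-diagonalizes the matrix.\<close>

lemma real_symmetric_eigenbasis:
  fixes A :: "nat \<Rightarrow> nat \<Rightarrow> real"
  assumes "\<And>i k. i < n \<Longrightarrow> k < n \<Longrightarrow> A i k = A k i"
  shows "\<exists>b t. (\<forall>k<n. \<forall>i<n. mvec n A (b k) i = t k * b k i) \<and>
    (\<forall>k<n. \<forall>l<n. (\<Sum>i<n. b k i * b l i) = (if k = l then 1 else 0))"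
  using assms
proof (induction n arbitrary: A)
  case (Suc n)
  let ?n = "Suc n"
  obtain v e where v: "(\<Sum>i<?n. (v i)\<^sup>2) = 1" and ev: "\<And>i. i < ?n \<Longrightarrow> mvec ?n A v i = e * v i"
    using real_symmetric_unit_eigenvector[of ?n A] Suc.prems by blast
  define dot where "dot x y = (\<Sum>i<?n. x i * y i)" for x y :: "nat \<Rightarrow> real"
  define w where "w i = ind_vec 0 i - v i" for i
  \<comment> \<open>If v is already e_0, then \<open>dot w w = 0\<close>, the quotient is 0 and the
    reflection degenerates to the identity, as it should.\<close>
  define c where "c = 2 / dot w w"
  define H where "H x i = x i - c * dot w x * w i" for x i
  have dot_lin: "dot x (H y) = dot x y - c * dot w y * dot x w" for x y
  proof -
    have "dot x (\<lambda>i. y i - d * w i) = dot x y - d * dot x w" for d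
      unfolding dot_def by (simp add: algebra_simps sum_subtractf sum_distrib_left del: sum.lessThan_Suc)
    then show ?thesis unfolding H_def .
  qed
  have dot_comm: "dot x y = dot y x" for x y by (simp add: dot_def mult.commute)
  have dot_H: "dot x (H y) = dot (H x) y" for x y
    unfolding dot_lin dot_comm[of "H x"] by (simp add: dot_comm)
  have HH: "H (H x) = x" for x
  proof
    fix i
    have "c * (c * (dot w w)) = 2 * c" by (simp add: c_def)
    moreover have "c * dot w (H x) = c * dot w x - (c * (c * dot w w)) * dot w x"
      unfolding dot_lin by (simp add: algebra_simps)
    ultimately have "c * dot w (H x) = c * dot w x - 2 * c * dot w x" by presburger
    then have k: "c * dot w (H x) = - (c * dot w x)" by simp
    have "H (H x) i = H x i - (c * dot w (H x)) * w i" unfolding H_def[of "H x" i] ..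
    also have "\<dots> = H x i + c * dot w x * w i" unfolding k by simp
    also have "\<dots> = x i" by (simp add: H_def)
    finally show "H (H x) i = x i" .
  qed
  have dot_ind: "dot x (ind_vec l) = x l" "dot (ind_vec l) x = x l" if "l < ?n" for x l
    using that unfolding dot_def by (simp_all del: sum.lessThan_Suc)
  have H0: "H (ind_vec 0) i = v i" if "i < ?n" for i
  proof (cases "dot w w = 0")
    case True
    then have "w i = 0" using that unfolding dot_def
      by (subst (asm) sum_nonneg_eq_0_iff) auto
    then show ?thesis by (simp add: H_def w_def)
  next
    case False
    have "dot v v = 1" using v by (simp add: dot_def power2_eq_square)
    then have "dot w w = 2 * (1 - v 0)"
    proof -
      have "dot w w = dot (ind_vec 0) (ind_vec 0) - 2 * dot (ind_vec 0) v + dot v v"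
        unfolding dot_def w_def by (simp add: algebra_simps sum.distrib sum_subtractf sum_distrib_left)
      then show ?thesis using \<open>dot v v = 1\<close> by (simp add: dot_ind) (simp add: ind_vec_def)
    qed
    moreover have "dot w (ind_vec 0) = 1 - v 0" by (simp add: dot_ind w_def) (simp add: ind_vec_def)
    ultimately have "c * dot w (ind_vec 0) = 1" using False by (simp add: c_def)
    then show ?thesis unfolding H_def by (simp add: w_def)
  qed
  \<comment> \<open>The form of A in reflected coordinates. Since the reflection sends e_0 to v, row
    and column 0 are e times e_0, and the remaining block is left to the induction
    hypothesis.\<close>
  define A' where "A' i k = rform ?n A (H (ind_vec i)) (H (ind_vec k))" for i k
  note comm = rform_symmetric[of ?n A, OF Suc.prems]
  have rH: "rform ?n A x (H y) = (\<Sum>l<?n. y l * rform ?n A x (H (ind_vec l)))" for x y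
  proof -
    have lin: "rform ?n A x (H y) = rform ?n A x y - c * dot w y * rform ?n A x w" for y
      using rform_linear(2)[of ?n A x y "\<lambda>i. (- c * dot w y) * w i"]
      unfolding H_def rform_linear(4) by (simp add: algebra_simps)
    have "(\<Sum>l<?n. y l * rform ?n A x (H (ind_vec l)))
        = (\<Sum>l<?n. y l * rform ?n A x (ind_vec l)) - c * dot w y * rform ?n A x w"
      unfolding lin dot_def[of w y]
      by (simp add: dot_ind algebra_simps sum_subtractf sum_distrib_left del: sum.lessThan_Suc)
    then show ?thesis unfolding lin rform_expand_right[of ?n A x y] by simp
  qed
  have A'_sym: "A' i k = A' k i" for i k unfolding A'_def by (rule comm)
  have A'_form: "rform ?n A (H x) (H y) = (\<Sum>i<?n. x i * (\<Sum>l<?n. A' i l * y l))" for x y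
  proof -
    have "rform ?n A (H x) (H y) = (\<Sum>l<?n. y l * rform ?n A (H (ind_vec l)) (H x))"
      by (subst rH) (simp add: comm)
    also have "\<dots> = (\<Sum>l<?n. \<Sum>i<?n. x i * (A' i l * y l))"
      by (subst rH) (simp add: A'_def comm[of "H (ind_vec _)" "H (ind_vec _)"] sum_distrib_left algebra_simps del: sum.lessThan_Suc)
    also have "\<dots> = (\<Sum>i<?n. x i * (\<Sum>l<?n. A' i l * y l))"
      unfolding sum_distrib_left by (rule sum.swap)
    finally show ?thesis .
  qed
  have A'0: "A' 0 k = (if k = 0 then e else 0)" if "k < ?n" for k
  proof -
    have *: "dot (H (ind_vec k)) v = ind_vec 0 k"
    proof -
      have "dot (H (ind_vec k)) v = dot (H (ind_vec k)) (H (ind_vec 0))"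
        unfolding dot_def by (intro sum.cong refl) (simp add: H0)
      also have "\<dots> = ind_vec 0 k"
        unfolding dot_H[symmetric] HH using that by (rule dot_ind(2))
      finally show ?thesis .
    qed
    have "A' k 0 = rform ?n A (H (ind_vec k)) v"
      unfolding A'_def by (intro rform_cong refl H0)
    also have "\<dots> = dot (H (ind_vec k)) (\<lambda>i. e * v i)"
      unfolding rform_mvec dot_def by (intro sum.cong refl) (simp add: ev)
    also have "\<dots> = e * dot (H (ind_vec k)) v"
      unfolding dot_def sum_distrib_left by (intro sum.cong refl) simp
    finally show ?thesis unfolding * by (simp add: A'_sym[of 0] ind_vec_def)
  qed
  obtain b3 t3 where b3: "\<And>k i. k < n \<Longrightarrow> i < n \<Longrightarrow> mvec n (\<lambda>i k. A' (Suc i) (Suc k)) (b3 k) i = t3 k * b3 k i"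
    and orth3: "\<And>k l. k < n \<Longrightarrow> l < n \<Longrightarrow> (\<Sum>i<n. b3 k i * b3 l i) = (if k = l then 1 else 0)"
    using Suc.IH[of "\<lambda>i k. A' (Suc i) (Suc k)"] A'_sym by blast
  \<comment> \<open>Eigenvectors of the block extended by a zero entry, together with e_0;
    reflecting them back gives the basis for A.\<close>
  define y where "y k i = (case k of 0 \<Rightarrow> ind_vec 0 i | Suc k' \<Rightarrow> (case i of 0 \<Rightarrow> 0 | Suc i' \<Rightarrow> b3 k' i'))" for k i
  define t where "t k = (case k of 0 \<Rightarrow> e | Suc k' \<Rightarrow> t3 k')" for k
  have y0 [simp]: "y 0 = ind_vec 0" and yS0 [simp]: "y (Suc k) 0 = 0" and ySS [simp]: "y (Suc k) (Suc i) = b3 k i" for k i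
    by (auto simp: y_def)
  have A'y: "(\<Sum>l<?n. A' i l * y k l) = t k * y k i" if "i < ?n" "k < ?n" for i k
  proof (cases k)
    case 0
    then show ?thesis using that A'0[of i]
      by (simp add: t_def A'_sym[of i 0] del: sum.lessThan_Suc) (simp add: ind_vec_def)
  next
    case (Suc k')
    show ?thesis
    proof (cases i)
      case 0
      then show ?thesis using Suc that
        by (simp add: sum.lessThan_Suc_shift A'0 del: sum.lessThan_Suc)
    next
      case (Suc i')
      then show ?thesis using \<open>k = Suc k'\<close> that b3[of k' i']
        by (simp add: sum.lessThan_Suc_shift t_def mvec_def del: sum.lessThan_Suc)
    qed
  qed
  have yorth: "dot (y k) (y l) = (if k = l then 1 else 0)" if "k < ?n" "l < ?n" for k l
    using that orth3
    by (cases k; cases l) (auto simp: dot_ind, auto simp: ind_vec_def dot_def sum.lessThan_Suc_shift simp del: sum.lessThan_Suc)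
  have eig: "mvec ?n A (H (y k)) i = t k * H (y k) i" if "i < ?n" "k < ?n" for i k
  proof -
    have "mvec ?n A (H (y k)) i = dot (ind_vec i) (mvec ?n A (H (y k)))"
      using that by (simp add: dot_ind)
    also have "\<dots> = rform ?n A (ind_vec i) (H (y k))" unfolding rform_mvec dot_def ..
    also have "\<dots> = rform ?n A (H (H (ind_vec i))) (H (y k))" unfolding HH ..
    also have "\<dots> = (\<Sum>j<?n. H (ind_vec i) j * (t k * y k j))"
      unfolding A'_form by (intro sum.cong refl) (simp add: A'y that del: sum.lessThan_Suc)
    also have "\<dots> = t k * dot (H (ind_vec i)) (y k)"
      unfolding dot_def by (simp add: sum_distrib_left algebra_simps del: sum.lessThan_Suc)
    also have "\<dots> = t k * H (y k) i" unfolding dot_H[symmetric] using that by (simp add: dot_ind)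
    finally show ?thesis .
  qed
  have orth: "(\<Sum>i<?n. H (y k) i * H (y l) i) = (if k = l then 1 else 0)" if "k < ?n" "l < ?n" for k l
  proof -
    have "dot (H (y k)) (H (y l)) = dot (y k) (y l)" unfolding dot_H[of _ "y l"] HH ..
    then show ?thesis unfolding yorth[OF that] by (simp only: dot_def)
  qed
  show ?case
    by (rule exI[of _ "\<lambda>k. H (y k)"], rule exI[of _ t]) (intro conjI allI impI eig orth)
qed simp

lemma orthonormal_complete:
  fixes b :: "nat \<Rightarrow> nat \<Rightarrow> real"
  assumes "\<And>k l. k < n \<Longrightarrow> l < n \<Longrightarrow> (\<Sum>i<n. b k i * b l i) = (if k = l then 1 else 0)"
    and "i < n" "j < n"
  shows "(\<Sum>k<n. b k i * b k j) = (if i = j then 1 else 0)"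
proof -
  define B where "B = Matrix.mat n n (\<lambda>(k, i). b k i)"
  have B: "B \<in> carrier_mat n n" by (simp add: B_def)
  have "B * transpose_mat B = 1\<^sub>m n"
    by (intro eq_matI) (auto simp: B_def scalar_prod_def atLeast0LessThan assms(1))
  then have "transpose_mat B * B = 1\<^sub>m n"
    using B by (intro mat_mult_left_right_inverse[of B n]) auto
  then have "(transpose_mat B * B) $$ (i, j) = (if i = j then 1 else 0)" using assms by simp
  then show ?thesis using assms(2,3) by (simp add: B_def scalar_prod_def atLeast0LessThan)
qed

locale eigenbasis = psd_form +
  fixes b :: "nat \<Rightarrow> nat \<Rightarrow> real" and t :: "nat \<Rightarrow> real"
  assumes eigen: "\<And>k i. k < m \<Longrightarrow> i < m \<Longrightarrow> mvec m T (b k) i = t k * b k i"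
    and orth: "\<And>k l. k < m \<Longrightarrow> l < m \<Longrightarrow> (\<Sum>i<m. b k i * b l i) = (if k = l then 1 else 0)"
begin

lemma complete: "i < m \<Longrightarrow> j < m \<Longrightarrow> (\<Sum>k<m. b k i * b k j) = (if i = j then 1 else 0)"
  using orthonormal_complete[OF orth] .

lemma rform_eigen: "k < m \<Longrightarrow> rf (b k) y = t k * (\<Sum>i<m. b k i * y i)"
proof -
  assume "k < m"
  then have "rf y (b k) = (\<Sum>i<m. y i * (t k * b k i))"
    unfolding rform_mvec by (intro sum.cong refl) (simp add: eigen)
  then show ?thesis by (simp add: rform_commute[of y] sum_distrib_left algebra_simps)
qed

lemma eigenvalue_nonneg: "k < m \<Longrightarrow> 0 \<le> t k"
  using T_psd[of "b k"] rform_eigen[of k "b k"] orth[of k k] by simp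

text \<open>For an arbitrary matrix A, not only T: it is applied to the imaginary part of a
  resolvent and to the form B.\<close>

lemma trace_basis: "(\<Sum>k<m. rform m A (b k) (b k)) = (\<Sum>i<m. A i i)"
proof -
  have "(\<Sum>k<m. rform m A (b k) (b k)) = (\<Sum>i<m. \<Sum>k<m. \<Sum>j<m. A i j * (b k i * b k j))"
    unfolding rform_def by (subst sum.swap) (simp add: algebra_simps)
  also have "\<dots> = (\<Sum>i<m. \<Sum>j<m. A i j * (\<Sum>k<m. b k i * b k j))"
    unfolding sum_distrib_left by (rule sum.cong[OF refl], rule sum.swap)
  also have "\<dots> = (\<Sum>i<m. \<Sum>j<m. if j = i then A i j else 0)"
    by (intro sum.cong refl) (simp add: complete)
  also have "\<dots> = (\<Sum>i<m. A i i)" by simp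
  finally show ?thesis .
qed

lemma expand: "i < m \<Longrightarrow> x i = (\<Sum>k<m. (\<Sum>j<m. b k j * x j) * b k i)"
proof -
  assume i: "i < m"
  have "(\<Sum>k<m. (\<Sum>j<m. b k j * x j) * b k i) = (\<Sum>j<m. x j * (\<Sum>k<m. b k i * b k j))"
    unfolding sum_distrib_right sum_distrib_left by (subst sum.swap) (simp add: algebra_simps)
  also have "\<dots> = (\<Sum>j<m. if j = i then x j else 0)"
    by (intro sum.cong refl) (simp add: complete i)
  finally show ?thesis using i by simp
qed

lemma rform_self_eigen: "rf x x = (\<Sum>k<m. t k * (\<Sum>i<m. b k i * x i)\<^sup>2)"
proof -
  have "rf x x = rf (\<lambda>i. \<Sum>k<m. (\<Sum>j<m. b k j * x j) * b k i) x"
    by (rule rform_cong[OF expand[of _ x] refl])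
  also have "\<dots> = (\<Sum>k<m. (\<Sum>j<m. b k j * x j) * rf (b k) x)"
    unfolding rform_linear(5) rform_linear(3) ..
  also have "\<dots> = (\<Sum>k<m. t k * (\<Sum>i<m. b k i * x i)\<^sup>2)"
    by (intro sum.cong refl) (simp add: rform_eigen power2_eq_square)
  finally show ?thesis .
qed

lemma norm_sq_eigen: "(\<Sum>i<m. (x i)\<^sup>2) = (\<Sum>k<m. (\<Sum>i<m. b k i * x i)\<^sup>2)"
proof -
  have "(\<Sum>i<m. (x i)\<^sup>2) = (\<Sum>i<m. \<Sum>k<m. x i * ((\<Sum>j<m. b k j * x j) * b k i))"
  proof (rule sum.cong[OF refl])
    fix i assume "i \<in> {..<m}"
    then have "x i * x i = x i * (\<Sum>k<m. (\<Sum>j<m. b k j * x j) * b k i)"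
      using arg_cong[OF expand[of i x], of "\<lambda>v. x i * v"] by simp
    then show "(x i)\<^sup>2 = (\<Sum>k<m. x i * ((\<Sum>j<m. b k j * x j) * b k i))"
      by (simp only: power2_eq_square sum_distrib_left)
  qed
  also have "\<dots> = (\<Sum>k<m. \<Sum>i<m. x i * ((\<Sum>j<m. b k j * x j) * b k i))" by (rule sum.swap)
  also have "\<dots> = (\<Sum>k<m. (\<Sum>i<m. b k i * x i)\<^sup>2)"
  proof (rule sum.cong[OF refl])
    fix k
    have "(\<Sum>i<m. x i * (c * b k i)) = c * (\<Sum>i<m. b k i * x i)" for c
      unfolding sum_distrib_left by (rule sum.cong) auto
    then show "(\<Sum>i<m. x i * ((\<Sum>j<m. b k j * x j) * b k i)) = (\<Sum>i<m. b k i * x i)\<^sup>2"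
      by (simp only: power2_eq_square)
  qed
  finally show ?thesis .
qed

lemma rform_le_norm_sq:
  assumes "\<And>k. k < m \<Longrightarrow> t k \<le> \<tau>"
  shows "rf x x \<le> \<tau> * (\<Sum>i<m. (x i)\<^sup>2)"
  unfolding rform_self_eigen norm_sq_eigen[of x] sum_distrib_left
  by (intro sum_mono mult_right_mono assms) auto

lemma trace_power:
  "mtrace (Matrix.mat m m (\<lambda>(i, k). T i k) ^\<^sub>m p) = (\<Sum>k<m. t k ^ p)"
proof -
  let ?A = "Matrix.mat m m (\<lambda>(i, k). T i k)"
  have A: "?A \<in> carrier_mat m m" by simp
  have entry: "(?A ^\<^sub>m p) $$ (i, j) = (\<Sum>k<m. t k ^ p * (b k i * b k j))" if "i < m" "j < m" for i j
    using that
  proof (induction p arbitrary: j)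
    case 0
    then show ?case by (simp add: complete)
  next
    case (Suc p)
    have P: "?A ^\<^sub>m p \<in> carrier_mat m m" using A by (rule pow_carrier_mat)
    have "(?A ^\<^sub>m Suc p) $$ (i, j) = (\<Sum>l<m. (?A ^\<^sub>m p) $$ (i, l) * T l j)"
      using Suc.prems P by (simp add: scalar_prod_def atLeast0LessThan)
    also have "\<dots> = (\<Sum>l<m. \<Sum>k<m. t k ^ p * b k i * (b k l * T l j))"
      using Suc by (intro sum.cong refl) (simp add: sum_distrib_right mult.assoc)
    also have "\<dots> = (\<Sum>k<m. t k ^ p * b k i * (\<Sum>l<m. b k l * T l j))"
      unfolding sum_distrib_left by (rule sum.swap)
    also have "\<dots> = (\<Sum>k<m. t k ^ Suc p * (b k i * b k j))"
    proof (intro sum.cong refl)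
      fix k assume "k \<in> {..<m}"
      then have "(\<Sum>l<m. b k l * T l j) = t k * b k j"
        using eigen[of k j] Suc.prems unfolding mvec_def by (simp add: T_sym[of j] mult.commute)
      then show "t k ^ p * b k i * (\<Sum>l<m. b k l * T l j) = t k ^ Suc p * (b k i * b k j)" by simp
    qed
    finally show ?case .
  qed
  have "mtrace (?A ^\<^sub>m p) = (\<Sum>i<m. (?A ^\<^sub>m p) $$ (i, i))"
    unfolding mtrace_def using pow_carrier_mat[OF A, of p] by simp
  also have "\<dots> = (\<Sum>i<m. \<Sum>k<m. t k ^ p * (b k i * b k i))" by (simp add: entry)
  also have "\<dots> = (\<Sum>k<m. t k ^ p * (\<Sum>i<m. b k i * b k i))"
    unfolding sum_distrib_left by (rule sum.swap)
  also have "\<dots> = (\<Sum>k<m. t k ^ p)" by (simp add: orth)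
  finally show ?thesis .
qed

end

lemma (in psd_form) exists_eigenbasis: "\<exists>b t. eigenbasis m T b t"
proof -
  obtain b t where "\<forall>k<m. \<forall>i<m. mvec m T (b k) i = t k * b k i"
    "\<forall>k<m. \<forall>l<m. (\<Sum>i<m. b k i * b l i) = (if k = l then 1 else 0)"
    using real_symmetric_eigenbasis[of m T] T_sym by blast
  then have "eigenbasis m T b t" by unfold_locales auto
  then show ?thesis by blast
qed

section \<open>Size of forms dominated by T\<close>

text \<open>The conditions under which a random quadratic form is of order m: a trace of order m,
  and a Frobenius norm that is small against m. The last clause bounds the image of the constant
  vector, which enters because the entries of Y need not be centred.\<close>

definition good_form :: "nat \<Rightarrow> real \<Rightarrow> real \<Rightarrow> (nat \<Rightarrow> nat \<Rightarrow> real) \<Rightarrow> bool" where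
  "good_form m c \<eta> B \<longleftrightarrow> c * real m \<le> (\<Sum>i<m. B i i) \<and> (\<Sum>i<m. \<Sum>k<m. (B i k)\<^sup>2) \<le> \<eta> * (real m)\<^sup>2
     \<and> (\<Sum>i<m. (\<Sum>k<m. B i k)\<^sup>2) \<le> \<eta> * (real m)\<^sup>2"

text \<open>With N = |B w|^2 = B(B w, w), Cauchy-Schwarz for B and B \<le> T \<le> \<tau> give N^2
  \<le> \<tau> N T(w,w), and N cancels.\<close>

lemma (in psd_form) dominated_mvec_norm:
  assumes B: "psd_form m B" and le: "\<And>x. rform m B x x \<le> rf x x"
    and \<tau>: "\<And>x. rf x x \<le> \<tau> * (\<Sum>i<m. (x i)\<^sup>2)"
  shows "(\<Sum>i<m. (mvec m B w i)\<^sup>2) \<le> \<tau> * rf w w"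
proof -
  interpret B: psd_form m B by (rule B)
  let ?b = "mvec m B w"
  let ?N = "\<Sum>i<m. (?b i)\<^sup>2"
  have N: "rform m B ?b w = ?N" unfolding rform_mvec by (simp add: power2_eq_square)
  have "?N\<^sup>2 \<le> rform m B ?b ?b * rform m B w w"
    using B.rform_Cauchy_Schwarz[of ?b w] unfolding N .
  also have "\<dots> \<le> rf ?b ?b * rf w w"
    by (intro mult_mono le B.T_psd T_psd)
  also have "\<dots> \<le> (\<tau> * ?N) * rf w w"
    by (intro mult_right_mono \<tau> T_psd)
  finally have *: "?N * ?N \<le> ?N * (\<tau> * rf w w)" by (simp add: power2_eq_square algebra_simps)
  show ?thesis
  proof (cases "?N = 0")
    case True
    have "0 \<le> \<tau> * rf w w"
    proof (cases "rf w w = 0")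
      case False
      then have "0 < rf w w" using T_psd[of w] by simp
      then have "0 < \<tau> * (\<Sum>i<m. (w i)\<^sup>2)" using \<tau>[of w] by linarith
      moreover have "0 \<le> (\<Sum>i<m. (w i)\<^sup>2)" by (intro sum_nonneg) auto
      ultimately have "0 < \<tau>" by (simp add: zero_less_mult_iff)
      then show ?thesis using T_psd[of w] by simp
    qed simp
    then show ?thesis using True by simp
  next
    case False
    moreover have "0 \<le> ?N" by (intro sum_nonneg) auto
    ultimately have "0 < ?N" by linarith
    then show ?thesis using * by (simp only: mult_le_cancel_left_pos)
  qed
qed

lemma (in psd_form) rform_ind_vec: "k < m \<Longrightarrow> rform m A (ind_vec k) (ind_vec k) = A k k"
  unfolding rform_mvec mvec_ind_vec by simp

text \<open>The norm bound tested on the basis vectors gives the first part, on the constant vector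
  the second.\<close>

lemma (in psd_form) dominated_frobenius:
  assumes B: "psd_form m B" and le: "\<And>x. rform m B x x \<le> rf x x"
    and \<tau>: "\<And>x. rf x x \<le> \<tau> * (\<Sum>i<m. (x i)\<^sup>2)"
  shows "(\<Sum>i<m. \<Sum>k<m. (B i k)\<^sup>2) \<le> \<tau> * (\<Sum>k<m. T k k)"
    and "\<tau> \<ge> 0 \<Longrightarrow> (\<Sum>i<m. (\<Sum>k<m. B i k)\<^sup>2) \<le> \<tau>\<^sup>2 * real m"
proof -
  have "(\<Sum>i<m. \<Sum>k<m. (B i k)\<^sup>2) = (\<Sum>k<m. \<Sum>i<m. (mvec m B (ind_vec k) i)\<^sup>2)"
    by (subst sum.swap) (simp add: mvec_ind_vec)
  also have "\<dots> \<le> (\<Sum>k<m. \<tau> * rf (ind_vec k) (ind_vec k))"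
    by (intro sum_mono dominated_mvec_norm assms)
  also have "\<dots> = \<tau> * (\<Sum>k<m. T k k)" by (simp add: rform_ind_vec sum_distrib_left)
  finally show "(\<Sum>i<m. \<Sum>k<m. (B i k)\<^sup>2) \<le> \<tau> * (\<Sum>k<m. T k k)" .
  assume "\<tau> \<ge> 0"
  have "(\<Sum>i<m. (\<Sum>k<m. B i k)\<^sup>2) = (\<Sum>i<m. (mvec m B (\<lambda>_. 1) i)\<^sup>2)" by (simp add: mvec_def)
  also have "\<dots> \<le> \<tau> * rf (\<lambda>_. 1) (\<lambda>_. 1)" by (intro dominated_mvec_norm assms)
  also have "\<dots> \<le> \<tau> * (\<tau> * (\<Sum>i<m. 1\<^sup>2))" by (intro mult_left_mono \<tau> \<open>\<tau> \<ge> 0\<close>)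
  finally show "(\<Sum>i<m. (\<Sum>k<m. B i k)\<^sup>2) \<le> \<tau>\<^sup>2 * real m" by (simp add: power2_eq_square)
qed

section \<open>Smoothed eigenvalue counts and the leave-one-out identity\<close>

text \<open>Poisson-smoothed number of eigenvalues near \<open>Re z\<close>.\<close>

definition smooth_count :: "nat \<Rightarrow> (nat \<Rightarrow> nat \<Rightarrow> real) \<Rightarrow> (nat \<Rightarrow> nat \<Rightarrow> real) \<Rightarrow> nat set \<Rightarrow> complex \<Rightarrow> real" where
  "smooth_count m T q J z = Im z * Im (\<Sum>k<m. res_mat m T q J z k k)"

definition loo_form :: "nat \<Rightarrow> (nat \<Rightarrow> nat \<Rightarrow> real) \<Rightarrow> (nat \<Rightarrow> nat \<Rightarrow> real) \<Rightarrow> nat set \<Rightarrow> complex \<Rightarrow> nat \<Rightarrow> nat \<Rightarrow> real" where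
  "loo_form m T q J z = res_form m T (Im z) (res_mat m T q J z)"

context sample_form
begin

lemma smooth_count_eigenvalues:
  assumes "finite J"
  obtains es where "length es = m" "\<And>e. e \<in> set es \<Longrightarrow> 0 \<le> e"
    "char_poly (Matrix.mat m m (\<lambda>(i, k). samp_mat m T q J i k)) = (\<Prod>e\<leftarrow>es. [:- e, 1:])"
    "\<And>z. Im z > 0 \<Longrightarrow> smooth_count m T q J z = (\<Sum>e\<leftarrow>es. (Im z)\<^sup>2 / ((e - Re z)\<^sup>2 + (Im z)\<^sup>2))"
proof -
  obtain es where es: "length es = m" "\<And>e. e \<in> set es \<Longrightarrow> 0 \<le> e"
    "char_poly (Matrix.mat m m (\<lambda>(i, k). samp_mat m T q J i k)) = (\<Prod>e\<leftarrow>es. [:- e, 1:])"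
    "\<And>z. Im z > 0 \<Longrightarrow> (\<Sum>k<m. res_mat m T q J z k k) = (\<Sum>e\<leftarrow>es. 1 / (of_real e - z))"
    using samp_mat_eigenvalues[OF assms] by blast
  have eq: "Im z * Im (\<Sum>e\<leftarrow>es. 1 / (of_real e - z)) = (\<Sum>e\<leftarrow>es. (Im z)\<^sup>2 / ((e - Re z)\<^sup>2 + (Im z)\<^sup>2))" for z
    by (induction es) (simp_all add: Im_divide power2_eq_square distrib_left)
  show ?thesis
    by (rule that[OF es(1-3)]) (simp_all only: smooth_count_def es(4) eq)
qed

lemma norm_res_trace:
  assumes "finite J" "Im z > 0"
  shows "cmod (\<Sum>k<m. res_mat m T q J z k k) \<le> real m / Im z"
proof -
  obtain es where es: "length es = m"
    "(\<Sum>k<m. res_mat m T q J z k k) = (\<Sum>e\<leftarrow>es. 1 / (of_real e - z))"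
    using samp_mat_eigenvalues[OF assms(1)] assms(2) by metis
  have "cmod (\<Sum>e\<leftarrow>es. 1 / (complex_of_real e - z)) \<le> real (length es) / Im z"
  proof (induction es)
    case (Cons e es)
    have "Im z \<le> cmod (complex_of_real e - z)"
      using abs_Im_le_cmod[of "complex_of_real e - z"] by simp
    then have "cmod (1 / (complex_of_real e - z)) \<le> 1 / Im z"
      using assms(2) by (simp add: norm_divide frac_le)
    then show ?case using Cons norm_triangle_ineq[of "1 / (complex_of_real e - z)"]
      by (simp add: add_divide_distrib) (smt (verit))
  qed simp
  then show ?thesis using es by simp
qed

text \<open>The rank-one trace bound 1 / Im z times the factor Im z: a column carries at most one
  unit of the count, whatever z is.\<close>

lemma smooth_count_remove:
  assumes "finite J" "j \<in> J" "Im z > 0"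
  shows "smooth_count m T q (J - {j}) z \<ge> smooth_count m T q J z - 1"
proof -
  have "cmod ((\<Sum>k<m. res_mat m T q (J - {j}) z k k) - (\<Sum>k<m. res_mat m T q J z k k)) \<le> 1 / Im z"
    using resolvent_insert_trace[of "J - {j}" j z] assms resolvent_res_mat[OF assms(3)]
    by (simp add: insert_absorb)
  then have "\<bar>Im (\<Sum>k<m. res_mat m T q (J - {j}) z k k) - Im (\<Sum>k<m. res_mat m T q J z k k)\<bar> \<le> 1 / Im z"
    using abs_Im_le_cmod by (smt (verit) minus_complex.simps(2))
  then have "Im (\<Sum>k<m. res_mat m T q J z k k) - Im (\<Sum>k<m. res_mat m T q (J - {j}) z k k) \<le> 1 / Im z"
    by linarith
  from mult_left_mono[OF this, of "Im z"] show ?thesis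
    using assms(3) unfolding smooth_count_def by (simp add: right_diff_distrib)
qed

lemma loo_form_psd: "Im z > 0 \<Longrightarrow> psd_form m (loo_form m T q J z)"
  unfolding loo_form_def by (rule res_form_psd_form[OF resolvent_res_mat])

lemma loo_form_good:
  assumes "Im z > 0" and \<tau>: "\<And>x. rf x x \<le> \<tau> * (\<Sum>i<m. (x i)\<^sup>2)" "\<tau> \<ge> 0"
    and "\<tau> * (\<Sum>k<m. T k k) \<le> \<eta> * (real m)\<^sup>2" "\<tau>\<^sup>2 * real m \<le> \<eta> * (real m)\<^sup>2"
    and "c * real m \<le> (\<Sum>i<m. loo_form m T q J z i i)"
  shows "good_form m c \<eta> (loo_form m T q J z)"
proof -
  note le = res_form_le[OF resolvent_res_mat[OF assms(1)] assms(1), of J, folded loo_form_def]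
  note dominated_frobenius[OF loo_form_psd[OF assms(1)] le \<tau>(1)]
  then show ?thesis unfolding good_form_def using assms by fastforce
qed

text \<open>Many eigenvalues near a positive point force tr B to be of order m. Indeed a m is at
  most tr (S B) = Im z * Im (z tr W), while tr S \<le> C m in \<open>res_form_trace_lower\<close>.
  The resulting constant survives Im z tending to 0.\<close>

lemma loo_form_trace_pos:
  assumes "finite J" "Im z > 0" "Re z \<ge> 0"
    and C: "(\<Sum>j\<in>J. \<Sum>i<m. (q j i)\<^sup>2) \<le> C * real m" "C > 0" and m: "m > 0"
    and a: "0 \<le> a" "a * real m \<le> Re z * smooth_count m T q J z - Im z * real m"
  shows "a\<^sup>2 / (C * (Re z + Im z)) * real m \<le> (\<Sum>i<m. loo_form m T q J z i i)"
proof -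
  let ?tr = "\<Sum>k<m. res_mat m T q J z k k"
  let ?B = "\<Sum>i<m. loo_form m T q J z i i"
  note R = resolvent_res_mat[OF assms(2)]
  have "\<bar>Re ?tr\<bar> \<le> real m / Im z"
    using norm_res_trace[OF assms(1,2)] abs_Re_le_cmod order_trans by blast
  \<comment> \<open>Im (z tr W) also contains Im z * Re (tr W); bounding it by its modulus costs the
    term \<open>Im z * real m\<close> of the assumption.\<close>
  then have "Im z * (Im z * Re ?tr) \<ge> Im z * (- real m)"
    using assms(2) by (intro mult_left_mono) (auto simp: abs_le_iff field_simps)
  then have "a * real m \<le> Im z * Im (z * ?tr)"
    using a(2) unfolding smooth_count_def by (simp add: algebra_simps)
  then have "(a * real m)\<^sup>2 \<le> (Im z * Im (z * ?tr))\<^sup>2"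
    using a(1) by (intro power_mono) auto
  also have "\<dots> \<le> (\<Sum>j\<in>J. \<Sum>i<m. (q j i)\<^sup>2) * ((Re z + Im z) * ?B)"
    using res_form_trace_lower[OF R assms(2,3,1)]
    unfolding res_form_trace_samples[OF R assms(2)] loo_form_def .
  also have "\<dots> \<le> (C * real m) * ((Re z + Im z) * ?B)"
  proof (intro mult_right_mono C mult_nonneg_nonneg)
    interpret B: psd_form m "loo_form m T q J z" by (rule loo_form_psd[OF assms(2)])
    have "0 \<le> loo_form m T q J z i i" if "i < m" for i
      using B.T_psd[of "ind_vec i"] unfolding rform_ind_vec[OF that] .
    then show "0 \<le> ?B" by (intro sum_nonneg) auto
  qed (use assms in auto)
  finally have "real m * (a\<^sup>2 * real m) \<le> real m * (C * (Re z + Im z) * ?B)"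
    by (simp add: power2_eq_square algebra_simps)
  then have "a\<^sup>2 * real m \<le> C * (Re z + Im z) * ?B"
    using m by (simp only: mult_le_cancel_left_pos of_nat_0_less_iff)
  moreover have "C * (Re z + Im z) > 0" using C assms by (simp add: add_nonneg_pos)
  ultimately show ?thesis by (simp add: field_simps)
qed

text \<open>Let g_k be the diagonal coefficient of Im z * Im W at the k-th eigenvector of T. The
  count is the sum of the g_k and the coefficients of B are t_k g_k. As g_k \<le> 1, writing g_k =
  (t_k g_k + s g_k) / (t_k + s) bounds it by t_k g_k / s + s / (t_k + s): the count is carried by tr
  B up to the small eigenvalues of T.\<close>

lemma loo_form_trace_zero:
  assumes "Im z > 0" "s > 0" and ev: "eigenbasis m T b t"
  shows "smooth_count m T q J z \<le> (\<Sum>i<m. loo_form m T q J z i i) / s + (\<Sum>k<m. s / (t k + s))"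
proof -
  interpret eigenbasis m T b t by (rule ev)
  let ?W = "res_mat m T q J z"
  note R = resolvent_res_mat[OF assms(1), of J]
  define G where "G i k = Im z * Im (?W i k)" for i k
  define g where "g k = rform m G (b k) (b k)" for k
  have trG: "smooth_count m T q J z = (\<Sum>k<m. g k)"
    unfolding g_def trace_basis by (simp add: G_def smooth_count_def sum_distrib_left)
  have Im_W: "Im z * Im (mvec m ?W (\<lambda>k. of_real (y k)) i) = mvec m G y i" for y i
    by (simp add: mvec_def G_def sum_distrib_left algebra_simps)
  have tg: "rform m (loo_form m T q J z) (b k) (b k) = t k * g k" if "k < m" for k
  proof -
    have "rform m (loo_form m T q J z) (b k) (b k) = rf (b k) (mvec m G (b k))"
      unfolding loo_form_def rform_res_form Im_W[symmetric] rform_linear(4) ..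
    then show ?thesis unfolding rform_eigen[OF that] g_def rform_mvec[of m G] .
  qed
  have pos: "0 \<le> t k * g k" if "k < m" for k
    using psd_form.T_psd[OF loo_form_psd[OF assms(1)], of J "b k"] tg[OF that] by simp
  have le1: "g k \<le> 1" if k: "k < m" for k
  proof (cases "t k = 0")
    case True
    \<comment> \<open>Domination by T says nothing on the kernel of T, but there the operator
      vanishes and the resolvent is explicitly -1/z.\<close>
    have "cf (cq j) (\<lambda>i. of_real (b k i)) = 0" for j
    proof -
      have "cf (\<lambda>i. of_real (x i)) (\<lambda>i. of_real (y i)) = of_real (rf x y)" for x y
        unfolding cform_def rform_def by simp
      then show ?thesis using rform_eigen[OF k, of "q j"] True by (simp add: rform_commute[of "q j"])
    qed
    moreover define w where "w = - 1 / z"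
    have w: "z * w = -1" using assms(1) unfolding w_def by auto
    ultimately have "res_sol J z (\<lambda>i. of_real (b k i)) (\<lambda>i. w * of_real (b k i))"
      unfolding res_sol_def samp_op_linear mult.assoc[symmetric] by (simp add: samp_op_def)
    then have sol: "mvec m ?W (\<lambda>i. of_real (b k i)) i = 1 * (w * of_real (b k i))" if "i < m" for i
      by (rule res_sol_unique[OF resolvent_apply[OF R] _ assms(1) _ that]) simp
    have "mvec m G (b k) i = Im z * Im w * b k i" if "i < m" for i
      unfolding Im_W[symmetric] sol[OF that] by simp
    then have "(\<Sum>i<m. b k i * mvec m G (b k) i) = (\<Sum>i<m. Im z * Im w * (b k i * b k i))"
      by (intro sum.cong refl) auto
    then have "g k = Im z * Im w * (\<Sum>i<m. b k i * b k i)"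
      unfolding g_def rform_mvec sum_distrib_left .
    also have "\<dots> = Im z * Im w" using orth[OF k k] by simp
    also have "\<dots> = (Im z)\<^sup>2 / ((Re z)\<^sup>2 + (Im z)\<^sup>2)"
      by (simp add: w_def Im_divide power2_eq_square)
    also have "\<dots> \<le> 1" using assms(1) by (simp add: divide_le_eq_1 sum_power2_gt_zero_iff)
    finally show ?thesis .
  next
    case False
    have "t k * g k \<le> rf (b k) (b k)"
      unfolding tg[OF k, symmetric] loo_form_def by (rule res_form_le[OF R assms(1)])
    then have "t k * g k \<le> t k * 1" unfolding rform_eigen[OF k] orth[OF k k] by simp
    then show ?thesis using False eigenvalue_nonneg[OF k] by simp
  qed
  have "g k \<le> t k * g k / s + s / (t k + s)" if k: "k < m" for k
  proof -
    have p: "0 < t k + s" using eigenvalue_nonneg[OF k] assms(2) by simp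
    then have "g k = (t k + s) * g k / (t k + s)" by simp
    then have "g k = t k * g k / (t k + s) + s * g k / (t k + s)"
      by (simp only: distrib_right add_divide_distrib)
    moreover have "t k * g k / (t k + s) \<le> t k * g k / s"
      using p pos[OF k] assms(2) eigenvalue_nonneg[OF k] by (intro divide_left_mono) auto
    moreover have "s * g k / (t k + s) \<le> s / (t k + s)"
      using p le1[OF k] assms(2) by (intro divide_right_mono) auto
    ultimately show ?thesis by linarith
  qed
  then have "smooth_count m T q J z \<le> (\<Sum>k<m. t k * g k / s + s / (t k + s))"
    unfolding trG by (intro sum_mono) auto
  also have "\<dots> = (\<Sum>k<m. rform m (loo_form m T q J z) (b k) (b k)) / s + (\<Sum>k<m. s / (t k + s))"
    by (simp add: sum.distrib tg flip: sum_divide_distrib)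
  finally show ?thesis unfolding trace_basis .
qed

text \<open>Each term of \<open>resolvent_trace\<close> is 1 - \<beta>_j by the rank-one update.
  Outside \<open>E\<close> the assumed lower bound makes the imaginary part of the denominator at
  least t / Im z, hence |\<beta>_j| \<le> Im z / t; columns in \<open>E\<close> get the crude
  bound.\<close>

lemma leave_one_out:
  assumes "finite J" "Im z > 0" "Re z \<ge> 0" "t > 0"
    and good: "\<And>j. j \<in> J \<Longrightarrow> j \<notin> E \<Longrightarrow> t \<le> rform m (loo_form m T q (J - {j}) z) (q j) (q j)"
    and E: "E \<subseteq> J"
  obtains \<beta> where "of_nat m + z * (\<Sum>k<m. res_mat m T q J z k k) = of_nat (card J) - \<beta>"
    "cmod \<beta> \<le> real (card J) * (Im z / t) + real (card E) * (cmod z / Im z)"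
    "Re z = 0 \<Longrightarrow> 0 \<le> Re \<beta>"
proof -
  define x0 where "x0 j = mvec m (res_mat m T q (J - {j}) z) (cq j)" for j
  define \<beta> where "\<beta> j = inverse (1 + cf (cq j) (x0 j))" for j
  have sol: "res_sol (J - {j}) z (cq j) (x0 j)" for j
    unfolding x0_def by (rule resolvent_apply[OF resolvent_res_mat[OF assms(2)]])
  have \<beta>_eq: "cf (cq j) (mvec m (res_mat m T q J z) (cq j)) = 1 - \<beta> j" if "j \<in> J" for j
  proof -
    have "res_sol (insert j (J - {j})) z (cq j) (mvec m (res_mat m T q J z) (cq j))"
      using that resolvent_apply[OF resolvent_res_mat[OF assms(2)], of J] by (simp add: insert_absorb)
    from res_sol_insert(2)[OF _ _ sol this assms(2)] assms(1)
    have *: "(1 + cf (cq j) (x0 j)) * (1 - cf (cq j) (mvec m (res_mat m T q J z) (cq j))) = 1" by simp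
    show ?thesis using inverse_unique[OF *] unfolding \<beta>_def by simp
  qed
  have bound: "cmod (\<beta> j) \<le> Im z / t + (if j \<in> E then cmod z / Im z else 0)" if "j \<in> J" for j
  proof (cases "j \<in> E")
    case True
    have "cmod (\<beta> j) \<le> cmod z / Im z"
      using norm_inverse_one_plus[OF sol[of j] assms(2)] assms(2) unfolding \<beta>_def by (simp add: field_simps)
    then show ?thesis using True assms by (simp add: add_increasing)
  next
    case False
    have "t \<le> (Im z)\<^sup>2 * nsq (x0 j)"
      using good[OF that False] unfolding loo_form_def x0_def
      by (simp add: res_form_quadratic[OF resolvent_res_mat[OF assms(2)] assms(2)])
    then have "cmod (\<beta> j) * t \<le> cmod (\<beta> j) * (Im z * nsq (x0 j)) * Im z"
      using mult_left_mono[of t "(Im z)\<^sup>2 * nsq (x0 j)" "cmod (\<beta> j)"] by (simp add: power2_eq_square algebra_simps)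
    also have "\<dots> \<le> 1 * Im z"
      unfolding \<beta>_def using assms(2) by (intro mult_right_mono norm_inverse_one_plus_nsq[OF sol]) auto
    finally show ?thesis using False assms(4) by (simp add: field_simps)
  qed
  show ?thesis
  proof (rule that[of "\<Sum>j\<in>J. \<beta> j"])
    have "of_nat m + z * (\<Sum>k<m. res_mat m T q J z k k) = (\<Sum>j\<in>J. 1 - \<beta> j)"
      unfolding resolvent_trace[OF resolvent_res_mat[OF assms(2)], symmetric]
      by (intro sum.cong refl \<beta>_eq)
    then show "of_nat m + z * (\<Sum>k<m. res_mat m T q J z k k) = of_nat (card J) - (\<Sum>j\<in>J. \<beta> j)"
      by (simp add: sum_subtractf)
    have "cmod (\<Sum>j\<in>J. \<beta> j) \<le> (\<Sum>j\<in>J. Im z / t + (if j \<in> E then cmod z / Im z else 0))"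
      by (rule sum_norm_le) (rule bound)
    also have "(\<Sum>j\<in>J. if j \<in> E then cmod z / Im z else 0) = real (card E) * (cmod z / Im z)"
      using assms(1) E by (simp add: sum.inter_restrict[symmetric] Int_absorb1)
    then have "(\<Sum>j\<in>J. Im z / t + (if j \<in> E then cmod z / Im z else 0))
      = real (card J) * (Im z / t) + real (card E) * (cmod z / Im z)"
      by (simp add: sum.distrib)
    finally show "cmod (\<Sum>j\<in>J. \<beta> j) \<le> real (card J) * (Im z / t) + real (card E) * (cmod z / Im z)" .
    show "0 \<le> Re (\<Sum>j\<in>J. \<beta> j)" if "Re z = 0"
      unfolding Re_sum using Re_inverse_one_plus[OF sol assms(2) that] unfolding \<beta>_def by (intro sum_nonneg) auto
  qed
qed

text \<open>The imaginary part of the leave-one-out identity, multiplied by Im z.\<close>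

lemma smooth_count_pos_bound:
  assumes "finite J" "Im z > 0" "Re z \<ge> 0" "t > 0"
    and "\<And>j. j \<in> J \<Longrightarrow> j \<notin> E \<Longrightarrow> t \<le> rform m (loo_form m T q (J - {j}) z) (q j) (q j)"
    and "E \<subseteq> J"
  shows "Re z * smooth_count m T q J z
     \<le> real (card J) * ((Im z)\<^sup>2 / t) + real (card E) * cmod z + Im z * real m"
proof -
  let ?tr = "\<Sum>k<m. res_mat m T q J z k k"
  obtain \<beta> where \<beta>: "of_nat m + z * ?tr = of_nat (card J) - \<beta>"
    "cmod \<beta> \<le> real (card J) * (Im z / t) + real (card E) * (cmod z / Im z)"
    by (rule leave_one_out[OF assms]) blast
  have "Re z * Im ?tr + Im z * Re ?tr = - Im \<beta>"
    using arg_cong[OF \<beta>(1), of Im] by (simp add: algebra_simps)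
  moreover have "\<bar>Re ?tr\<bar> \<le> real m / Im z"
    using norm_res_trace[OF assms(1,2)] abs_Re_le_cmod order_trans by blast
  then have "Im z * (- Re ?tr) \<le> Im z * (real m / Im z)"
    using assms(2) by (intro mult_left_mono) auto
  ultimately have "Re z * Im ?tr \<le> cmod \<beta> + real m"
    using assms(2) abs_Im_le_cmod[of \<beta>] by simp
  then have "Re z * Im ?tr \<le> real (card J) * (Im z / t) + real (card E) * (cmod z / Im z) + real m"
    using \<beta>(2) by linarith
  from mult_left_mono[OF this, of "Im z"] show ?thesis
    using assms(2) unfolding smooth_count_def by (simp add: power2_eq_square algebra_simps)
qed

text \<open>On the imaginary axis z tr W has real part minus the count, so the real part of the
  identity compares m minus the count with the number of columns.\<close>

lemma smooth_count_zero_bound: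
  assumes "finite J" "Im z > 0" "Re z = 0" "t > 0"
    and "\<And>j. j \<in> J \<Longrightarrow> j \<notin> E \<Longrightarrow> t \<le> rform m (loo_form m T q (J - {j}) z) (q j) (q j)"
    and "E \<subseteq> J"
  shows "smooth_count m T q J z
     \<le> real m - real (card J) + real (card J) * (Im z / t) + real (card E)"
proof -
  let ?tr = "\<Sum>k<m. res_mat m T q J z k k"
  have z: "cmod z = Im z" using assms(2,3) by (simp add: cmod_def)
  have "Re z \<ge> 0" using assms(3) by simp
  then obtain \<beta> where \<beta>: "of_nat m + z * ?tr = of_nat (card J) - \<beta>"
    "cmod \<beta> \<le> real (card J) * (Im z / t) + real (card E) * (cmod z / Im z)"
    using leave_one_out[OF assms(1,2) _ assms(4,5,6)] by metis
  have "real m - smooth_count m T q J z = real (card J) - Re \<beta>"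
    using arg_cong[OF \<beta>(1), of Re] assms(3) unfolding smooth_count_def by simp
  moreover have "Re \<beta> \<le> cmod \<beta>" by (rule complex_Re_le_cmod)
  ultimately show ?thesis using \<beta>(2) assms(2) unfolding z by simp
qed

lemma smooth_count_zero_ge:
  assumes "finite J" "Im z > 0" "Re z = 0"
  shows "real m - real (card J) \<le> smooth_count m T q J z"
proof -
  let ?tr = "\<Sum>k<m. res_mat m T q J z k k"
  have "Re z \<ge> 0" using assms(3) by simp
  \<comment> \<open>All columns are declared exceptional, so no lower bound on quadratic forms has
    to be supplied; only the sign of Re \<beta> is wanted.\<close>
  then obtain \<beta> where \<beta>: "of_nat m + z * ?tr = of_nat (card J) - \<beta>" "0 \<le> Re \<beta>"
    using leave_one_out[OF assms(1,2), of 1 J] assms(3) by force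
  have "real m - smooth_count m T q J z = real (card J) - Re \<beta>"
    using arg_cong[OF \<beta>(1), of Re] assms(3) unfolding smooth_count_def by simp
  with \<beta>(2) show ?thesis by simp
qed

end

section \<open>Linear and quadratic forms in independent entries\<close>

text \<open>The cross term vanishes. Stated for nonnegative integrals so that iterated integration
  needs no integrability of the outer function.\<close>

lemma (in prob_space) nn_integral_square_add:
  fixes k :: "'a \<Rightarrow> real"
  assumes [measurable]: "k \<in> borel_measurable M" and sq: "integrable M (\<lambda>y. (k y)\<^sup>2)" and 0: "expectation k = 0"
  shows "(\<integral>\<^sup>+y. ennreal ((A + k y)\<^sup>2) \<partial>M) = ennreal (A\<^sup>2 + expectation (\<lambda>y. (k y)\<^sup>2))"
proof -
  have k: "integrable M k" using square_integrable_imp_integrable[OF assms(1) sq] .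
  have eq: "(A + k y)\<^sup>2 = A\<^sup>2 + 2 * A * k y + (k y)\<^sup>2" for y by (simp add: power2_sum)
  have int: "integrable M (\<lambda>y. A\<^sup>2 + 2 * A * k y + (k y)\<^sup>2)" using k sq by auto
  have "(\<integral>\<^sup>+y. ennreal ((A + k y)\<^sup>2) \<partial>M) = ennreal (expectation (\<lambda>y. A\<^sup>2 + 2 * A * k y + (k y)\<^sup>2))"
    unfolding eq by (rule nn_integral_eq_integral[OF int]) (auto simp: eq[symmetric])
  also have "expectation (\<lambda>y. A\<^sup>2 + 2 * A * k y + (k y)\<^sup>2) = A\<^sup>2 + expectation (\<lambda>y. (k y)\<^sup>2)"
    using k sq 0 by (simp add: prob_space)
  finally show ?thesis .
qed

locale real_law = prob_space D for D :: "real measure" +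
  assumes sets_D [measurable_cong]: "sets D = sets borel"
begin

abbreviation PD :: "nat \<Rightarrow> (nat \<Rightarrow> real) measure" where "PD p \<equiv> PiM {..<p} (\<lambda>_. D)"

sublocale PD: product_prob_space "\<lambda>_. D" "{..<p}" for p :: nat
  by unfold_locales

lemma PD_nn_integral_Suc:
  assumes "f \<in> borel_measurable (PD (Suc p))"
  shows "integral\<^sup>N (PD (Suc p)) f = (\<integral>\<^sup>+x. (\<integral>\<^sup>+y. f (x(p := y)) \<partial>D) \<partial>PD p)"
  unfolding lessThan_Suc using assms
  by (intro PD.product_nn_integral_insert) (auto simp: lessThan_Suc)

lemma PD_comp_measurable:
  assumes "i < p"
  shows "(\<lambda>x. x i) \<in> borel_measurable (PD p)"
proof -
  have "(\<lambda>x. x i) \<in> PD p \<rightarrow>\<^sub>M D" using assms by (intro measurable_component_singleton) auto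
  then show ?thesis by (simp add: measurable_cong_sets[OF refl sets_D])
qed

lemma PD_linear_measurable [measurable]:
  fixes g :: "real \<Rightarrow> real"
  assumes [measurable]: "g \<in> borel_measurable borel"
  shows "(\<lambda>x. \<Sum>i<p. c i * g (x i)) \<in> borel_measurable (PD p)"
proof (rule borel_measurable_sum)
  fix i assume "i \<in> {..<p}"
  then have [measurable]: "(\<lambda>x. x i) \<in> borel_measurable (PD p)" by (simp add: PD_comp_measurable)
  show "(\<lambda>x. c i * g (x i)) \<in> borel_measurable (PD p)" by measurable
qed

lemma PD_bilinear_measurable [measurable]:
  fixes g h :: "real \<Rightarrow> real"
  assumes [measurable]: "g \<in> borel_measurable borel" "h \<in> borel_measurable borel"
  shows "(\<lambda>x. \<Sum>i<p. \<Sum>l<p. B i l * g (x i) * h (x l)) \<in> borel_measurable (PD p)"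
proof (rule borel_measurable_sum, rule borel_measurable_sum)
  fix i l assume "i \<in> {..<p}" "l \<in> {..<p}"
  then have [measurable]: "(\<lambda>x. x i) \<in> borel_measurable (PD p)" "(\<lambda>x. x l) \<in> borel_measurable (PD p)"
    by (simp_all add: PD_comp_measurable)
  show "(\<lambda>x. B i l * g (x i) * h (x l)) \<in> borel_measurable (PD p)" by measurable
qed

lemma linear_variance:
  fixes g :: "real \<Rightarrow> real"
  assumes [measurable]: "g \<in> borel_measurable borel"
    and g: "integrable D (\<lambda>y. (g y)\<^sup>2)" "expectation g = 0" "expectation (\<lambda>y. (g y)\<^sup>2) \<le> \<kappa>"
  shows "(\<integral>\<^sup>+x. ennreal ((\<Sum>i<p. c i * g (x i))\<^sup>2) \<partial>PD p) \<le> ennreal (\<kappa> * (\<Sum>i<p. (c i)\<^sup>2))"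
proof (induction p)
  case 0
  then show ?case by simp
next
  case (Suc p)
  have \<kappa>: "0 \<le> \<kappa>" using g(3) by (rule order_trans[rotated]) simp
  have gi: "integrable D g" using square_integrable_imp_integrable[of g] g(1) by simp
  have "(\<integral>\<^sup>+x. ennreal ((\<Sum>i<Suc p. c i * g (x i))\<^sup>2) \<partial>PD (Suc p))
      = (\<integral>\<^sup>+x. (\<integral>\<^sup>+y. ennreal (((\<Sum>i<p. c i * g (x i)) + c p * g y)\<^sup>2) \<partial>D) \<partial>PD p)"
  proof (subst PD_nn_integral_Suc)
    show "(\<lambda>x. ennreal ((\<Sum>i<Suc p. c i * g (x i))\<^sup>2)) \<in> borel_measurable (PD (Suc p))"
      by measurable
  qed simp
  also have "\<dots> = (\<integral>\<^sup>+x. ennreal ((\<Sum>i<p. c i * g (x i))\<^sup>2 + (c p)\<^sup>2 * expectation (\<lambda>y. (g y)\<^sup>2)) \<partial>PD p)"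
    using g gi by (simp add: nn_integral_square_add power_mult_distrib)
  also have "\<dots> \<le> (\<integral>\<^sup>+x. ennreal ((\<Sum>i<p. c i * g (x i))\<^sup>2) + ennreal (\<kappa> * (c p)\<^sup>2) \<partial>PD p)"
  proof (intro nn_integral_mono)
    fix x
    have "(c p)\<^sup>2 * expectation (\<lambda>y. (g y)\<^sup>2) \<le> \<kappa> * (c p)\<^sup>2"
      using mult_right_mono[OF g(3), of "(c p)\<^sup>2"] by (simp add: mult.commute)
    then show "ennreal ((\<Sum>i<p. c i * g (x i))\<^sup>2 + (c p)\<^sup>2 * expectation (\<lambda>y. (g y)\<^sup>2))
      \<le> ennreal ((\<Sum>i<p. c i * g (x i))\<^sup>2) + ennreal (\<kappa> * (c p)\<^sup>2)"
      using \<kappa> by (simp flip: ennreal_plus add: ennreal_leI)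
  qed
  also have "\<dots> = (\<integral>\<^sup>+x. ennreal ((\<Sum>i<p. c i * g (x i))\<^sup>2) \<partial>PD p) + ennreal (\<kappa> * (c p)\<^sup>2)"
    by (simp add: nn_integral_add PD.emeasure_space_1)
  also have "\<dots> \<le> ennreal (\<kappa> * (\<Sum>i<p. (c i)\<^sup>2)) + ennreal (\<kappa> * (c p)\<^sup>2)"
    by (intro add_mono Suc order_refl)
  also have "\<dots> = ennreal (\<kappa> * (\<Sum>i<Suc p. (c i)\<^sup>2))"
    using \<kappa> by (subst ennreal_plus[symmetric]) (auto simp: distrib_left sum_nonneg)
  finally show ?case .
qed

lemma square_sum3: "(a + b + c)\<^sup>2 \<le> 3 * (a\<^sup>2 + b\<^sup>2 + c\<^sup>2)" for a b c :: real
proof -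
  have "0 \<le> (a - b)\<^sup>2 + (b - c)\<^sup>2 + (a - c)\<^sup>2" by simp
  then show ?thesis by (simp add: power2_eq_square algebra_simps)
qed

text \<open>Adding one coordinate changes the centred form by a quantity that has mean zero in the
  new coordinate for fixed old ones, so the second moments add. No fourth moment of g or h enters,
  only one of the product g h, which is harmless when g is bounded.\<close>

lemma bilinear_variance:
  fixes g h :: "real \<Rightarrow> real"
  assumes [measurable]: "g \<in> borel_measurable borel" "h \<in> borel_measurable borel"
    and g: "integrable D (\<lambda>y. (g y)\<^sup>2)" "expectation g = 0" "expectation (\<lambda>y. (g y)\<^sup>2) \<le> \<kappa>"
    and h: "integrable D (\<lambda>y. (h y)\<^sup>2)" "expectation h = 0" "expectation (\<lambda>y. (h y)\<^sup>2) \<le> \<kappa>"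
    and gh: "integrable D (\<lambda>y. (g y * h y - r)\<^sup>2)" "expectation (\<lambda>y. g y * h y) = r"
      "expectation (\<lambda>y. (g y * h y - r)\<^sup>2) \<le> \<kappa>"
  shows "(\<integral>\<^sup>+x. ennreal (((\<Sum>i<p. \<Sum>l<p. B i l * g (x i) * h (x l)) - r * (\<Sum>i<p. B i i))\<^sup>2) \<partial>PD p)
     \<le> ennreal (3 * \<kappa> * (\<kappa> + 1) * (\<Sum>i<p. \<Sum>l<p. (B i l)\<^sup>2))"
proof (induction p)
  case 0
  then show ?case by simp
next
  case (Suc p)
  have \<kappa>: "0 \<le> \<kappa>" using g(3) by (rule order_trans[rotated]) simp
  define V where "V x = (\<Sum>i<p. \<Sum>l<p. B i l * g (x i) * h (x l)) - r * (\<Sum>i<p. B i i)" for x :: "nat \<Rightarrow> real"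
  define a where "a x = (\<Sum>i<p. B i p * g (x i))" for x :: "nat \<Rightarrow> real"
  define b where "b x = (\<Sum>l<p. B p l * h (x l))" for x :: "nat \<Rightarrow> real"
  have [measurable]: "V \<in> borel_measurable (PD p)" "a \<in> borel_measurable (PD p)" "b \<in> borel_measurable (PD p)"
    unfolding V_def a_def b_def by measurable
  \<comment> \<open>The increment: contributions of the new column, the new row, and the new
    diagonal entry.\<close>
  define k where "k x y = a x * h y + b x * g y + B p p * (g y * h y - r)" for x y
  have gi: "integrable D g" using square_integrable_imp_integrable[of g] g(1) by simp
  have hi: "integrable D h" using square_integrable_imp_integrable[of h] h(1) by simp
  have ghi: "integrable D (\<lambda>y. g y * h y - r)" using square_integrable_imp_integrable[of "\<lambda>y. g y * h y - r"] gh(1) by simp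
  have ghi': "integrable D (\<lambda>y. g y * h y)" using Bochner_Integration.integrable_add[OF ghi, of "\<lambda>_. r"] by simp
  have k_le: "(k x y)\<^sup>2 \<le> 3 * ((a x)\<^sup>2 * (h y)\<^sup>2 + (b x)\<^sup>2 * (g y)\<^sup>2 + (B p p)\<^sup>2 * (g y * h y - r)\<^sup>2)" for x y
    unfolding k_def using square_sum3[of "a x * h y" "b x * g y" "B p p * (g y * h y - r)"]
    by (simp add: power_mult_distrib)
  have k_int: "integrable D (\<lambda>y. 3 * ((a x)\<^sup>2 * (h y)\<^sup>2 + (b x)\<^sup>2 * (g y)\<^sup>2 + (B p p)\<^sup>2 * (g y * h y - r)\<^sup>2))" for x
    using g(1) h(1) gh(1) by auto
  have [measurable]: "k x \<in> borel_measurable D" for x unfolding k_def by measurable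
  have k_sq: "integrable D (\<lambda>y. (k x y)\<^sup>2)" for x
    by (rule Bochner_Integration.integrable_bound[OF k_int[of x]]) (use k_le[of x] in \<open>auto intro: order_trans[OF k_le abs_ge_self]\<close>)
  have k0: "expectation (k x) = 0" for x
    unfolding k_def using g h gh gi hi ghi ghi' by (simp add: prob_space)
  have k_var: "expectation (\<lambda>y. (k x y)\<^sup>2) \<le> 3 * \<kappa> * ((a x)\<^sup>2 + (b x)\<^sup>2 + (B p p)\<^sup>2)" for x
  proof -
    have "expectation (\<lambda>y. (k x y)\<^sup>2)
      \<le> expectation (\<lambda>y. 3 * ((a x)\<^sup>2 * (h y)\<^sup>2 + (b x)\<^sup>2 * (g y)\<^sup>2 + (B p p)\<^sup>2 * (g y * h y - r)\<^sup>2))"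
      by (intro integral_mono k_sq k_int k_le)
    also have "\<dots> = 3 * ((a x)\<^sup>2 * expectation (\<lambda>y. (h y)\<^sup>2) + (b x)\<^sup>2 * expectation (\<lambda>y. (g y)\<^sup>2)
        + (B p p)\<^sup>2 * expectation (\<lambda>y. (g y * h y - r)\<^sup>2))"
      using g(1) h(1) gh(1) by simp
    also have "\<dots> \<le> 3 * ((a x)\<^sup>2 * \<kappa> + (b x)\<^sup>2 * \<kappa> + (B p p)\<^sup>2 * \<kappa>)"
      using g(3) h(3) gh(3) by (intro mult_left_mono add_mono) auto
    finally show ?thesis by (simp add: algebra_simps)
  qed
  have step: "(\<Sum>i<Suc p. \<Sum>l<Suc p. B i l * g ((x(p := y)) i) * h ((x(p := y)) l)) - r * (\<Sum>i<Suc p. B i i)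
      = V x + k x y" for x y
    unfolding V_def k_def a_def b_def
    by (simp add: sum.distrib sum_distrib_left sum_distrib_right algebra_simps)
  have "(\<integral>\<^sup>+x. ennreal (((\<Sum>i<Suc p. \<Sum>l<Suc p. B i l * g (x i) * h (x l)) - r * (\<Sum>i<Suc p. B i i))\<^sup>2) \<partial>PD (Suc p))
      = (\<integral>\<^sup>+x. (\<integral>\<^sup>+y. ennreal ((V x + k x y)\<^sup>2) \<partial>D) \<partial>PD p)"
    unfolding step[symmetric]
  proof (rule PD_nn_integral_Suc)
    show "(\<lambda>x. ennreal (((\<Sum>i<Suc p. \<Sum>l<Suc p. B i l * g (x i) * h (x l)) - r * (\<Sum>i<Suc p. B i i))\<^sup>2))
      \<in> borel_measurable (PD (Suc p))" by measurable
  qed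
  also have "\<dots> = (\<integral>\<^sup>+x. ennreal ((V x)\<^sup>2 + expectation (\<lambda>y. (k x y)\<^sup>2)) \<partial>PD p)"
    by (simp add: nn_integral_square_add k_sq k0)
  also have "\<dots> \<le> (\<integral>\<^sup>+x. ennreal ((V x)\<^sup>2) + (ennreal (3 * \<kappa>) * ennreal ((a x)\<^sup>2)
      + (ennreal (3 * \<kappa>) * ennreal ((b x)\<^sup>2) + ennreal (3 * \<kappa> * (B p p)\<^sup>2))) \<partial>PD p)"
  proof (intro nn_integral_mono)
    fix x
    have "(V x)\<^sup>2 + expectation (\<lambda>y. (k x y)\<^sup>2) \<le> (V x)\<^sup>2 + (3 * \<kappa> * (a x)\<^sup>2 + (3 * \<kappa> * (b x)\<^sup>2 + 3 * \<kappa> * (B p p)\<^sup>2))"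
      using k_var[of x] by (simp add: algebra_simps)
    then show "ennreal ((V x)\<^sup>2 + expectation (\<lambda>y. (k x y)\<^sup>2)) \<le> ennreal ((V x)\<^sup>2) + (ennreal (3 * \<kappa>) * ennreal ((a x)\<^sup>2)
      + (ennreal (3 * \<kappa>) * ennreal ((b x)\<^sup>2) + ennreal (3 * \<kappa> * (B p p)\<^sup>2)))"
      using \<kappa> by (simp flip: ennreal_plus ennreal_mult add: ennreal_leI)
  qed
  also have "\<dots> = (\<integral>\<^sup>+x. ennreal ((V x)\<^sup>2) \<partial>PD p) + (ennreal (3 * \<kappa>) * (\<integral>\<^sup>+x. ennreal ((a x)\<^sup>2) \<partial>PD p)
      + (ennreal (3 * \<kappa>) * (\<integral>\<^sup>+x. ennreal ((b x)\<^sup>2) \<partial>PD p) + ennreal (3 * \<kappa> * (B p p)\<^sup>2)))"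
    by (simp add: nn_integral_add nn_integral_cmult PD.emeasure_space_1)
  also have "\<dots> \<le> ennreal (3 * \<kappa> * (\<kappa> + 1) * (\<Sum>i<p. \<Sum>l<p. (B i l)\<^sup>2))
      + (ennreal (3 * \<kappa>) * ennreal (\<kappa> * (\<Sum>i<p. (B i p)\<^sup>2))
      + (ennreal (3 * \<kappa>) * ennreal (\<kappa> * (\<Sum>l<p. (B p l)\<^sup>2)) + ennreal (3 * \<kappa> * (B p p)\<^sup>2)))"
    unfolding V_def a_def b_def
    by (intro add_mono mult_left_mono Suc.IH linear_variance g h order_refl) auto
  also have "\<dots> = ennreal (3 * \<kappa> * (\<kappa> + 1) * (\<Sum>i<p. \<Sum>l<p. (B i l)\<^sup>2)
      + (3 * \<kappa> * (\<kappa> * (\<Sum>i<p. (B i p)\<^sup>2)) + (3 * \<kappa> * (\<kappa> * (\<Sum>l<p. (B p l)\<^sup>2)) + 3 * \<kappa> * (B p p)\<^sup>2)))"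
    using \<kappa> by (simp add: ennreal_plus ennreal_mult sum_nonneg del: ennreal_plus[symmetric])
  also have "\<dots> \<le> ennreal (3 * \<kappa> * (\<kappa> + 1) * (\<Sum>i<Suc p. \<Sum>l<Suc p. (B i l)\<^sup>2))"
  proof (rule ennreal_leI)
    let ?S1 = "\<Sum>i<p. (B i p)\<^sup>2" and ?S2 = "\<Sum>l<p. (B p l)\<^sup>2"
    have "3 * \<kappa> * (\<kappa> * ?S1) + (3 * \<kappa> * (\<kappa> * ?S2) + 3 * \<kappa> * (B p p)\<^sup>2)
       \<le> 3 * \<kappa> * ((\<kappa> + 1) * ?S1) + (3 * \<kappa> * ((\<kappa> + 1) * ?S2) + 3 * \<kappa> * ((\<kappa> + 1) * (B p p)\<^sup>2))"
      using \<kappa> by (intro add_mono mult_left_mono mult_right_mono) (auto simp: sum_nonneg distrib_right)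
    then show "3 * \<kappa> * (\<kappa> + 1) * (\<Sum>i<p. \<Sum>l<p. (B i l)\<^sup>2)
      + (3 * \<kappa> * (\<kappa> * ?S1) + (3 * \<kappa> * (\<kappa> * ?S2) + 3 * \<kappa> * (B p p)\<^sup>2))
      \<le> 3 * \<kappa> * (\<kappa> + 1) * (\<Sum>i<Suc p. \<Sum>l<Suc p. (B i l)\<^sup>2)"
      by (simp add: sum.distrib algebra_simps)
  qed
  finally show ?case .
qed

end

lemma (in prob_space) prob_abs_ge_le:
  fixes V :: "'a \<Rightarrow> real"
  assumes [measurable]: "V \<in> borel_measurable M"
    and v: "(\<integral>\<^sup>+x. ennreal ((V x)\<^sup>2) \<partial>M) \<le> ennreal v" "0 \<le> v" and "0 < s"
  shows "prob {x \<in> space M. s \<le> \<bar>V x\<bar>} \<le> v / s\<^sup>2"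
proof -
  have "{x \<in> space M. s \<le> \<bar>V x\<bar>} = {x \<in> space M. 1 \<le> ennreal (1 / s\<^sup>2) * ennreal ((V x)\<^sup>2)}"
  proof -
    have "s \<le> \<bar>V x\<bar> \<longleftrightarrow> 1 \<le> ennreal (1 / s\<^sup>2) * ennreal ((V x)\<^sup>2)" for x
    proof -
      have "1 \<le> ennreal (1 / s\<^sup>2) * ennreal ((V x)\<^sup>2) \<longleftrightarrow> 1 \<le> (V x)\<^sup>2 / s\<^sup>2"
        using \<open>0 < s\<close> by (simp add: ennreal_mult[symmetric] flip: ennreal_1)
      also have "\<dots> \<longleftrightarrow> s\<^sup>2 \<le> (V x)\<^sup>2" using \<open>0 < s\<close> by (simp add: le_divide_eq)
      also have "\<dots> \<longleftrightarrow> s \<le> \<bar>V x\<bar>" using \<open>0 < s\<close> by (simp add: abs_le_square_iff[symmetric])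
      finally show ?thesis by simp
    qed
    then show ?thesis by auto
  qed
  then have "emeasure M {x \<in> space M. s \<le> \<bar>V x\<bar>} \<le> ennreal (1 / s\<^sup>2) * (\<integral>\<^sup>+x. ennreal ((V x)\<^sup>2) * indicator (space M) x \<partial>M)"
    by (simp only:) (rule nn_integral_Markov_inequality, auto)
  also have "(\<integral>\<^sup>+x. ennreal ((V x)\<^sup>2) * indicator (space M) x \<partial>M) = (\<integral>\<^sup>+x. ennreal ((V x)\<^sup>2) \<partial>M)"
    by (intro nn_integral_cong) auto
  also have "ennreal (1 / s\<^sup>2) * \<dots> \<le> ennreal (1 / s\<^sup>2) * ennreal v"
    by (intro mult_left_mono v) auto
  also have "\<dots> = ennreal (v / s\<^sup>2)" using v(2) by (simp add: ennreal_mult[symmetric])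
  finally show ?thesis using v(2) by (simp add: emeasure_eq_measure)
qed

text \<open>Since \<open>q(X - \<alpha> f) \<ge> 0\<close>, the form \<open>q\<close> is bounded below by \<open>2 \<alpha> B(f, X) - \<alpha>\<^sup>2 q(f)\<close>. With \<open>f\<close> a bounded
  centred function of the entries, both terms have small variance although the entries only have two moments.\<close>

lemma (in real_law) quadratic_form_lower_tail:
  assumes int: "integrable D (\<lambda>x. x)" and sq: "integrable D (\<lambda>x. (x - \<mu>)\<^sup>2)"
    and mean: "expectation (\<lambda>x. x) = \<mu>" and var: "expectation (\<lambda>x. (x - \<mu>)\<^sup>2) = 1"
    and "c > 0" "\<delta> > 0"
  obtains t \<eta> where "t > 0" "\<eta> > 0"
    "\<And>m B. m > 0 \<Longrightarrow> psd_form m B \<Longrightarrow> good_form m c \<eta> B \<Longrightarrow>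
      measure (PD m) {x \<in> space (PD m). rform m B x x < t * real m} \<le> \<delta>"
proof -
  \<comment> \<open>The bounded test function is the centred arctan of the centred entry. Strict
    monotonicity of arctan with arctan 0 = 0 makes its correlation \<rho> with the entry
    positive.\<close>
  define a0 where "a0 = expectation (\<lambda>x. arctan (x - \<mu>))"
  define \<phi> where "\<phi> x = arctan (x - \<mu>) - a0" for x
  define Z where "Z x = x - \<mu>" for x :: real
  have arctan_meas [measurable]: "(\<lambda>x. arctan (x - \<mu>)) \<in> borel_measurable borel"
    by (intro borel_measurable_continuous_onI continuous_intros)
  have \<phi>_meas [measurable]: "\<phi> \<in> borel_measurable borel"
    unfolding \<phi>_def by (intro borel_measurable_continuous_onI continuous_intros)
  have Z_meas [measurable]: "Z \<in> borel_measurable borel"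
    unfolding Z_def by (intro borel_measurable_continuous_onI continuous_intros)
  have D_borel: "measurable D borel = (borel_measurable borel :: (real \<Rightarrow> real) set)"
    by (rule measurable_cong_sets[OF sets_D refl])
  have [measurable]: "(\<lambda>x. arctan (x - \<mu>)) \<in> borel_measurable D" "\<phi> \<in> borel_measurable D" "Z \<in> borel_measurable D"
    unfolding D_borel by (rule arctan_meas \<phi>_meas Z_meas)+
  have arctan_le: "\<bar>arctan y\<bar> \<le> pi / 2" for y :: real
    using arctan_ubound[of y] arctan_lbound[of y] by linarith
  have arctan_int: "integrable D (\<lambda>x. arctan (x - \<mu>))"
    by (rule integrable_const_bound[where B = "pi / 2"]) (simp_all only: real_norm_def arctan_le AE_I2, measurable)
  have "\<bar>a0\<bar> \<le> pi / 2"
  proof -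
    have "\<bar>a0\<bar> \<le> expectation (\<lambda>x. \<bar>arctan (x - \<mu>)\<bar>)" unfolding a0_def by (rule integral_abs_bound)
    also have "\<dots> \<le> expectation (\<lambda>x. pi / 2)" using arctan_int by (intro integral_mono arctan_le) auto
    finally show ?thesis by (simp add: prob_space)
  qed
  then have \<phi>_le: "\<bar>\<phi> x\<bar> \<le> pi" for x unfolding \<phi>_def using arctan_le[of "x - \<mu>"] by linarith
  have \<phi>_sq_le: "(\<phi> x)\<^sup>2 \<le> pi\<^sup>2" for x using \<phi>_le[of x] by (simp add: abs_le_square_iff[symmetric])
  have \<phi>_int: "integrable D \<phi>" unfolding \<phi>_def using arctan_int by auto
  have \<phi>_0: "expectation \<phi> = 0" unfolding \<phi>_def using arctan_int by (simp add: prob_space a0_def)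
  have Z_int: "integrable D Z" unfolding Z_def using int by auto
  have Z_0: "expectation Z = 0" unfolding Z_def using int mean by (simp add: prob_space)
  have Z_sq: "integrable D (\<lambda>x. (Z x)\<^sup>2)" "expectation (\<lambda>x. (Z x)\<^sup>2) = 1" using sq var by (simp_all add: Z_def)
  have \<phi>Z_int: "integrable D (\<lambda>x. \<phi> x * Z x)"
  proof (rule Bochner_Integration.integrable_bound)
    show "integrable D (\<lambda>x. pi * Z x)" using Z_int by simp
    show "AE x in D. norm (\<phi> x * Z x) \<le> norm (pi * Z x)"
      by (intro AE_I2) (simp add: abs_mult \<phi>_le mult_right_mono)
  qed measurable
  define \<rho> where "\<rho> = expectation (\<lambda>x. \<phi> x * Z x)"
  define \<sigma> where "\<sigma> = expectation (\<lambda>x. \<phi> x * \<phi> x)"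
  have \<phi>\<phi>_int: "integrable D (\<lambda>x. \<phi> x * \<phi> x)"
  proof (rule integrable_const_bound)
    show "AE x in D. norm (\<phi> x * \<phi> x) \<le> pi\<^sup>2"
      using \<phi>_sq_le by (intro AE_I2) (simp add: power2_eq_square)
  qed measurable
  have at_int: "integrable D (\<lambda>x. arctan (Z x) * Z x)"
  proof (rule Bochner_Integration.integrable_bound)
    show "integrable D (\<lambda>x. pi / 2 * Z x)" using Z_int by simp
    show "(\<lambda>x. arctan (Z x) * Z x) \<in> borel_measurable D" unfolding Z_def by measurable
    show "AE x in D. norm (arctan (Z x) * Z x) \<le> norm (pi / 2 * Z x)"
    proof (rule AE_I2)
      fix x
      have "\<bar>arctan (Z x)\<bar> * \<bar>Z x\<bar> \<le> pi / 2 * \<bar>Z x\<bar>"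
        by (intro mult_right_mono arctan_le) auto
      then show "norm (arctan (Z x) * Z x) \<le> norm (pi / 2 * Z x)" by (simp add: abs_mult)
    qed
  qed
  have at_pos: "0 \<le> arctan y * y" for y :: real
    by (cases "y \<ge> 0") (auto simp: mult_nonpos_nonpos)
  have "\<rho> = expectation (\<lambda>x. arctan (Z x) * Z x - a0 * Z x)"
    unfolding \<rho>_def \<phi>_def Z_def by (simp add: left_diff_distrib)
  also have "\<dots> = expectation (\<lambda>x. arctan (Z x) * Z x)" using at_int Z_int Z_0 by simp
  finally have \<rho>_eq: "\<rho> = expectation (\<lambda>x. arctan (Z x) * Z x)" .
  have "\<rho> \<noteq> 0"
  proof
    assume "\<rho> = 0"
    then have "AE x in D. arctan (Z x) * Z x = 0"
      unfolding \<rho>_eq by (subst (asm) integral_nonneg_eq_0_iff_AE) (use at_int at_pos in auto)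
    then have "AE x in D. (Z x)\<^sup>2 = 0" by eventually_elim auto
    then have "expectation (\<lambda>x. (Z x)\<^sup>2) = expectation (\<lambda>x. 0)" by (intro integral_cong_AE) auto
    then show False using Z_sq by simp
  qed
  moreover have "\<rho> \<ge> 0" unfolding \<rho>_eq by (intro Bochner_Integration.integral_nonneg at_pos)
  ultimately have \<rho>: "\<rho> > 0" by simp
  have "\<sigma> \<noteq> 0"
  proof
    assume "\<sigma> = 0"
    then have "AE x in D. \<phi> x * \<phi> x = 0"
      unfolding \<sigma>_def by (subst (asm) integral_nonneg_eq_0_iff_AE) (use \<phi>\<phi>_int in auto)
    then have "AE x in D. \<phi> x * Z x = 0" by eventually_elim auto
    then have "\<rho> = expectation (\<lambda>x. 0)" unfolding \<rho>_def by (intro integral_cong_AE) auto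
    then show False using \<open>\<rho> \<noteq> 0\<close> by simp
  qed
  moreover have "\<sigma> \<ge> 0" unfolding \<sigma>_def by (intro Bochner_Integration.integral_nonneg) auto
  ultimately have \<sigma>: "\<sigma> > 0" by simp
  \<comment> \<open>One constant bounding the second moments of Z, of \<phi>, of \<phi> Z and of
    \<phi>^2, since |\<phi>| \<le> pi and E Z^2 = 1.\<close>
  define \<kappa> where "\<kappa> = 1 + pi\<^sup>2 + pi\<^sup>2 * pi\<^sup>2"
  have var_le: "expectation (\<lambda>y. (k y - r)\<^sup>2) \<le> \<kappa>" "integrable D (\<lambda>y. (k y - r)\<^sup>2)"
    if [measurable]: "k \<in> borel_measurable D" and k: "integrable D (\<lambda>y. (k y)\<^sup>2)" "expectation (\<lambda>y. (k y)\<^sup>2) \<le> \<kappa>"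
      and r: "r = expectation k" for k r
  proof -
    have ki: "integrable D k" using square_integrable_imp_integrable[OF that(1) k(1)] .
    have eq: "(k y - r)\<^sup>2 = (k y)\<^sup>2 - 2 * r * k y + r\<^sup>2" for y by (simp add: power2_diff)
    show "integrable D (\<lambda>y. (k y - r)\<^sup>2)" unfolding eq using k ki by auto
    have "expectation (\<lambda>y. (k y - r)\<^sup>2) = expectation (\<lambda>y. (k y)\<^sup>2) - 2 * r * r + r\<^sup>2"
      unfolding eq using k ki r by (simp add: prob_space)
    also have "\<dots> \<le> \<kappa>" using k(2) by (simp add: power2_eq_square) (smt (verit) zero_le_square)
    finally show "expectation (\<lambda>y. (k y - r)\<^sup>2) \<le> \<kappa>" .
  qed
  have \<phi>2: "integrable D (\<lambda>x. (\<phi> x)\<^sup>2)" using \<phi>\<phi>_int by (simp add: power2_eq_square)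
  have \<phi>2_le: "expectation (\<lambda>x. (\<phi> x)\<^sup>2) \<le> \<kappa>"
  proof -
    have "expectation (\<lambda>x. (\<phi> x)\<^sup>2) \<le> expectation (\<lambda>x. pi\<^sup>2)"
      using \<phi>2 by (intro integral_mono \<phi>_sq_le) auto
    also have "\<dots> \<le> \<kappa>" by (simp add: prob_space \<kappa>_def)
    finally show ?thesis .
  qed
  have prod: "expectation (\<lambda>y. (\<phi> y * h y)\<^sup>2) \<le> \<kappa>" "integrable D (\<lambda>y. (\<phi> y * h y)\<^sup>2)"
    if [measurable]: "h \<in> borel_measurable D" and h: "integrable D (\<lambda>y. (h y)\<^sup>2)"
      "pi\<^sup>2 * expectation (\<lambda>y. (h y)\<^sup>2) \<le> \<kappa>" for h
  proof -
    have le: "(\<phi> y * h y)\<^sup>2 \<le> pi\<^sup>2 * (h y)\<^sup>2" for y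
      unfolding power_mult_distrib by (intro mult_right_mono \<phi>_sq_le) auto
    show i: "integrable D (\<lambda>y. (\<phi> y * h y)\<^sup>2)"
      by (rule Bochner_Integration.integrable_bound[where f = "\<lambda>y. pi\<^sup>2 * (h y)\<^sup>2"])
        (use h le in \<open>auto simp: abs_mult\<close>)
    have "expectation (\<lambda>y. (\<phi> y * h y)\<^sup>2) \<le> expectation (\<lambda>y. pi\<^sup>2 * (h y)\<^sup>2)"
      using h i by (intro integral_mono le) auto
    then show "expectation (\<lambda>y. (\<phi> y * h y)\<^sup>2) \<le> \<kappa>" using h by simp
  qed
  have p1: "pi\<^sup>2 * expectation (\<lambda>y. (Z y)\<^sup>2) \<le> \<kappa>" using Z_sq by (simp add: \<kappa>_def)
  have p2: "pi\<^sup>2 * expectation (\<lambda>y. (\<phi> y)\<^sup>2) \<le> \<kappa>"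
  proof -
    have "expectation (\<lambda>x. (\<phi> x)\<^sup>2) \<le> expectation (\<lambda>x. pi\<^sup>2)"
      using \<phi>2 by (intro integral_mono \<phi>_sq_le) auto
    then have "pi\<^sup>2 * expectation (\<lambda>y. (\<phi> y)\<^sup>2) \<le> pi\<^sup>2 * pi\<^sup>2" by (intro mult_left_mono) (auto simp: prob_space)
    then show ?thesis by (simp add: \<kappa>_def add_increasing)
  qed
  have Z2_le: "expectation (\<lambda>x. (Z x)\<^sup>2) \<le> \<kappa>" using Z_sq by (simp add: \<kappa>_def add_increasing2)
  define K where "K = 3 * \<kappa> * (\<kappa> + 1)"
  have \<kappa>: "\<kappa> > 0" unfolding \<kappa>_def by (simp add: add_pos_nonneg)
  have K: "K > 0" "\<kappa> \<le> K"
  proof -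
    show "K > 0" unfolding K_def using \<kappa> by (intro mult_pos_pos) auto
    have "0 \<le> \<kappa> * \<kappa>" by simp
    then show "\<kappa> \<le> K" unfolding K_def using \<kappa> by (simp add: algebra_simps)
  qed
  have V1: "(\<integral>\<^sup>+x. ennreal (((\<Sum>i<m. \<Sum>l<m. B i l * \<phi> (x i) * Z (x l)) - \<rho> * (\<Sum>i<m. B i i))\<^sup>2) \<partial>PD m)
     \<le> ennreal (K * (\<Sum>i<m. \<Sum>l<m. (B i l)\<^sup>2))" for m B
    unfolding K_def using prod[OF _ Z_sq(1) p1]
    by (intro bilinear_variance \<phi>2 \<phi>2_le \<phi>_0 Z_sq(1) Z2_le Z_0 var_le \<rho>_def[symmetric]) (auto simp: \<rho>_def)
  have V2: "(\<integral>\<^sup>+x. ennreal (((\<Sum>i<m. \<Sum>l<m. B i l * \<phi> (x i) * \<phi> (x l)) - \<sigma> * (\<Sum>i<m. B i i))\<^sup>2) \<partial>PD m)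
     \<le> ennreal (K * (\<Sum>i<m. \<Sum>l<m. (B i l)\<^sup>2))" for m B
    unfolding K_def using prod[OF _ \<phi>2 p2]
    by (intro bilinear_variance \<phi>2 \<phi>2_le \<phi>_0 var_le \<sigma>_def[symmetric]) (auto simp: \<sigma>_def)
  have V3: "(\<integral>\<^sup>+x. ennreal ((\<Sum>i<m. d i * \<phi> (x i))\<^sup>2) \<partial>PD m) \<le> ennreal (K * (\<Sum>i<m. (d i)\<^sup>2))" for m d
  proof -
    have "ennreal (\<kappa> * (\<Sum>i<m. (d i)\<^sup>2)) \<le> ennreal (K * (\<Sum>i<m. (d i)\<^sup>2))"
      using K by (intro ennreal_leI mult_right_mono sum_nonneg) auto
    then show ?thesis using linear_variance[OF _ \<phi>2 \<phi>_0 \<phi>2_le, of m d] by (auto intro: order_trans)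
  qed
  \<comment> \<open>\<alpha> maximizes 2 \<alpha> \<rho> - \<alpha>^2 \<sigma>, with maximum
    \<rho>^2 / \<sigma>, so the trace contributes at least 2 t m. The deviation s m allowed to each
    random term makes their total effect at most t m, and \<eta> is such that each Chebyshev bound
    costs \<delta> / 3.\<close>
  define \<alpha> where "\<alpha> = \<rho> / \<sigma>"
  define t where "t = \<rho>\<^sup>2 * c / (2 * \<sigma>)"
  define s where "s = t / (2 * \<alpha> * (1 + \<bar>\<mu>\<bar>) + \<alpha>\<^sup>2)"
  define \<eta> where "\<eta> = \<delta> * s\<^sup>2 / (3 * K)"
  have \<alpha>: "\<alpha> > 0" using \<rho> \<sigma> by (simp add: \<alpha>_def)
  have t: "t > 0" using \<rho> \<sigma> \<open>c > 0\<close> by (simp add: t_def)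
  have den: "2 * \<alpha> * (1 + \<bar>\<mu>\<bar>) + \<alpha>\<^sup>2 > 0"
  proof -
    have "0 < 1 + \<bar>\<mu>\<bar>" by linarith
    then have "0 < 2 * \<alpha> * (1 + \<bar>\<mu>\<bar>)" using \<alpha> by (simp only: zero_less_mult_iff) simp
    moreover have "0 < \<alpha>\<^sup>2" using \<alpha> by simp
    ultimately show ?thesis by linarith
  qed
  have s: "s > 0" using t den by (simp add: s_def)
  have \<eta>: "\<eta> > 0" using s K \<open>\<delta> > 0\<close> by (simp add: \<eta>_def)
  show ?thesis
  proof (rule that[OF t \<eta>])
    fix m :: nat and B :: "nat \<Rightarrow> nat \<Rightarrow> real"
    assume m: "m > 0" and B: "psd_form m B" and gB: "good_form m c \<eta> B"
    interpret B: psd_form m B by (rule B)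
    define tr where "tr = (\<Sum>i<m. B i i)"
    define W1 where "W1 x = (\<Sum>i<m. \<Sum>l<m. B i l * \<phi> (x i) * Z (x l)) - \<rho> * (\<Sum>i<m. B i i)" for x :: "nat \<Rightarrow> real"
    define W2 where "W2 x = (\<Sum>i<m. \<Sum>l<m. B i l * \<phi> (x i) * \<phi> (x l)) - \<sigma> * (\<Sum>i<m. B i i)" for x :: "nat \<Rightarrow> real"
    \<comment> \<open>The effect of the mean: replacing the entry by its centred version leaves
      \<mu> times this linear form in the row sums of B.\<close>
    define W3 where "W3 x = (\<Sum>i<m. (\<Sum>l<m. B i l) * \<phi> (x i))" for x :: "nat \<Rightarrow> real"
    have [measurable]: "W1 \<in> borel_measurable (PD m)" "W2 \<in> borel_measurable (PD m)" "W3 \<in> borel_measurable (PD m)"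
      unfolding W1_def W2_def W3_def by measurable
    have F: "K * (\<Sum>i<m. \<Sum>l<m. (B i l)\<^sup>2) \<le> K * (\<eta> * (real m)\<^sup>2)" "K * (\<Sum>i<m. (\<Sum>l<m. B i l)\<^sup>2) \<le> K * (\<eta> * (real m)\<^sup>2)"
      and tr: "c * real m \<le> tr"
      using gB K unfolding good_form_def tr_def by auto
    have q: "t * real m \<le> rform m B x x"
      if w: "\<bar>W1 x\<bar> < s * real m" "\<bar>W2 x\<bar> < s * real m" "\<bar>W3 x\<bar> < s * real m" for x
    proof -
      let ?f = "\<lambda>i. \<phi> (x i)"
      have fx: "rform m B ?f x = W1 x + \<rho> * tr + \<mu> * W3 x"
      proof -
        have "rform m B ?f x = (\<Sum>i<m. \<Sum>l<m. B i l * \<phi> (x i) * Z (x l) + \<mu> * (B i l * \<phi> (x i)))"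
          unfolding rform_def Z_def by (intro sum.cong refl) (simp add: algebra_simps)
        then show ?thesis
          unfolding W1_def W3_def tr_def by (simp add: sum.distrib sum_distrib_left sum_distrib_right)
      qed
      have ff: "rform m B ?f ?f = W2 x + \<sigma> * tr"
        unfolding W2_def tr_def rform_def by (simp add: algebra_simps)
      have "0 \<le> rform m B x x + 2 * (- \<alpha>) * rform m B x ?f + (- \<alpha>)\<^sup>2 * rform m B ?f ?f"
        using B.T_psd[of "\<lambda>i. x i + (- \<alpha>) * ?f i"] unfolding B.rform_lin_comb .
      then have "2 * \<alpha> * (W1 x + \<rho> * tr + \<mu> * W3 x) - \<alpha>\<^sup>2 * (W2 x + \<sigma> * tr) \<le> rform m B x x"
        unfolding B.rform_commute[of x ?f] fx ff by simp
      moreover have "2 * \<alpha> * (W1 x + \<rho> * tr + \<mu> * W3 x) - \<alpha>\<^sup>2 * (W2 x + \<sigma> * tr)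
          = (2 * \<alpha> * \<rho> - \<alpha>\<^sup>2 * \<sigma>) * tr + (2 * \<alpha> * (W1 x + \<mu> * W3 x) - \<alpha>\<^sup>2 * W2 x)"
        by (simp add: algebra_simps)
      moreover have "2 * \<alpha> * \<rho> - \<alpha>\<^sup>2 * \<sigma> = \<rho>\<^sup>2 / \<sigma>"
        using \<sigma> by (simp add: \<alpha>_def power2_eq_square field_simps)
      moreover have "2 * \<alpha> * (W1 x + \<mu> * W3 x) - \<alpha>\<^sup>2 * W2 x \<ge> - (t * real m)"
      proof -
        have "\<bar>W1 x + \<mu> * W3 x\<bar> \<le> s * real m + \<bar>\<mu>\<bar> * (s * real m)"
          using w mult_left_mono[of "\<bar>W3 x\<bar>" "s * real m" "\<bar>\<mu>\<bar>"]
          by (intro order_trans[OF abs_triangle_ineq] add_mono) (auto simp: abs_mult)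
        then have "\<alpha> * \<bar>W1 x + \<mu> * W3 x\<bar> \<le> \<alpha> * (s * real m + \<bar>\<mu>\<bar> * (s * real m))"
          using \<alpha> by (intro mult_left_mono) auto
        moreover have "\<alpha>\<^sup>2 * \<bar>W2 x\<bar> \<le> \<alpha>\<^sup>2 * (s * real m)" using w by (intro mult_left_mono) auto
        moreover have "\<bar>\<alpha> * (W1 x + \<mu> * W3 x)\<bar> = \<alpha> * \<bar>W1 x + \<mu> * W3 x\<bar>" using \<alpha> by (simp add: abs_mult)
        moreover have "\<bar>\<alpha>\<^sup>2 * W2 x\<bar> = \<alpha>\<^sup>2 * \<bar>W2 x\<bar>" by (simp add: abs_mult)
        moreover have "2 * (\<alpha> * (s * real m + \<bar>\<mu>\<bar> * (s * real m))) + \<alpha>\<^sup>2 * (s * real m) = t * real m"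
        proof -
          have "t = s * (2 * \<alpha> * (1 + \<bar>\<mu>\<bar>) + \<alpha>\<^sup>2)" using den by (simp add: s_def)
          then show ?thesis by (simp add: algebra_simps)
        qed
        moreover have "2 * \<alpha> * (W1 x + \<mu> * W3 x) = 2 * (\<alpha> * (W1 x + \<mu> * W3 x))" by simp
        ultimately show ?thesis by linarith
      qed
      moreover have "\<rho>\<^sup>2 / \<sigma> * tr \<ge> 2 * t * real m"
      proof -
        have "\<rho>\<^sup>2 / \<sigma> * (c * real m) \<le> \<rho>\<^sup>2 / \<sigma> * tr" using tr \<sigma> by (intro mult_left_mono) auto
        then show ?thesis by (simp add: t_def)
      qed
      ultimately show ?thesis by simp
    qed
    have bnd: "PD.prob m {x \<in> space (PD m). s * real m \<le> \<bar>W x\<bar>} \<le> \<delta> / 3"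
      if [measurable]: "W \<in> borel_measurable (PD m)" and "(\<integral>\<^sup>+x. ennreal ((W x)\<^sup>2) \<partial>PD m) \<le> ennreal (K * (\<eta> * (real m)\<^sup>2))" for W
    proof -
      have "PD.prob m {x \<in> space (PD m). s * real m \<le> \<bar>W x\<bar>} \<le> K * (\<eta> * (real m)\<^sup>2) / (s * real m)\<^sup>2"
        using s m K \<eta> that by (intro PD.prob_abs_ge_le) auto
      also have "\<dots> = \<delta> / 3" using s m K by (simp add: \<eta>_def field_simps power2_eq_square)
      finally show ?thesis .
    qed
    let ?E = "\<lambda>W. {x \<in> space (PD m). s * real m \<le> \<bar>W x\<bar>}"
    have "{x \<in> space (PD m). rform m B x x < t * real m} \<subseteq> ?E W1 \<union> (?E W2 \<union> ?E W3)"
    proof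
      fix x assume x: "x \<in> {x \<in> space (PD m). rform m B x x < t * real m}"
      show "x \<in> ?E W1 \<union> (?E W2 \<union> ?E W3)"
      proof (rule ccontr)
        assume "\<not> ?thesis"
        then have "\<bar>W1 x\<bar> < s * real m" "\<bar>W2 x\<bar> < s * real m" "\<bar>W3 x\<bar> < s * real m" using x by auto
        from q[OF this] x show False by simp
      qed
    qed
    then have "PD.prob m {x \<in> space (PD m). rform m B x x < t * real m} \<le> PD.prob m (?E W1 \<union> (?E W2 \<union> ?E W3))"
      by (intro PD.finite_measure_mono) auto
    also have "\<dots> \<le> PD.prob m (?E W1) + PD.prob m (?E W2 \<union> ?E W3)"
      by (intro measure_Un_le) auto
    also have "PD.prob m (?E W2 \<union> ?E W3) \<le> PD.prob m (?E W2) + PD.prob m (?E W3)"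
      by (intro measure_Un_le) auto
    also have "PD.prob m (?E W1) \<le> \<delta> / 3"
      using order_trans[OF V1 ennreal_leI[OF F(1)]] unfolding W1_def[symmetric] by (intro bnd) auto
    also have "PD.prob m (?E W2) \<le> \<delta> / 3"
      using order_trans[OF V2 ennreal_leI[OF F(1)]] unfolding W2_def[symmetric] by (intro bnd) auto
    also have "PD.prob m (?E W3) \<le> \<delta> / 3"
      using order_trans[OF V3 ennreal_leI[OF F(2)]] unfolding W3_def[symmetric] by (intro bnd) auto
    finally show "PD.prob m {x \<in> space (PD m). rform m B x x < t * real m} \<le> \<delta>" by simp
  qed
qed

section \<open>Carleman's criterion for the moment problem\<close>

text \<open>The weights \<open>c i\<close> have partial products (k + 2)^(k + 1), so the
  arithmetic-geometric inequality for the \<open>a i * c i\<close> bounds the geometric mean by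
  their sum over (k + 1)(k + 2). Summation over k telescopes, and c_i / (i + 1) \<le> e.\<close>

lemma Carleman_inequality:
  fixes a :: "nat \<Rightarrow> real"
  assumes pos: "\<And>k. 0 < a k" and "summable a"
  shows "summable (\<lambda>k. (\<Prod>i<Suc k. a i) powr (1 / real (Suc k)))"
proof -
  define c where "c i = real (i + 2) ^ (i + 1) / real (i + 1) ^ i" for i
  have c_pos: "0 < c i" for i by (simp add: c_def)
  have prod_c: "(\<Prod>i<Suc k. c i) = real (k + 2) ^ (k + 1)" for k
  proof (induction k)
    case (Suc k)
    have "(\<Prod>i<Suc (Suc k). c i) = real (k + 2) ^ (k + 1) * c (Suc k)"
      using Suc by simp
    also have "\<dots> = real (Suc k + 2) ^ (Suc k + 1)"
    proof -
      have "c (Suc k) = real (Suc k + 2) ^ (Suc k + 1) / real (k + 2) ^ (k + 1)" by (simp add: c_def)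
      moreover have "real (k + 2) ^ (k + 1) \<noteq> 0" by simp
      ultimately show ?thesis by (metis nonzero_mult_div_cancel_left times_divide_eq_right)
    qed
    finally show ?case .
  qed (simp add: c_def)
  define GM where "GM k = (\<Prod>i<Suc k. a i) powr (1 / real (Suc k))" for k
  have GM_nonneg: "0 \<le> GM k" for k by (simp add: GM_def)
  have GM_le: "GM k \<le> (\<Sum>i<Suc k. a i * c i) / (real (k + 1) * real (k + 2))" for k
  proof -
    have "(\<Prod>i<Suc k. a i * c i) powr (1 / real (Suc k)) = GM k * real (k + 2)"
    proof -
      have "(\<Prod>i<Suc k. c i) powr (1 / real (Suc k)) = (real (k + 2) powr real (k + 1)) powr (1 / real (Suc k))"
        unfolding prod_c by (subst powr_realpow) auto
      also have "\<dots> = real (k + 2)" by (simp add: powr_powr)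
      finally have "(\<Prod>i<Suc k. c i) powr (1 / real (Suc k)) = real (k + 2)" .
      moreover have "(\<Prod>i<Suc k. a i * c i) powr (1 / real (Suc k))
          = GM k * (\<Prod>i<Suc k. c i) powr (1 / real (Suc k))"
        unfolding prod.distrib GM_def using pos c_pos
        by (intro powr_mult) 
      ultimately show ?thesis by simp
    qed
    moreover have "(\<Prod>i<Suc k. a i * c i) powr (1 / real (card {..<Suc k})) \<le> (\<Sum>i<Suc k. a i * c i / real (card {..<Suc k}))"
      using pos c_pos by (intro arith_geom_mean) (auto intro: less_imp_le)
    ultimately have "GM k * real (k + 2) \<le> (\<Sum>i<Suc k. a i * c i) / real (k + 1)"
      unfolding sum_divide_distrib by simp
    then have "GM k \<le> (\<Sum>i<Suc k. a i * c i) / real (k + 1) / real (k + 2)"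
      by (subst pos_le_divide_eq) simp_all
    then show ?thesis by (simp only: divide_divide_eq_left)
  qed
  \<comment> \<open>The bracket is the sum of 1 / ((k + 1)(k + 2)) over i \<le> k < n, i.e. the
    order of summation has been exchanged.\<close>
  have partial: "(\<Sum>k<n. GM k) \<le> (\<Sum>i<n. a i * c i * (1 / real (i + 1) - 1 / real (n + 1)))" for n
  proof (induction n)
    case (Suc n)
    have d: "1 / (real (n + 1) * real (n + 2)) = 1 / real (n + 1) - 1 / real (n + 2)"
      by (simp add: field_simps)
    have "(\<Sum>k<Suc n. GM k) \<le> (\<Sum>i<n. a i * c i * (1 / real (i + 1) - 1 / real (n + 1)))
       + (\<Sum>i<Suc n. a i * c i) * (1 / real (n + 1) - 1 / real (n + 2))"
      using Suc GM_le[of n] unfolding d[symmetric] by simp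
    also have "\<dots> = (\<Sum>i<Suc n. a i * c i * (1 / real (i + 1) - 1 / real (n + 2)))"
    proof -
      have *: "(\<Sum>i<n. x i * (u i - p)) + (\<Sum>i<Suc n. x i) * (p - q) = (\<Sum>i<Suc n. x i * (u i - q))"
        if "u n = p" for x u :: "nat \<Rightarrow> real" and p q
        using that by (simp add: sum_distrib_left sum_subtractf algebra_simps)
      show ?thesis by (rule *[where x = "\<lambda>i. a i * c i" and u = "\<lambda>i. 1 / real (i + 1)"]) simp
    qed
    finally show ?case by simp
  qed simp
  have c_le: "c i / real (i + 1) \<le> exp 1" for i
  proof -
    have "c i / real (i + 1) = (1 + 1 / real (i + 1)) ^ (i + 1)"
    proof -
      have "1 + 1 / real (i + 1) = real (i + 2) / real (i + 1)" by (simp add: field_simps)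
      then show ?thesis unfolding c_def by (simp add: power_divide)
    qed
    also have "\<dots> \<le> exp (1 / real (i + 1)) ^ (i + 1)"
      by (intro power_mono exp_ge_add_one_self_aux) (auto intro: exp_ge_add_one_self)
    also have "\<dots> = exp 1" by (simp only: exp_of_nat_mult[symmetric]) simp
    finally show ?thesis .
  qed
  have "(\<Sum>k<n. GM k) \<le> exp 1 * suminf a" for n
  proof -
    have "(\<Sum>k<n. GM k) \<le> (\<Sum>i<n. a i * exp 1)"
    proof (rule order_trans[OF partial sum_mono])
      fix i
      have "a i * c i * (1 / real (i + 1) - 1 / real (n + 1)) \<le> a i * c i * (1 / real (i + 1))"
        using pos[of i] c_pos[of i] by (intro mult_left_mono) auto
      also have "\<dots> = a i * (c i / real (i + 1))" by simp
      also have "\<dots> \<le> a i * exp 1" using pos[of i] by (intro mult_left_mono c_le) auto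
      finally show "a i * c i * (1 / real (i + 1) - 1 / real (n + 1)) \<le> a i * exp 1" .
    qed
    also have "\<dots> = exp 1 * (\<Sum>i<n. a i)" by (simp add: sum_distrib_left mult.commute)
    also have "\<dots> \<le> exp 1 * suminf a"
      using assms by (intro mult_left_mono sum_le_suminf) (auto intro: less_imp_le)
    finally show ?thesis .
  qed
  then have "summable GM" by (intro summableI_nonneg_bounded[OF GM_nonneg])
  then show ?thesis unfolding GM_def .
qed

text \<open>Bang's proof: the quantity \<open>sup k. |f k x| / (e^k M k)\<close> can drop by a factor \<open>e\<close> at level \<open>e^-n\<close>
  only over a distance at least \<open>M n / (e M (n + 1))\<close>.\<close>

lemma Bang_quasi_analytic:
  fixes f :: "nat \<Rightarrow> real \<Rightarrow> complex" and M :: "nat \<Rightarrow> real"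
  assumes M_pos: "\<And>k. 0 < M k" and log_convex: "\<And>k. M (Suc k) / M k \<le> M (Suc (Suc k)) / M (Suc k)"
    and Taylor: "\<And>k n x h. cmod (f k (x + h) - (\<Sum>i<n. f (k + i) x * of_real (h ^ i / fact i)))
      \<le> M (k + n) * \<bar>h\<bar> ^ n / fact n"
    and flat: "\<And>k. f k 0 = 0"
    and div: "\<not> summable (\<lambda>k. M k / M (Suc k))"
  shows "f 0 x = 0"
proof -
  define r where "r k = M (Suc k) / M k" for k
  have r_pos: "0 < r k" for k using M_pos by (simp add: r_def)
  have r_mono: "r j \<le> r n" if "j \<le> n" for j n
    by (rule lift_Suc_mono_le[of r, OF _ that]) (use log_convex in \<open>simp add: r_def\<close>)
  have M_le: "M (k + i) \<le> M k * r n ^ i" if "k + i \<le> Suc n" for k i n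
    using that
  proof (induction i)
    case (Suc i)
    have "M (k + Suc i) = M (k + i) * r (k + i)" using M_pos[of "k + i"] by (simp add: r_def)
    also have "\<dots> \<le> (M k * r n ^ i) * r n"
      using Suc M_pos r_pos by (intro mult_mono r_mono) (auto intro: less_imp_le)
    finally show ?case by (simp add: mult_ac)
  qed simp
  have f_le: "cmod (f k x) \<le> M k" for k x using Taylor[of k x 0 0] by simp
  \<comment> \<open>Level n stands for the bounds e^(k - n) M_k for all k at once. A move by at most
    1 / (e r_n) loses one level: the Taylor sum costs a factor sum 1 / i! \<le> e.\<close>
  have step: "cmod (f k (x + h)) \<le> exp (real k - real n) * M k"
    if x: "\<And>k. cmod (f k x) \<le> exp (real k - real (Suc n)) * M k" and h: "\<bar>h\<bar> \<le> exp (-1) / r n" for k n x h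
  proof (cases "k \<le> n")
    case False
    then have "1 \<le> exp (real k - real n)" by simp
    then have "1 * M k \<le> exp (real k - real n) * M k"
      using M_pos[of k] by (intro mult_right_mono) auto
    with f_le[of k "x + h"] show ?thesis by simp
  next
    case True
    \<comment> \<open>Expanding up to order \<open>Suc n\<close> makes the remainder look like one
      more Taylor term, its exponential weight being 1 there.\<close>
    define d where "d = Suc n - k"
    have kd: "k + d = Suc n" using True by (simp add: d_def)
    define q where "q i = exp (real (k + i) - real (Suc n)) * M (k + i) * \<bar>h\<bar> ^ i / fact i" for i
    have "cmod (f k (x + h)) \<le> cmod (\<Sum>i<d. f (k + i) x * of_real (h ^ i / fact i)) + M (k + d) * \<bar>h\<bar> ^ d / fact d"
      using Taylor[of k x h d] norm_triangle_sub[of "f k (x + h)" "\<Sum>i<d. f (k + i) x * of_real (h ^ i / fact i)"] by linarith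
    also have "cmod (\<Sum>i<d. f (k + i) x * of_real (h ^ i / fact i)) \<le> (\<Sum>i<d. q i)"
    proof (rule sum_norm_le)
      fix i
      have "cmod (f (k + i) x) * (\<bar>h\<bar> ^ i / fact i) \<le> exp (real (k + i) - real (Suc n)) * M (k + i) * (\<bar>h\<bar> ^ i / fact i)"
        by (intro mult_right_mono x) auto
      then show "cmod (f (k + i) x * of_real (h ^ i / fact i)) \<le> q i"
        by (simp add: q_def norm_mult norm_divide norm_power power_abs)
    qed
    also have "M (k + d) * \<bar>h\<bar> ^ d / fact d = q d" unfolding q_def kd by simp
    finally have "cmod (f k (x + h)) \<le> (\<Sum>i<Suc d. q i)" by simp
    also have "\<dots> \<le> (\<Sum>i<Suc d. exp (real k - real (Suc n)) * M k * (1 / fact i))"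
    proof (rule sum_mono)
      fix i assume "i \<in> {..<Suc d}"
      then have i: "k + i \<le> Suc n" using kd by auto
      have "exp (real i) * M (k + i) * \<bar>h\<bar> ^ i \<le> exp (real i) * (M k * r n ^ i) * (exp (-1) / r n) ^ i"
        using M_pos r_pos[of n] h by (intro mult_mono mult_left_mono M_le i power_mono) (auto intro: less_imp_le mult_nonneg_nonneg)
      also have "\<dots> = M k * (exp (real i) * exp (-1) ^ i)"
        using r_pos[of n] by (simp add: power_divide)
      also have "exp (real i) * exp (-1) ^ i = (1::real)"
        by (simp only: exp_of_nat_mult[symmetric] exp_add[symmetric]) simp
      finally have "exp (real i) * M (k + i) * \<bar>h\<bar> ^ i \<le> M k" by simp
      then have "exp (real k - real (Suc n)) * (exp (real i) * M (k + i) * \<bar>h\<bar> ^ i) / fact i \<le> exp (real k - real (Suc n)) * M k / fact i"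
        by (intro divide_right_mono mult_left_mono) auto
      moreover have "exp (real (k + i) - real (Suc n)) = exp (real k - real (Suc n)) * exp (real i)"
        by (simp add: exp_add[symmetric])
      ultimately show "q i \<le> exp (real k - real (Suc n)) * M k * (1 / fact i)"
        unfolding q_def by (simp add: mult.assoc)
    qed
    also have "\<dots> = exp (real k - real (Suc n)) * M k * (\<Sum>i<Suc d. 1 / fact i)"
      by (rule sum_distrib_left[symmetric])
    also have "\<dots> \<le> exp (real k - real (Suc n)) * M k * exp 1"
    proof (rule mult_left_mono)
      have "(\<Sum>i<Suc d. 1 ^ i /\<^sub>R fact i) \<le> (\<Sum>i. 1 ^ i /\<^sub>R fact i :: real)"
        by (rule sum_le_suminf) (auto intro: sums_summable[OF exp_converges[of "1::real"], simplified])
      also have "\<dots> = exp 1" by (rule sums_unique[OF exp_converges, symmetric])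
      finally show "(\<Sum>i<Suc d. (1::real) / fact i) \<le> exp 1" by (simp add: field_simps del: sum.lessThan_Suc)
    qed (use M_pos in \<open>auto intro: less_imp_le\<close>)
    also have "\<dots> = exp (real k - real n) * M k"
    proof -
      have "exp (real k - real n) = exp (real k - real (Suc n)) * exp 1" by (simp add: exp_add[symmetric])
      then show ?thesis by simp
    qed
    finally show ?thesis .
  qed
  define s where "s j = exp (-1) / r j" for j
  have s_pos: "0 < s j" for j using r_pos by (simp add: s_def)
  \<comment> \<open>Starting at 0, where every level holds by flatness, and descending from level j
    + d to level j.\<close>
  have reach: "cmod (f k x) \<le> exp (real k - real j) * M k"
    if "\<bar>x\<bar> \<le> (\<Sum>i\<in>{j..<j + d}. s i)" for k x j d
    using that
  proof (induction d arbitrary: j x k)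
    case 0
    then have "x = 0" by simp
    then show ?case using flat[of k] M_pos[of k] by simp
  next
    case (Suc d)
    define S where "S = (\<Sum>i\<in>{Suc j..<Suc j + d}. s i)"
    have S: "0 \<le> S" unfolding S_def using s_pos by (intro sum_nonneg) (auto intro: less_imp_le)
    have "(\<Sum>i\<in>{j..<j + Suc d}. s i) = s j + S"
      unfolding S_def by (subst sum.atLeast_Suc_lessThan) (simp_all del: sum.op_ivl_Suc)
    with Suc.prems have le: "\<bar>x\<bar> \<le> s j + S" by simp
    \<comment> \<open>Splits the way to x in the proportion S to \<open>s j\<close>, the last part
      being the one covered by \<open>step\<close>.\<close>
    define x' where "x' = x * (S / (s j + S))"
    have p: "0 < s j + S" using S s_pos[of j] by simp
    have "\<bar>x'\<bar> \<le> (s j + S) * (S / (s j + S))"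
      unfolding x'_def abs_mult using S p le by (intro mult_mono) auto
    then have x': "\<bar>x'\<bar> \<le> S" using p by simp
    have "x - x' = x * (s j / (s j + S))" unfolding x'_def using p by (simp add: field_simps)
    then have "\<bar>x - x'\<bar> \<le> (s j + S) * (s j / (s j + S))"
      unfolding abs_mult using p le s_pos[of j] by (simp only: abs_mult) (intro mult_mono, auto)
    then have h: "\<bar>x - x'\<bar> \<le> exp (-1) / r j" using p by (simp add: s_def)
    have "cmod (f k (x' + (x - x'))) \<le> exp (real k - real j) * M k"
      by (rule step[OF _ h]) (use Suc.IH[of x' "Suc j"] x' in \<open>simp add: S_def\<close>)
    then show ?case by simp
  qed
  have "\<not> summable s"
  proof
    assume "summable s"
    then have "summable (\<lambda>j. exp 1 * s j)" by (rule summable_mult)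
    moreover have "exp 1 * s j = M j / M (Suc j)" for j
      by (simp add: s_def r_def flip: exp_add)
    ultimately show False using div by simp
  qed
  \<comment> \<open>The step lengths have divergent sum from every index on, so x is reached from 0
    while still at level j, for each j.\<close>
  have bound: "cmod (f 0 x) \<le> exp (- real j) * M 0" for j
  proof -
    have "\<not> summable (\<lambda>i. s (i + j))" using \<open>\<not> summable s\<close> by (simp add: summable_iff_shift)
    then obtain d where "\<bar>x\<bar> \<le> (\<Sum>i<d. s (i + j))"
      using summableI_nonneg_bounded[of "\<lambda>i. s (i + j)" "\<bar>x\<bar>"] s_pos by (meson less_imp_le linear)
    also have "\<dots> = (\<Sum>i\<in>{j..<j + d}. s i)"
      by (rule sum.reindex_bij_witness[of _ "\<lambda>i. i - j" "\<lambda>i. i + j"]) auto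
    finally show ?thesis using reach[of x j d 0] by simp
  qed
  have "(\<lambda>j. exp (- real j) * M 0) \<longlonglongrightarrow> 0 * M 0"
    by (intro tendsto_mult tendsto_const filterlim_compose[OF exp_at_bot] filterlim_compose[OF filterlim_uminus_at_bot_at_top] filterlim_real_sequentially)
  then have "cmod (f 0 x) \<le> 0 * M 0"
    by (rule tendsto_le[OF sequentially_bot _ tendsto_const]) (use bound in auto)
  then show ?thesis by simp
qed

lemma iexp_Taylor_bound:
  "cmod (iexp y - (\<Sum>i<n. (\<i> * of_real y) ^ i / fact i)) \<le> \<bar>y\<bar> ^ n / fact n"
proof (cases n)
  case (Suc p)
  then show ?thesis using iexp_approx1[of y p] by (simp only: lessThan_Suc_atMost)
qed simp

text \<open>The k-th derivative of the characteristic function, given directly by its integral;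
  Taylor bounds are all that Bang's argument asks for.\<close>

definition char_moment :: "real measure \<Rightarrow> nat \<Rightarrow> real \<Rightarrow> complex" where
  "char_moment N k x = (CLINT t|N. (\<i> * of_real t) ^ k * iexp (x * t))"

lemma (in real_distribution) prob_UNIV: "prob UNIV = 1"
  using prob_space by simp

locale all_moments = real_distribution N for N :: "real measure" +
  assumes moments: "integrable N (\<lambda>x. x ^ k)"
begin

lemma abs_moments: "integrable N (\<lambda>x. \<bar>x\<bar> ^ k)"
  using Bochner_Integration.integrable_abs[OF moments[of k]] by (simp add: power_abs)

text \<open>Nonnegativity of the variance of |x|^k.\<close>

lemma abs_moment_le: "expectation (\<lambda>x. \<bar>x\<bar> ^ k) \<le> sqrt (expectation (\<lambda>x. x ^ (2 * k)))"
proof -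
  let ?c = "expectation (\<lambda>x. \<bar>x\<bar> ^ k)"
  have sq: "(\<bar>x\<bar> ^ k - ?c)\<^sup>2 = x ^ (2 * k) - 2 * ?c * \<bar>x\<bar> ^ k + ?c\<^sup>2" for x :: real
    by (simp add: power2_diff power_mult[symmetric] power_even_abs mult.commute[of k 2])
  have "0 \<le> expectation (\<lambda>x. (\<bar>x\<bar> ^ k - ?c)\<^sup>2)" by (intro Bochner_Integration.integral_nonneg) auto
  also have "\<dots> = expectation (\<lambda>x. x ^ (2 * k)) - ?c\<^sup>2"
    unfolding sq using abs_moments[of k] moments[of "2 * k"] by (simp add: prob_UNIV power2_eq_square)
  finally have "?c\<^sup>2 \<le> expectation (\<lambda>x. x ^ (2 * k))" by simp
  then show ?thesis by (rule real_le_rsqrt)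
qed

lemma char_moment_integrable: "integrable N (\<lambda>t. (\<i> * of_real t) ^ k * iexp (x * t))"
  by (rule Bochner_Integration.integrable_bound[OF abs_moments[of k]])
    (auto simp: norm_mult norm_power)

text \<open>The Taylor estimate of exp (i h t) integrated against t^k exp (i x t); the absolute
  moment is then passed to an even one.\<close>

lemma char_moment_Taylor:
  "cmod (char_moment N k (x + h) - (\<Sum>i<n. char_moment N (k + i) x * of_real (h ^ i / fact i)))
    \<le> sqrt (expectation (\<lambda>x. x ^ (2 * (k + n)))) * \<bar>h\<bar> ^ n / fact n"
proof -
  let ?g = "\<lambda>t. (\<i> * of_real t) ^ k * iexp ((x + h) * t) - (\<Sum>i<n. (\<i> * of_real t) ^ (k + i) * iexp (x * t) * of_real (h ^ i / fact i))"
  have g: "?g t = (\<i> * of_real t) ^ k * iexp (x * t) * (iexp (h * t) - (\<Sum>i<n. (\<i> * of_real (h * t)) ^ i / fact i))" for t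
  proof -
    have "iexp ((x + h) * t) = iexp (x * t) * iexp (h * t)"
      by (simp add: exp_add[symmetric] algebra_simps)
    moreover have "(\<Sum>i<n. (\<i> * of_real t) ^ (k + i) * iexp (x * t) * of_real (h ^ i / fact i))
        = (\<i> * of_real t) ^ k * iexp (x * t) * (\<Sum>i<n. (\<i> * of_real (h * t)) ^ i / fact i)"
      unfolding sum_distrib_left by (intro sum.cong refl) (simp add: power_add power_mult_distrib)
    ultimately show ?thesis by (simp only: right_diff_distrib mult.assoc)
  qed
  have int: "integrable N ?g"
    by (intro Bochner_Integration.integrable_diff Bochner_Integration.integrable_sum char_moment_integrable
      Bochner_Integration.integrable_mult_left)
  have "char_moment N k (x + h) - (\<Sum>i<n. char_moment N (k + i) x * of_real (h ^ i / fact i)) = (CLINT t|N. ?g t)"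
  proof -
    have i1: "integrable N (\<lambda>t. (\<i> * of_real t) ^ k * iexp ((x + h) * t))"
      by (rule char_moment_integrable)
    have i2: "integrable N (\<lambda>t. \<Sum>i<n. (\<i> * of_real t) ^ (k + i) * iexp (x * t) * of_real (h ^ i / fact i))"
      by (intro Bochner_Integration.integrable_sum Bochner_Integration.integrable_mult_left char_moment_integrable)
    have eq: "(CLINT t|N. (\<Sum>i<n. (\<i> * of_real t) ^ (k + i) * iexp (x * t) * of_real (h ^ i / fact i)))
      = (\<Sum>i<n. char_moment N (k + i) x * of_real (h ^ i / fact i))"
      unfolding char_moment_def
      by (subst Bochner_Integration.integral_sum)
        (intro Bochner_Integration.integrable_mult_left char_moment_integrable sum.cong refl Bochner_Integration.integral_mult_left_zero)+
    show ?thesis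
      unfolding Bochner_Integration.integral_diff[OF i1 i2] eq char_moment_def[of N k "x + h"] ..
  qed
  also have "cmod \<dots> \<le> expectation (\<lambda>t. \<bar>t\<bar> ^ (k + n) * (\<bar>h\<bar> ^ n / fact n))"
  proof (rule order_trans[OF integral_norm_bound integral_mono])
    show "integrable N (\<lambda>t. norm (?g t))" using int by (rule Bochner_Integration.integrable_norm)
    show "integrable N (\<lambda>t. \<bar>t\<bar> ^ (k + n) * (\<bar>h\<bar> ^ n / fact n))"
      by (intro Bochner_Integration.integrable_mult_left abs_moments)
    fix t
    have "norm (?g t) \<le> \<bar>t\<bar> ^ k * (\<bar>h * t\<bar> ^ n / fact n)"
    proof -
      have "norm (?g t) = \<bar>t\<bar> ^ k * cmod (iexp (h * t) - (\<Sum>i<n. (\<i> * of_real (h * t)) ^ i / fact i))"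
        unfolding g norm_mult norm_power by simp
      also have "\<dots> \<le> \<bar>t\<bar> ^ k * (\<bar>h * t\<bar> ^ n / fact n)"
        by (intro mult_left_mono iexp_Taylor_bound) auto
      finally show ?thesis .
    qed
    then show "norm (?g t) \<le> \<bar>t\<bar> ^ (k + n) * (\<bar>h\<bar> ^ n / fact n)"
      by (simp add: abs_mult power_mult_distrib power_add mult_ac)
  qed
  also have "\<dots> = expectation (\<lambda>t. \<bar>t\<bar> ^ (k + n)) * (\<bar>h\<bar> ^ n / fact n)" by simp
  also have "\<dots> \<le> sqrt (expectation (\<lambda>x. x ^ (2 * (k + n)))) * (\<bar>h\<bar> ^ n / fact n)"
    by (intro mult_right_mono abs_moment_le) auto
  finally show ?thesis by simp
qed

lemma even_moment_log_convex:
  assumes pos: "0 < expectation (\<lambda>x. x ^ (2 * k))"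
  shows "(expectation (\<lambda>x. x ^ (2 * Suc k)))\<^sup>2 \<le> expectation (\<lambda>x. x ^ (2 * k)) * expectation (\<lambda>x. x ^ (2 * Suc (Suc k)))"
proof -
  let ?A = "expectation (\<lambda>x. x ^ (2 * k))" and ?B = "expectation (\<lambda>x. x ^ (2 * Suc k))"
    and ?C = "expectation (\<lambda>x. x ^ (2 * Suc (Suc k)))"
  define s where "s = ?B / ?A"
  have sq: "(s * x ^ k - x ^ Suc (Suc k))\<^sup>2 = s\<^sup>2 * x ^ (2 * k) - 2 * s * x ^ (2 * Suc k) + x ^ (2 * Suc (Suc k))" for x :: real
  proof -
    have "x ^ (2 * j) = (x ^ j)\<^sup>2" for j by (simp only: power_mult[symmetric] mult.commute[of 2])
    then show ?thesis by (simp add: power2_eq_square algebra_simps)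
  qed
  have "0 \<le> expectation (\<lambda>x. (s * x ^ k - x ^ Suc (Suc k))\<^sup>2)" by (intro Bochner_Integration.integral_nonneg) auto
  also have "\<dots> = s\<^sup>2 * ?A - 2 * s * ?B + ?C"
    unfolding sq using moments[of "2 * k"] moments[of "2 * Suc k"] moments[of "2 * Suc (Suc k)"]
    by (simp del: mult_Suc_right power_Suc)
  also have "s\<^sup>2 * ?A - 2 * s * ?B + ?C = ?C - ?B\<^sup>2 / ?A"
    using pos by (simp add: s_def power2_eq_square field_simps)
  finally have "?B\<^sup>2 / ?A \<le> ?C" by simp
  then show ?thesis using pos by (simp add: pos_divide_le_eq mult.commute)
qed

end

text \<open>The difference of the two characteristic functions is flat at 0 with derivatives bounded
  by M_k = 2 sqrt (m_k). If the sum of M_k / M_(k+1) converged, Carleman's inequality for these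
  ratios, whose geometric means are the powers m_k^(-1/(2k)), would contradict the hypothesis. So
  Bang's theorem applies and uniqueness of characteristic functions concludes.\<close>

theorem Carleman_determinate:
  assumes N: "all_moments N" and N': "all_moments N'"
    and eq: "\<And>k. (\<integral>x. x ^ k \<partial>N) = (\<integral>x. x ^ k \<partial>N')"
    and pos: "\<And>k. 0 < (\<integral>x. x ^ (2 * k) \<partial>N)"
    and Carleman: "\<not> summable (\<lambda>k. (\<integral>x. x ^ (2 * Suc k) \<partial>N) powr (- 1 / real (2 * Suc k)))"
  shows "N = N'"
proof -
  interpret N: all_moments N by (rule N)
  interpret N': all_moments N' by (rule N')
  define m where "m k = (\<integral>x. x ^ (2 * k) \<partial>N)" for k
  have m_pos: "0 < m k" for k unfolding m_def by (rule pos)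
  have m0: "m 0 = 1" by (simp add: m_def N.prob_UNIV)
  define M where "M k = 2 * sqrt (m k)" for k
  define f where "f k x = char_moment N k x - char_moment N' k x" for k x
  have "f 0 x = 0" for x
  proof (rule Bang_quasi_analytic[of M])
    show "0 < M k" for k using m_pos by (simp add: M_def)
    show "M (Suc k) / M k \<le> M (Suc (Suc k)) / M (Suc k)" for k
    proof -
      have "(m (Suc k))\<^sup>2 \<le> m k * m (Suc (Suc k))"
        using N.even_moment_log_convex[OF pos[of k]] unfolding m_def .
      then have "sqrt ((m (Suc k))\<^sup>2) \<le> sqrt (m k * m (Suc (Suc k)))" by (rule real_sqrt_le_mono)
      then have "sqrt (m (Suc k)) * sqrt (m (Suc k)) \<le> sqrt (m k) * sqrt (m (Suc (Suc k)))"
        using m_pos[of "Suc k"] by (simp add: real_sqrt_mult)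
      then show ?thesis unfolding M_def using m_pos[of k] m_pos[of "Suc k"] by (simp add: field_simps)
    qed
    show "cmod (f k (x + h) - (\<Sum>i<n. f (k + i) x * of_real (h ^ i / fact i))) \<le> M (k + n) * \<bar>h\<bar> ^ n / fact n" for k n x h
    proof -
      have "f k (x + h) - (\<Sum>i<n. f (k + i) x * of_real (h ^ i / fact i))
        = (char_moment N k (x + h) - (\<Sum>i<n. char_moment N (k + i) x * of_real (h ^ i / fact i)))
        - (char_moment N' k (x + h) - (\<Sum>i<n. char_moment N' (k + i) x * of_real (h ^ i / fact i)))"
        unfolding f_def by (simp only: left_diff_distrib sum_subtractf) simp
      also have "cmod \<dots> \<le> sqrt (m (k + n)) * \<bar>h\<bar> ^ n / fact n + sqrt (m (k + n)) * \<bar>h\<bar> ^ n / fact n"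
        using N'.char_moment_Taylor[of k x h n]
        by (intro order_trans[OF norm_triangle_ineq4 add_mono[OF N.char_moment_Taylor[of k x h n, folded m_def]]])
          (simp add: m_def eq)
      finally show ?thesis by (simp add: M_def mult_ac)
    qed
    show "f k 0 = 0" for k
    proof -
      have c: "char_moment D k 0 = \<i> ^ k * of_real (\<integral>x. x ^ k \<partial>D)" for D
        by (simp add: char_moment_def power_mult_distrib flip: of_real_power)
      then show ?thesis using eq by (simp add: f_def)
    qed
    show "\<not> summable (\<lambda>k. M k / M (Suc k))"
    proof
      assume "summable (\<lambda>k. M k / M (Suc k))"
      then have "summable (\<lambda>k. (\<Prod>i<Suc k. M i / M (Suc i)) powr (1 / real (Suc k)))"
        by (rule Carleman_inequality[rotated]) (use m_pos in \<open>simp add: M_def\<close>)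
      \<comment> \<open>The product telescopes to M_0 / M_k, and \<open>m 0 = 1\<close> for a
        probability measure.\<close>
      moreover have "(\<Prod>i<k. M i / M (Suc i)) = 1 / sqrt (m k)" for k
      proof (induction k)
        case (Suc k)
        then show ?case using m_pos[of k] m_pos[of "Suc k"] by (simp add: M_def)
      qed (simp add: m0)
      ultimately have "summable (\<lambda>k. (1 / sqrt (m (Suc k))) powr (1 / real (Suc k)))" by simp
      moreover have "(1 / sqrt (m (Suc k))) powr (1 / real (Suc k)) = m (Suc k) powr (- 1 / real (2 * Suc k))" for k
      proof -
        have "1 / sqrt (m (Suc k)) = m (Suc k) powr (- 1 / 2)"
          using m_pos[of "Suc k"] by (simp add: powr_minus_divide powr_half_sqrt)
        then show ?thesis by (simp add: powr_powr)
      qed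
      ultimately show False using Carleman unfolding m_def by simp
    qed
  qed
  then have "char N = char N'"
    unfolding f_def char_moment_def char_def by (simp add: fun_eq_iff)
  then show ?thesis
    by (rule Levy_uniqueness[OF N.real_distribution_axioms N'.real_distribution_axioms])
qed

section \<open>From convergence of moments to weak convergence\<close>

text \<open>Truncating \<open>x\<close> at \<open>R\<close> changes the \<open>k\<close>-th moment by at most \<open>2 C / R^k\<close>, where \<open>C\<close> bounds the \<open>2k\<close>-th moment.\<close>

lemma truncation_error:
  fixes x R :: real
  assumes "0 < R"
  shows "\<bar>x ^ k - (max (- R) (min x R)) ^ k\<bar> \<le> 2 * x ^ (2 * k) / R ^ k"
proof (cases "\<bar>x\<bar> \<le> R")
  case True
  then have "max (- R) (min x R) = x" by auto
  then show ?thesis using assms by simp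
next
  case False
  then have le: "\<bar>max (- R) (min x R)\<bar> \<le> \<bar>x\<bar>" "R \<le> \<bar>x\<bar>" using assms by auto
  have "\<bar>x ^ k - (max (- R) (min x R)) ^ k\<bar> \<le> \<bar>x\<bar> ^ k + \<bar>max (- R) (min x R)\<bar> ^ k"
    by (rule order_trans[OF abs_triangle_ineq4]) (simp add: power_abs)
  also have "\<dots> \<le> 2 * \<bar>x\<bar> ^ k" using power_mono[OF le(1), of k] by simp
  also have "\<dots> \<le> 2 * (\<bar>x\<bar> ^ k * (\<bar>x\<bar> ^ k / R ^ k))"
  proof -
    have "1 \<le> \<bar>x\<bar> ^ k / R ^ k" using power_mono[OF le(2), of k] assms by simp
    from mult_left_mono[OF this, of "\<bar>x\<bar> ^ k"] show ?thesis by simp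
  qed
  also have "\<dots> = 2 * x ^ (2 * k) / R ^ k"
    by (simp add: power_mult[symmetric] power_even_abs mult_2 power_add[symmetric] flip: power_add mult_2)
  finally show ?thesis .
qed

text \<open>Weak convergence only sees bounded functions. Truncated even powers and Fatou's lemma
  bound the even moments of the limit; then truncating x at R costs O(R^(-k)) uniformly along the
  sequence and in the limit, so the moments themselves converge.\<close>

lemma weak_limit_moments:
  assumes D: "\<And>n. all_moments (D n)" and N': "real_distribution N'" and w: "weak_conv_m D N'"
    and conv: "\<And>k. (\<lambda>n. (\<integral>x. x ^ k \<partial>D n)) \<longlonglongrightarrow> \<mu> k"
  shows "all_moments N'" "(\<integral>x. x ^ k \<partial>N') = \<mu> k"
proof -
  interpret N': real_distribution N' by (rule N')
  interpret D: all_moments "D n" for n by (rule D)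
  have wc: "(\<lambda>n. integral\<^sup>L (D n) g) \<longlonglongrightarrow> integral\<^sup>L N' g"
    if "\<And>x. isCont g x" "\<And>x. norm (g x) \<le> B" for g :: "real \<Rightarrow> real" and B
    using weak_conv_imp_integral_bdd_continuous_conv[OF D.real_distribution_axioms N' w] that by blast
  have even: "integrable N' (\<lambda>x. x ^ (2 * k))" "(\<integral>x. x ^ (2 * k) \<partial>N') \<le> \<mu> (2 * k)" for k
  proof -
    have \<mu>0: "0 \<le> \<mu> (2 * k)"
      by (rule tendsto_lowerbound[OF conv[of "2 * k"]]) (auto intro!: always_eventually Bochner_Integration.integral_nonneg simp: power_mult)
    have bnd: "(\<integral>\<^sup>+x. ennreal (min (x ^ (2 * k)) (real R)) \<partial>N') \<le> ennreal (\<mu> (2 * k))" for R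
    proof -
      have b: "norm (min (x ^ (2 * k)) (real R)) \<le> real R" for x :: real
        by (auto simp: power_mult min_def abs_if)
      have i: "integrable N' (\<lambda>x. min (x ^ (2 * k)) (real R))" "integrable (D n) (\<lambda>x. min (x ^ (2 * k)) (real R))" for n
        by (rule N'.integrable_const_bound[where B = "real R"], use b in auto,
            rule D.integrable_const_bound[where B = "real R"], use b in auto)
      have "(\<integral>x. min (x ^ (2 * k)) (real R) \<partial>N') \<le> \<mu> (2 * k)"
      proof (rule tendsto_le[OF sequentially_bot conv[of "2 * k"]])
        show "(\<lambda>n. \<integral>x. min (x ^ (2 * k)) (real R) \<partial>D n) \<longlonglongrightarrow> (\<integral>x. min (x ^ (2 * k)) (real R) \<partial>N')"
          by (rule wc[OF _ b]) (intro continuous_intros)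
        show "\<forall>\<^sub>F n in sequentially. (\<integral>x. min (x ^ (2 * k)) (real R) \<partial>D n) \<le> (\<integral>x. x ^ (2 * k) \<partial>D n)"
          using i D.moments by (intro always_eventually allI integral_mono) auto
      qed
      then show ?thesis
        using i by (subst nn_integral_eq_integral) (auto simp: power_mult intro!: ennreal_leI)
    qed
    have "(\<integral>\<^sup>+x. ennreal (x ^ (2 * k)) \<partial>N') = (\<integral>\<^sup>+x. liminf (\<lambda>R. ennreal (min (x ^ (2 * k)) (real R))) \<partial>N')"
    proof (rule nn_integral_cong)
      fix x :: real
      have "\<forall>\<^sub>F R in sequentially. x ^ (2 * k) \<le> real R"
        using filterlim_real_sequentially unfolding filterlim_at_top by blast
      then have "\<forall>\<^sub>F R in sequentially. ennreal (min (x ^ (2 * k)) (real R)) = ennreal (x ^ (2 * k))"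
        by eventually_elim simp
      then have "(\<lambda>R. ennreal (min (x ^ (2 * k)) (real R))) \<longlonglongrightarrow> ennreal (x ^ (2 * k))"
        by (rule tendsto_eventually)
      then show "ennreal (x ^ (2 * k)) = liminf (\<lambda>R. ennreal (min (x ^ (2 * k)) (real R)))"
        using lim_imp_Liminf[OF sequentially_bot] by metis
    qed
    also have "\<dots> \<le> liminf (\<lambda>R. \<integral>\<^sup>+x. ennreal (min (x ^ (2 * k)) (real R)) \<partial>N')"
      by (rule nn_integral_liminf) auto
    also have "\<dots> \<le> liminf (\<lambda>R::nat. ennreal (\<mu> (2 * k)))"
      by (intro Liminf_mono always_eventually allI bnd)
    also have "\<dots> = ennreal (\<mu> (2 * k))" by (simp add: Liminf_const)
    finally have fin: "(\<integral>\<^sup>+x. ennreal (x ^ (2 * k)) \<partial>N') \<le> ennreal (\<mu> (2 * k))" .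
    show int: "integrable N' (\<lambda>x. x ^ (2 * k))"
      by (rule integrableI_nonneg) (use fin in \<open>auto simp: power_mult intro: le_less_trans[OF _ ennreal_less_top]\<close>)
    show "(\<integral>x. x ^ (2 * k) \<partial>N') \<le> \<mu> (2 * k)"
      using fin \<mu>0 nn_integral_eq_integral[OF int] by (simp add: power_mult)
  qed
  have mom: "integrable N' (\<lambda>x. x ^ k)" for k
  proof (rule Bochner_Integration.integrable_bound)
    show "integrable N' (\<lambda>x. x ^ (2 * k) + 1)" using even(1)[of k] by simp
    show "AE x in N'. norm (x ^ k) \<le> norm (x ^ (2 * k) + 1)"
    proof (rule AE_I2)
      fix x :: real
      have "x ^ (2 * k) = (x ^ k)\<^sup>2" by (simp only: power_mult[symmetric] mult.commute[of 2])
      moreover have "\<bar>y\<bar> \<le> y\<^sup>2 + 1" for y :: real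
        using zero_le_power2[of "\<bar>y\<bar> - 1"] by (simp add: power2_diff)
      ultimately show "norm (x ^ k) \<le> norm (x ^ (2 * k) + 1)" by (metis abs_ge_self order_trans real_norm_def)
    qed
  qed simp
  then show AM: "all_moments N'" by unfold_locales
  interpret N'': all_moments N' by (rule AM)
  show "(\<integral>x. x ^ k \<partial>N') = \<mu> k"
  proof (cases "k = 0")
    case True
    have "(\<lambda>n. 1::real) \<longlonglongrightarrow> \<mu> 0" using conv[of 0] by (simp add: D.prob_UNIV)
    then show ?thesis using True by (simp add: N'.prob_UNIV LIMSEQ_const_iff)
  next
    case False
    have close: "\<bar>\<mu> k - (\<integral>x. x ^ k \<partial>N')\<bar> \<le> 4 * \<mu> (2 * k) / real R ^ k" if R: "R > 0" for R :: nat
    proof -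
      define g where "g x = (max (- real R) (min x (real R))) ^ k" for x
      have g_b: "norm (g x) \<le> real R ^ k" for x
        unfolding g_def norm_power by (rule power_mono) auto
      have g_c: "isCont g x" for x unfolding g_def by (intro continuous_intros)
      have [measurable]: "g \<in> borel_measurable borel"
        by (intro borel_measurable_continuous_onI continuous_at_imp_continuous_on) (use g_c in auto)
      have err: "\<bar>(\<integral>x. x ^ k \<partial>E) - (\<integral>x. g x \<partial>E)\<bar> \<le> 2 / real R ^ k * (\<integral>x. x ^ (2 * k) \<partial>E)" if "all_moments E" for E
      proof -
        interpret E: all_moments E by (rule that)
        have ig: "integrable E g" by (rule E.integrable_const_bound[where B = "real R ^ k"]) (use g_b in auto)
        have "\<bar>(\<integral>x. x ^ k \<partial>E) - (\<integral>x. g x \<partial>E)\<bar> = \<bar>\<integral>x. x ^ k - g x \<partial>E\<bar>"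
          using ig E.moments by simp
        also have "\<dots> \<le> (\<integral>x. \<bar>x ^ k - g x\<bar> \<partial>E)" by (rule integral_abs_bound)
        also have "\<dots> \<le> (\<integral>x. 2 * x ^ (2 * k) / real R ^ k \<partial>E)"
        proof (rule integral_mono)
          show "integrable E (\<lambda>x. \<bar>x ^ k - g x\<bar>)" using ig E.moments[of k] by simp
          show "integrable E (\<lambda>x. 2 * x ^ (2 * k) / real R ^ k)" using E.moments[of "2 * k"] by simp
          show "\<bar>x ^ k - g x\<bar> \<le> 2 * x ^ (2 * k) / real R ^ k" for x
            unfolding g_def using R by (intro truncation_error) simp
        qed
        finally show ?thesis by simp
      qed
      have "\<bar>\<mu> k - (\<integral>x. g x \<partial>N')\<bar> \<le> 2 / real R ^ k * \<mu> (2 * k)"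
      proof (rule tendsto_le[OF sequentially_bot])
        show "(\<lambda>n. 2 / real R ^ k * (\<integral>x. x ^ (2 * k) \<partial>D n)) \<longlonglongrightarrow> 2 / real R ^ k * \<mu> (2 * k)"
          by (intro tendsto_intros conv)
        show "(\<lambda>n. \<bar>(\<integral>x. x ^ k \<partial>D n) - (\<integral>x. g x \<partial>D n)\<bar>) \<longlonglongrightarrow> \<bar>\<mu> k - (\<integral>x. g x \<partial>N')\<bar>"
          by (intro tendsto_intros conv wc[OF g_c g_b])
      qed (use err D in auto)
      moreover have "\<bar>(\<integral>x. x ^ k \<partial>N') - (\<integral>x. g x \<partial>N')\<bar> \<le> 2 / real R ^ k * \<mu> (2 * k)"
        by (rule order_trans[OF err[OF AM]]) (intro mult_left_mono even, simp)
      ultimately have "\<bar>\<mu> k - (\<integral>x. x ^ k \<partial>N')\<bar> \<le> 2 / real R ^ k * \<mu> (2 * k) + 2 / real R ^ k * \<mu> (2 * k)"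
        by linarith
      then show ?thesis by simp
    qed
    have "(\<lambda>R. 4 * \<mu> (2 * k) / real R ^ k) \<longlonglongrightarrow> 0"
      using False by (intro real_tendsto_divide_at_top tendsto_const filterlim_pow_at_top filterlim_real_sequentially) auto
    moreover have "\<forall>\<^sub>F R in sequentially. \<bar>\<mu> k - (\<integral>x. x ^ k \<partial>N')\<bar> \<le> 4 * \<mu> (2 * k) / real R ^ k"
      using eventually_gt_at_top[of 0] by eventually_elim (rule close)
    ultimately have "\<bar>\<mu> k - (\<integral>x. x ^ k \<partial>N')\<bar> \<le> 0"
      by (rule tendsto_le[OF sequentially_bot _ tendsto_const])
    then show ?thesis by simp
  qed
qed

text \<open>Second moments give tightness by Chebyshev. Every subsequential limit has the moments of
  N, hence equals N by determinacy.\<close>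

theorem moment_convergence_weak:
  assumes D: "\<And>n. all_moments (D n)" and N: "all_moments N"
    and conv: "\<And>k. (\<lambda>n. (\<integral>x. x ^ k \<partial>D n)) \<longlonglongrightarrow> (\<integral>x. x ^ k \<partial>N)"
    and pos: "\<And>k. 0 < (\<integral>x. x ^ (2 * k) \<partial>N)"
    and Carleman: "\<not> summable (\<lambda>k. (\<integral>x. x ^ (2 * Suc k) \<partial>N) powr (- 1 / real (2 * Suc k)))"
  shows "weak_conv_m D N"
proof (rule tight_subseq_weak_converge)
  interpret D: all_moments "D n" for n by (rule D)
  interpret N: all_moments N by (rule N)
  show "real_distribution (D n)" for n by (rule D.real_distribution_axioms)
  show "real_distribution N" by (rule N.real_distribution_axioms)
  show "tight D"
    unfolding tight_def
  proof (intro conjI allI impI)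
    show "real_distribution (D n)" for n by (rule D.real_distribution_axioms)
    fix e :: real assume e: "0 < e"
    have "Bseq (\<lambda>n. \<integral>x. x ^ 2 \<partial>D n)" using conv[of 2] by (intro convergent_imp_Bseq convergentI)
    then obtain C where C: "C > 0" "\<And>n. norm (\<integral>x. x ^ 2 \<partial>D n) \<le> C" by (auto simp: Bseq_def)
    define R where "R = sqrt (2 * C / e)"
    have R: "R > 0" using C e by (simp add: R_def)
    have R2: "C / R\<^sup>2 = e / 2" using C e by (simp add: R_def field_simps)
    have "1 - e < D.prob n {- R<..R}" for n
    proof -
      have "D.prob n {x \<in> space (D n). R \<le> \<bar>x\<bar>} \<le> C / R\<^sup>2"
      proof (rule D.prob_abs_ge_le)
        have "(\<integral>\<^sup>+x. ennreal (x\<^sup>2) \<partial>D n) = ennreal (\<integral>x. x\<^sup>2 \<partial>D n)"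
          using D.moments[of n 2] by (intro nn_integral_eq_integral) auto
        then show "(\<integral>\<^sup>+x. ennreal (x\<^sup>2) \<partial>D n) \<le> ennreal C"
          using C(2)[of n] by (auto intro!: ennreal_leI)
      qed (use C R in auto)
      then have "D.prob n {x. R \<le> \<bar>x\<bar>} < e" using R2 e by simp
      moreover have "{x. R \<le> \<bar>x\<bar>} \<in> sets (D n)" by simp
      moreover have "1 = D.prob n UNIV" using D.prob_UNIV by simp
      moreover have "D.prob n UNIV \<le> D.prob n ({- R<..R} \<union> {x. R \<le> \<bar>x\<bar>})"
        by (intro D.finite_measure_mono) auto
      moreover have "D.prob n ({- R<..R} \<union> {x. R \<le> \<bar>x\<bar>}) \<le> D.prob n {- R<..R} + D.prob n {x. R \<le> \<bar>x\<bar>}"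
        by (intro measure_Un_le) auto
      ultimately show ?thesis by linarith
    qed
    then show "\<exists>a b. a < b \<and> (\<forall>n. 1 - e < D.prob n {a<..b})"
      using R by (intro exI[of _ "- R"] exI[of _ R]) auto
  qed
  fix s :: "nat \<Rightarrow> nat" and \<nu> assume s: "strict_mono s" and \<nu>: "real_distribution \<nu>" and w: "weak_conv_m (D \<circ> s) \<nu>"
  have conv': "(\<lambda>n. (\<integral>x. x ^ k \<partial>(D \<circ> s) n)) \<longlonglongrightarrow> (\<integral>x. x ^ k \<partial>N)" for k
    using LIMSEQ_subseq_LIMSEQ[OF conv s, of k] by (simp add: o_def)
  have D': "all_moments ((D \<circ> s) n)" for n by (simp add: D)
  have "N = \<nu>"
    using weak_limit_moments[OF D' \<nu> w conv'] N pos Carleman by (intro Carleman_determinate) simp_all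
  then show "weak_conv_m (D \<circ> s) N" using w by simp
qed

section \<open>Small eigenvalues of T when the limit law has no mass at 0\<close>

lemma integral_uniform_distr:
  fixes f T :: "_ \<Rightarrow> real"
  assumes [measurable]: "f \<in> borel_measurable borel"
  shows "(\<integral>x. f x \<partial>distr (measure_pmf (pmf_of_set {..<Suc m})) borel T) = (\<Sum>k<Suc m. f (T k)) / real (Suc m)"
proof -
  have "{..<Suc m} \<noteq> {}" by auto
  then have "(\<integral>k. f (T k) \<partial>measure_pmf (pmf_of_set {..<Suc m})) = (\<Sum>k<Suc m. f (T k)) / real (card {..<Suc m})"
    by (intro integral_pmf_of_set) auto
  then show ?thesis by (subst integral_distr) simp_all
qed

lemma all_moments_uniform_distr:
  fixes T :: "nat \<Rightarrow> real"
  shows "all_moments (distr (measure_pmf (pmf_of_set {..<Suc m})) borel T)"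
proof -
  interpret real_distribution "distr (measure_pmf (pmf_of_set {..<Suc m})) borel T"
    by (rule prob_space.real_distribution_distr[OF prob_space_measure_pmf]) simp
  show ?thesis
  proof
    fix k
    have "integrable (measure_pmf (pmf_of_set {..<Suc m})) (\<lambda>i. T i ^ k)"
    proof (rule integrable_measure_pmf_finite)
      have "{..<Suc m} \<noteq> {}" by auto
      then show "finite (set_pmf (pmf_of_set {..<Suc m}))" by (subst set_pmf_of_set) auto
    qed
    then show "integrable (distr (measure_pmf (pmf_of_set {..<Suc m})) borel T) (\<lambda>x. x ^ k)"
      by (subst integrable_distr_eq) auto
  qed
qed

lemma (in real_distribution) smoothed_atom_tendsto:
  "(\<lambda>n. expectation (\<lambda>x. (1 / real (Suc n)) / (\<bar>x\<bar> + 1 / real (Suc n)))) \<longlonglongrightarrow> prob {0}"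
proof -
  have "(\<lambda>n. expectation (\<lambda>x. (1 / real (Suc n)) / (\<bar>x\<bar> + 1 / real (Suc n)))) \<longlonglongrightarrow> expectation (\<lambda>x. indicator {0} x)"
  proof (rule integral_dominated_convergence[where w = "\<lambda>_. 1"])
    show "AE x in M. (\<lambda>n. (1 / real (Suc n)) / (\<bar>x\<bar> + 1 / real (Suc n))) \<longlonglongrightarrow> indicator {0} x"
    proof (rule AE_I2)
      fix x :: real
      show "(\<lambda>n. (1 / real (Suc n)) / (\<bar>x\<bar> + 1 / real (Suc n))) \<longlonglongrightarrow> indicator {0} x"
      proof (cases "x = 0")
        case True
        then show ?thesis by simp
      next
        case False
        have "(\<lambda>n. (1 / real (Suc n)) / (\<bar>x\<bar> + 1 / real (Suc n))) \<longlonglongrightarrow> 0 / (\<bar>x\<bar> + 0)"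
          using False by (intro tendsto_intros LIMSEQ_Suc[OF lim_1_over_n]) auto
        then show ?thesis using False by simp
      qed
    qed
    show "AE x in M. norm ((1 / real (Suc n)) / (\<bar>x\<bar> + 1 / real (Suc n))) \<le> 1" for n
    proof (rule AE_I2)
      fix x :: real
      have "0 < \<bar>x\<bar> + 1 / real (Suc n)" by (simp add: add_nonneg_pos)
      then show "norm ((1 / real (Suc n)) / (\<bar>x\<bar> + 1 / real (Suc n))) \<le> 1"
        by (simp only: real_norm_def abs_divide abs_of_pos divide_le_eq_1_pos)
    qed
  qed auto
  then show ?thesis by simp
qed

text \<open>The spectral distributions of T converge weakly to N; test this on s / (|x| + s), whose
  N-integral tends to the mass at 0 as s tends to 0. The threshold s depends on N, not on the array
  t, because in \<open>mass_at_zero\<close> it has to be fixed before the outcome is chosen.\<close>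

lemma few_small_eigenvalues:
  fixes \<mu> :: "nat \<Rightarrow> real"
  assumes \<mu>_pos: "\<And>k. k \<ge> 1 \<Longrightarrow> 0 < \<mu> k"
    and Carleman: "\<not> summable (\<lambda>k. \<mu> (2 * Suc k) powr (- 1 / real (2 * Suc k)))"
    and N: "real_distribution N"
    and N_moments: "\<And>k. k \<ge> 1 \<Longrightarrow> integrable N (\<lambda>x. x ^ k) \<and> (\<integral>x. x ^ k \<partial>N) = \<mu> k"
    and N0: "measure N {0} = 0" and "\<eta> > 0"
  obtains s where "s > 0"
    "\<forall>t. (\<forall>m k. k < m \<longrightarrow> 0 \<le> t m k) \<longrightarrow>
      (\<forall>p\<ge>1. (\<lambda>m. (\<Sum>k<m. t m k ^ p) / real m) \<longlonglongrightarrow> \<mu> p) \<longrightarrow>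
      (\<forall>\<^sub>F m in sequentially. (\<Sum>k<m. s / (t m k + s)) \<le> \<eta> * real m)"
proof -
  interpret N: real_distribution N by (rule N)
  have N': "all_moments N"
  proof
    show "integrable N (\<lambda>x. x ^ k)" for k using N_moments[of k] by (cases "k = 0") auto
  qed
  have N0': "(\<integral>x. x ^ 0 \<partial>N) = 1" by (simp add: N.prob_UNIV)
  have "\<forall>\<^sub>F n in sequentially. N.expectation (\<lambda>x. (1 / real (Suc n)) / (\<bar>x\<bar> + 1 / real (Suc n))) < \<eta>"
    using order_tendstoD(2)[OF N.smoothed_atom_tendsto, of \<eta>] N0 \<open>\<eta> > 0\<close> by simp
  then obtain n where n: "N.expectation (\<lambda>x. (1 / real (Suc n)) / (\<bar>x\<bar> + 1 / real (Suc n))) < \<eta>"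
    by (auto simp: eventually_sequentially)
  define s where "s = 1 / real (Suc n)"
  have s: "s > 0" by (simp add: s_def)
  define g where "g x = s / (\<bar>x\<bar> + s)" for x
  have p: "0 < \<bar>x\<bar> + s" for x using s by (simp add: add_nonneg_pos)
  have g_cont: "isCont g x" for x
    unfolding g_def using p[of x] by (intro continuous_intros) auto
  have g_bound: "norm (g x) \<le> 1" for x
    unfolding g_def using p[of x] s by (simp add: abs_of_pos)
  have [measurable]: "g \<in> borel_measurable borel"
    by (intro borel_measurable_continuous_onI continuous_at_imp_continuous_on) (use g_cont in auto)
  show ?thesis
  proof (rule that[OF s], intro allI impI)
    fix t :: "nat \<Rightarrow> nat \<Rightarrow> real"
    assume "\<forall>m k. k < m \<longrightarrow> 0 \<le> t m k" and "\<forall>p\<ge>1. (\<lambda>m. (\<Sum>k<m. t m k ^ p) / real m) \<longlonglongrightarrow> \<mu> p"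
    then have t: "\<And>m k. k < m \<Longrightarrow> 0 \<le> t m k"
      and conv: "\<And>p. p \<ge> 1 \<Longrightarrow> (\<lambda>m. (\<Sum>k<m. t m k ^ p) / real m) \<longlonglongrightarrow> \<mu> p" by blast+
    define D where "D m = distr (measure_pmf (pmf_of_set {..<Suc m})) borel (t (Suc m))" for m
    have wc: "weak_conv_m D N"
    proof (rule moment_convergence_weak[OF _ N'])
      show "all_moments (D n)" for n unfolding D_def by (rule all_moments_uniform_distr)
      show "(\<lambda>n. (\<integral>x. x ^ k \<partial>D n)) \<longlonglongrightarrow> (\<integral>x. x ^ k \<partial>N)" for k
      proof (cases "k = 0")
        case True
        have "(\<integral>x. x ^ 0 \<partial>D n) = 1" for n
          unfolding D_def by (subst integral_uniform_distr) auto
        then show ?thesis using True N0' by simp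
      next
        case False
        then show ?thesis
          unfolding D_def using LIMSEQ_Suc[OF conv[of k]] N_moments[of k]
          by (subst integral_uniform_distr) auto
      qed
      show "0 < (\<integral>x. x ^ (2 * k) \<partial>N)" for k
        using N0' \<mu>_pos[of "2 * k"] N_moments[of "2 * k"] by (cases "k = 0") auto
      show "\<not> summable (\<lambda>k. (\<integral>x. x ^ (2 * Suc k) \<partial>N) powr (- 1 / real (2 * Suc k)))"
      proof -
        have "(\<integral>x. x ^ (2 * Suc k) \<partial>N) = \<mu> (2 * Suc k)" for k using N_moments[of "2 * Suc k"] by simp
        then show ?thesis using Carleman by (simp only: not_False_eq_True simp_thms)
      qed
    qed
    have "(\<lambda>m. integral\<^sup>L (D m) g) \<longlonglongrightarrow> integral\<^sup>L N g"
      by (rule weak_conv_imp_integral_bdd_continuous_conv[OF _ N wc g_cont g_bound])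
        (auto simp: D_def all_moments.axioms(1) all_moments_uniform_distr)
    then have "\<forall>\<^sub>F m in sequentially. integral\<^sup>L (D m) g < \<eta>"
      by (rule order_tendstoD(2)) (use n[folded s_def, folded g_def] in simp)
    then have "\<forall>\<^sub>F m in sequentially. (\<Sum>k<Suc m. s / (t (Suc m) k + s)) \<le> \<eta> * real (Suc m)"
    proof eventually_elim
      case (elim m)
      have "(\<Sum>k<Suc m. g (t (Suc m) k)) / real (Suc m) < \<eta>"
        using elim unfolding D_def by (subst (asm) integral_uniform_distr) auto
      moreover have "(\<Sum>k<Suc m. g (t (Suc m) k)) = (\<Sum>k<Suc m. s / (t (Suc m) k + s))"
        using t[of _ "Suc m"] by (intro sum.cong refl) (simp add: g_def)
      ultimately show ?case by (simp add: pos_divide_less_eq mult.commute del: sum.lessThan_Suc)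
    qed
    then show "\<forall>\<^sub>F m in sequentially. (\<Sum>k<m. s / (t m k + s)) \<le> \<eta> * real m"
      by (subst eventually_sequentially_Suc[symmetric])
  qed
qed

section \<open>Measurability and conditioning on independent data\<close>

lemma det_measurable:
  fixes A :: "'x \<Rightarrow> complex mat"
  assumes A: "\<And>x. A x \<in> carrier_mat n n"
    and meas: "\<And>i k. i < n \<Longrightarrow> k < n \<Longrightarrow> (\<lambda>x. A x $$ (i, k)) \<in> borel_measurable M"
  shows "(\<lambda>x. Determinant.det (A x)) \<in> borel_measurable M"
proof -
  have "(\<lambda>x. \<Sum>p | p permutes {0..<n}. of_int (sign p) * (\<Prod>i = 0..<n. A x $$ (i, p i))) \<in> borel_measurable M"
  proof (intro borel_measurable_sum borel_measurable_times borel_measurable_const borel_measurable_prod)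
    fix p i assume "p \<in> {p. p permutes {0..<n}}" "i \<in> {0..<n}"
    then have "i < n" "p i < n" using permutes_in_image[of p "{0..<n}" i] by auto
    then show "(\<lambda>x. A x $$ (i, p i)) \<in> borel_measurable M" by (rule meas)
  qed
  then show ?thesis by (simp only: det_def'[OF A])
qed

lemma adj_mat_measurable:
  fixes A :: "'x \<Rightarrow> complex mat"
  assumes A: "\<And>x. A x \<in> carrier_mat n n"
    and meas: "\<And>i k. i < n \<Longrightarrow> k < n \<Longrightarrow> (\<lambda>x. A x $$ (i, k)) \<in> borel_measurable M"
    and "i < n" "k < n"
  shows "(\<lambda>x. adj_mat (A x) $$ (i, k)) \<in> borel_measurable M"
proof -
  have "(\<lambda>x. (-1) ^ (k + i) * Determinant.det (mat_delete (A x) k i)) \<in> borel_measurable M"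
  proof (intro borel_measurable_times borel_measurable_const det_measurable)
    show "mat_delete (A x) k i \<in> carrier_mat (n - 1) (n - 1)" for x
      using A by (rule mat_delete_carrier)
    fix a b assume ab: "a < n - 1" "b < n - 1"
    have "(\<lambda>x. A x $$ (if a < k then a else Suc a, if b < i then b else Suc b)) \<in> borel_measurable M"
      using ab by (intro meas) auto
    moreover have "mat_delete (A x) k i $$ (a, b) = A x $$ (if a < k then a else Suc a, if b < i then b else Suc b)" for x
      using ab A[of x] unfolding mat_delete_def by simp
    ultimately show "(\<lambda>x. mat_delete (A x) k i $$ (a, b)) \<in> borel_measurable M" by simp
  qed
  moreover have "adj_mat (A x) $$ (i, k) = (-1) ^ (k + i) * Determinant.det (mat_delete (A x) k i)" for x
    using A[of x] assms(3,4) by (simp add: adj_mat_def cofactor_def)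
  ultimately show ?thesis by simp
qed

lemma loo_form_measurable:
  assumes T: "\<And>i k. i < m \<Longrightarrow> k < m \<Longrightarrow> (\<lambda>x. T x i k) \<in> borel_measurable M"
    and q: "\<And>j i. j \<in> J \<Longrightarrow> i < m \<Longrightarrow> (\<lambda>x. q x j i) \<in> borel_measurable M"
    and ik: "i < m" "k < m"
  shows "(\<lambda>x. loo_form m (T x) (q x) J z i k) \<in> borel_measurable M"
proof -
  have P: "pencil m (T x) (q x) J z \<in> carrier_mat m m" for x by (simp add: pencil_def)
  have entry: "(\<lambda>x. pencil m (T x) (q x) J z $$ (a, b)) \<in> borel_measurable M" if "a < m" "b < m" for a b
  proof -
    have "(\<lambda>x. samp_mat m (T x) (q x) J a b) \<in> borel_measurable M"
      unfolding samp_mat_def using that by (intro borel_measurable_sum borel_measurable_times q T) auto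
    then have "(\<lambda>x. (if a = b then z else 0) - complex_of_real (samp_mat m (T x) (q x) J a b)) \<in> borel_measurable M"
      by (intro borel_measurable_diff borel_measurable_const measurable_compose[OF _ borel_measurable_of_real])
    moreover have "pencil m (T x) (q x) J z $$ (a, b) = (if a = b then z else 0) - complex_of_real (samp_mat m (T x) (q x) J a b)" for x
      using that by (simp add: pencil_def)
    ultimately show ?thesis by (simp only:)
  qed
  have "(\<lambda>x. res_mat m (T x) (q x) J z a b) \<in> borel_measurable M" if "a < m" "b < m" for a b
  proof -
    have "(\<lambda>x. adj_mat (pencil m (T x) (q x) J z) $$ (a, b)) \<in> borel_measurable M"
      by (rule adj_mat_measurable[OF P entry that])
    moreover have "(\<lambda>x. Determinant.det (pencil m (T x) (q x) J z)) \<in> borel_measurable M"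
      by (rule det_measurable[OF P entry])
    ultimately show ?thesis unfolding res_mat_def by (rule borel_measurable_divide[OF borel_measurable_uminus])
  qed
  then have "(\<lambda>x. \<Sum>l<m. complex_of_real (T x i l) * res_mat m (T x) (q x) J z l k) \<in> borel_measurable M"
    using ik by (intro borel_measurable_sum borel_measurable_times measurable_compose[OF T borel_measurable_of_real]) auto
  then show ?thesis
    unfolding loo_form_def res_form_def
    by (rule borel_measurable_times[OF borel_measurable_const measurable_compose[OF _ borel_measurable_Im]])
qed

lemma loo_form_cong:
  assumes T: "\<And>i k. i < m \<Longrightarrow> k < m \<Longrightarrow> T i k = T' i k"
    and q: "\<And>j i. j \<in> J \<Longrightarrow> i < m \<Longrightarrow> q j i = q' j i" and "i < m"
  shows "loo_form m T q J z i k = loo_form m T' q' J z i k"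
proof -
  have "pencil m T q J z = pencil m T' q' J z"
    unfolding pencil_def samp_mat_def
    by (intro eq_matI) (auto simp: T q intro!: arg_cong[of _ _ of_real] sum.cong)
  then have "res_mat m T q J z = res_mat m T' q' J z" unfolding res_mat_def by simp
  then show ?thesis unfolding loo_form_def res_form_def using T[OF \<open>i < m\<close>]
    by (simp cong: sum.cong_simp)
qed

lemma good_form_cong:
  assumes "\<And>i k. i < m \<Longrightarrow> k < m \<Longrightarrow> B i k = B' i k"
  shows "good_form m c \<eta> B = good_form m c \<eta> B'"
  unfolding good_form_def using assms by (simp cong: sum.cong_simp)

lemma rform_cong_matrix:
  assumes "\<And>i k. i < m \<Longrightarrow> k < m \<Longrightarrow> B i k = B' i k"
  shows "rform m B x y = rform m B' x y"
  unfolding rform_def using assms by (simp cong: sum.cong_simp)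

lemma psd_form_cong:
  assumes "\<And>i k. i < m \<Longrightarrow> k < m \<Longrightarrow> B i k = B' i k" "psd_form m B"
  shows "psd_form m B'"
proof -
  interpret psd_form m B by (rule assms(2))
  show ?thesis
    by unfold_locales (use assms(1) T_sym T_psd rform_cong_matrix[OF assms(1)] in auto)
qed

text \<open>Fubini for the product law: it is enough to bound the probability with the first
  component frozen at each of its values.\<close>

lemma (in prob_space) indep_var_freeze:
  assumes ind: "indep_var S X S' X'" and A: "A \<in> sets (S \<Otimes>\<^sub>M S')" and "0 \<le> \<delta>"
    and le: "\<And>\<omega>. \<omega> \<in> space M \<Longrightarrow> prob {\<omega>' \<in> space M. (X \<omega>, X' \<omega>') \<in> A} \<le> \<delta>"
  shows "prob {\<omega> \<in> space M. (X \<omega>, X' \<omega>) \<in> A} \<le> \<delta>"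
proof -
  have [measurable]: "X \<in> M \<rightarrow>\<^sub>M S" "X' \<in> M \<rightarrow>\<^sub>M S'" and [measurable]: "A \<in> sets (S \<Otimes>\<^sub>M S')"
    and eq: "distr M S X \<Otimes>\<^sub>M distr M S' X' = distr M (S \<Otimes>\<^sub>M S') (\<lambda>x. (X x, X' x))"
    using ind A by (auto simp: indep_var_distribution_eq)
  interpret D': prob_space "distr M S' X'" by (rule prob_space_distr) measurable
  have A': "A \<in> sets (distr M S X \<Otimes>\<^sub>M distr M S' X')" using A by simp
  have "emeasure M {\<omega> \<in> space M. (X \<omega>, X' \<omega>) \<in> A} = emeasure (distr M S X \<Otimes>\<^sub>M distr M S' X') A"
    unfolding eq by (subst emeasure_distr) (auto intro!: arg_cong[of _ _ "emeasure M"])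
  also have "\<dots> = (\<integral>\<^sup>+x. emeasure (distr M S' X') (Pair x -` A) \<partial>distr M S X)"
    by (rule D'.emeasure_pair_measure_alt[OF A'])
  also have "\<dots> = (\<integral>\<^sup>+\<omega>. emeasure (distr M S' X') (Pair (X \<omega>) -` A) \<partial>M)"
    using D'.measurable_emeasure_Pair[OF A'] by (intro nn_integral_distr) simp_all
  also have "\<dots> \<le> (\<integral>\<^sup>+\<omega>. ennreal \<delta> \<partial>M)"
  proof (rule nn_integral_mono)
    fix \<omega> assume \<omega>: "\<omega> \<in> space M"
    have "emeasure (distr M S' X') (Pair (X \<omega>) -` A) = emeasure M {\<omega>' \<in> space M. (X \<omega>, X' \<omega>') \<in> A}"
      by (subst emeasure_distr) (auto intro!: arg_cong[of _ _ "emeasure M"])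
    also have "\<dots> \<le> ennreal \<delta>" using le[OF \<omega>] by (simp add: emeasure_eq_measure ennreal_leI)
    finally show "emeasure (distr M S' X') (Pair (X \<omega>) -` A) \<le> ennreal \<delta>" .
  qed
  also have "\<dots> = ennreal \<delta>" by (simp add: emeasure_space_1)
  finally show ?thesis using \<open>0 \<le> \<delta>\<close> by (simp add: emeasure_eq_measure)
qed

text \<open>T and Y enter as arrays indexed by pairs, i.e. as points of product spaces, to fit the
  independence hypotheses. That B is good is part of the event: the probability is then small
  unconditionally, and goodness is checked later at a single outcome.\<close>

definition bad_column :: "nat \<Rightarrow> nat \<Rightarrow> complex \<Rightarrow> real \<Rightarrow> real \<Rightarrow> real \<Rightarrow> nat \<Rightarrow> (nat \<times> nat \<Rightarrow> real) \<Rightarrow> (nat \<times> nat \<Rightarrow> real) \<Rightarrow> bool" where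
  "bad_column m n z c \<eta> t j \<tau> y \<longleftrightarrow>
    (let B = loo_form m (\<lambda>i k. \<tau> (i, k)) (\<lambda>j i. y (i, j) / sqrt (real n)) ({..<n} - {j}) z
     in good_form m c \<eta> B \<and> rform m B (\<lambda>i. y (i, j)) (\<lambda>i. y (i, j)) < t * real m)"

lemma bad_column_cong:
  assumes "\<And>i k. i < m \<Longrightarrow> k < m \<Longrightarrow> \<tau> (i, k) = \<tau>' (i, k)" "\<And>i j. i < m \<Longrightarrow> j < n \<Longrightarrow> y (i, j) = y' (i, j)" "j < n"
  shows "bad_column m n z c \<eta> t j \<tau> y = bad_column m n z c \<eta> t j \<tau>' y'"
proof -
  let ?B = "loo_form m (\<lambda>i k. \<tau> (i, k)) (\<lambda>j i. y (i, j) / sqrt (real n)) ({..<n} - {j}) z"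
  let ?B' = "loo_form m (\<lambda>i k. \<tau>' (i, k)) (\<lambda>j i. y' (i, j) / sqrt (real n)) ({..<n} - {j}) z"
  have B: "?B i k = ?B' i k" if "i < m" for i k
    using that assms by (intro loo_form_cong) auto
  have "rform m ?B (\<lambda>i. y (i, j)) (\<lambda>i. y (i, j)) = rform m ?B (\<lambda>i. y' (i, j)) (\<lambda>i. y' (i, j))"
    using assms by (intro rform_cong) auto
  then show ?thesis
    unfolding bad_column_def Let_def using rform_cong_matrix[OF B] good_form_cong[OF B] by simp
qed

lemma bad_column_measurable:
  assumes S: "\<And>i k. i < m \<Longrightarrow> k < m \<Longrightarrow> (\<lambda>x. \<tau> x (i, k)) \<in> borel_measurable S"
    and y: "\<And>i j. i < m \<Longrightarrow> j < n \<Longrightarrow> (\<lambda>x. y x (i, j)) \<in> borel_measurable S" and "j < n"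
  shows "{x \<in> space S. bad_column m n z c \<eta> t j (\<tau> x) (y x)} \<in> sets S"
proof -
  define B where "B x = loo_form m (\<lambda>i k. \<tau> x (i, k)) (\<lambda>j i. y x (i, j) / sqrt (real n)) ({..<n} - {j}) z" for x
  have B: "(\<lambda>x. B x i k) \<in> borel_measurable S" if "i < m" "k < m" for i k
    unfolding B_def using that by (intro loo_form_measurable borel_measurable_divide borel_measurable_const S y) auto
  have [measurable]: "(\<lambda>x. \<Sum>i<m. B x i i) \<in> borel_measurable S"
    "(\<lambda>x. \<Sum>i<m. \<Sum>k<m. (B x i k)\<^sup>2) \<in> borel_measurable S"
    "(\<lambda>x. \<Sum>i<m. (\<Sum>k<m. B x i k)\<^sup>2) \<in> borel_measurable S"
    "(\<lambda>x. rform m (B x) (\<lambda>i. y x (i, j)) (\<lambda>i. y x (i, j))) \<in> borel_measurable S"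
    unfolding rform_def using \<open>j < n\<close>
    by (intro borel_measurable_sum borel_measurable_power borel_measurable_times B y; simp)+
  show ?thesis
    unfolding bad_column_def Let_def B_def[symmetric] good_form_def by measurable
qed

section \<open>The random model: bad columns are rare\<close>

locale sample_model = prob_space M for M :: "'a measure" +
  fixes Y :: "nat \<Rightarrow> nat \<Rightarrow> 'a \<Rightarrow> real" and T :: "nat \<Rightarrow> nat \<Rightarrow> nat \<Rightarrow> 'a \<Rightarrow> real" and n :: "nat \<Rightarrow> nat"
  assumes Y_rv: "\<And>i j. Y i j \<in> borel_measurable M"
    and Y_indep: "indep_vars (\<lambda>_. borel) (\<lambda>(i, j). Y i j) UNIV"
    and Y_ident: "\<And>i j. distr M borel (Y i j) = distr M borel (Y 0 0)"
    and Y_int: "integrable M (Y 0 0)"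
    and Y_var: "integrable M (\<lambda>\<omega>. \<bar>Y 0 0 \<omega> - expectation (Y 0 0)\<bar>\<^sup>2)"
    and Y_var1: "expectation (\<lambda>\<omega>. \<bar>Y 0 0 \<omega> - expectation (Y 0 0)\<bar>\<^sup>2) = 1"
    and n_pos: "\<And>m. n m > 0"
    and T_psd: "\<And>m \<omega>. \<omega> \<in> space M \<Longrightarrow> psd_form m (\<lambda>i k. T m i k \<omega>)"
    and T_indep: "\<And>m. indep_var
        (Pi\<^sub>M UNIV (\<lambda>_. borel)) (\<lambda>\<omega> (i, j). if i < m \<and> j < m then T m i j \<omega> else 0)
        (Pi\<^sub>M UNIV (\<lambda>_. borel)) (\<lambda>\<omega> (i, j). Y i j \<omega>)"
begin

abbreviation "Tarr m \<omega> \<equiv> (\<lambda>(i, k). T m i k \<omega>)"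
abbreviation "Yarr \<omega> \<equiv> (\<lambda>(i, j). Y i j \<omega>)"

definition law :: "real measure" where "law = distr M borel (Y 0 0)"

sublocale law: real_law law
proof (rule real_law.intro)
  show "prob_space law" unfolding law_def by (rule prob_space_distr[OF Y_rv])
  show "real_law_axioms law" by unfold_locales (simp add: law_def)
qed

lemma Y_sq_integrable: "integrable M (\<lambda>\<omega>. (Y i j \<omega>)\<^sup>2)"
  and Y_sq_expectation: "expectation (\<lambda>\<omega>. (Y i j \<omega>)\<^sup>2) = 1 + (expectation (Y 0 0))\<^sup>2"
proof -
  define \<mu> where "\<mu> = expectation (Y 0 0)"
  have eq: "(Y 0 0 \<omega>)\<^sup>2 = \<bar>Y 0 0 \<omega> - \<mu>\<bar>\<^sup>2 + 2 * \<mu> * Y 0 0 \<omega> - \<mu>\<^sup>2" for \<omega>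
    by (simp add: power2_diff algebra_simps)
  have 0: "integrable M (\<lambda>\<omega>. (Y 0 0 \<omega>)\<^sup>2)"
    unfolding eq using Y_int Y_var by (auto simp: \<mu>_def)
  have 1: "expectation (\<lambda>\<omega>. (Y 0 0 \<omega>)\<^sup>2) = 1 + \<mu>\<^sup>2"
    unfolding eq using Y_int Y_var Y_var1
    by (simp add: \<mu>_def[symmetric] prob_space power2_eq_square del: power2_abs)
  have D: "integrable (distr M borel (Y i j)) (\<lambda>x. x\<^sup>2) \<longleftrightarrow> integrable M (\<lambda>\<omega>. (Y i j \<omega>)\<^sup>2)"
    "integral\<^sup>L (distr M borel (Y i j)) (\<lambda>x. x\<^sup>2) = expectation (\<lambda>\<omega>. (Y i j \<omega>)\<^sup>2)" for i j
    using Y_rv[of i j] by (auto simp: integrable_distr_eq integral_distr)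
  show "integrable M (\<lambda>\<omega>. (Y i j \<omega>)\<^sup>2)" using 0 unfolding D(1)[symmetric] Y_ident[of i j] .
  show "expectation (\<lambda>\<omega>. (Y i j \<omega>)\<^sup>2) = 1 + (expectation (Y 0 0))\<^sup>2"
    using 1 unfolding D(2)[symmetric] Y_ident[of i j] \<mu>_def .
qed

lemma column_law:
  assumes "m > 0"
  shows "distr M (PiM {..<m} (\<lambda>_. borel)) (\<lambda>\<omega>. \<lambda>i\<in>{..<m}. Y i j \<omega>) = law.PD m"
proof -
  have "indep_vars (\<lambda>i. PiM {(i, j)} (\<lambda>_. borel)) (\<lambda>i \<omega>. restrict (\<lambda>p. (case p of (i, j) \<Rightarrow> Y i j) \<omega>) {(i, j)}) {..<m}"
    by (rule indep_vars_restrict[OF Y_indep]) (auto simp: disjoint_family_on_def)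
  from indep_vars_compose2[OF this, of "\<lambda>i f. f (i, j)" "\<lambda>_. borel"]
  have "indep_vars (\<lambda>_. borel) (\<lambda>i. Y i j) {..<m}"
    by simp
  then have "distr M (PiM {..<m} (\<lambda>_. borel)) (\<lambda>\<omega>. \<lambda>i\<in>{..<m}. Y i j \<omega>) = PiM {..<m} (\<lambda>i. distr M borel (Y i j))"
    using assms by (subst (asm) indep_vars_iff_distr_eq_PiM') (auto simp: Y_rv)
  then show ?thesis unfolding law_def by (simp add: Y_ident[of _ j])
qed

lemma Yarr_measurable [measurable]: "Yarr \<in> M \<rightarrow>\<^sub>M PiM UNIV (\<lambda>_. borel)"
  by (rule measurable_PiM_single') (auto simp: Y_rv)

context
  fixes c \<delta> t \<eta> :: real
  assumes tail: "\<And>m B. m > 0 \<Longrightarrow> psd_form m B \<Longrightarrow> good_form m c \<eta> B \<Longrightarrow>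
      law.PD.prob m {x \<in> space (law.PD m). rform m B x x < t * real m} \<le> \<delta>"
    and \<delta>: "0 \<le> \<delta>"
begin

text \<open>With T fixed and the other columns frozen, B is a deterministic form and column j has
  independent entries with the common law, so the lower tail bound applies.\<close>

lemma bad_column_fixed:
  assumes \<tau>: "psd_form m (\<lambda>i k. \<tau> (i, k))" and "m > 0" "j < p" and z: "Im z > 0"
  shows "prob {\<omega> \<in> space M. bad_column m p z c \<eta> t j \<tau> (Yarr \<omega>)} \<le> \<delta>"
proof -
  define I1 where "I1 = {..<m} \<times> ({..<p} - {j})"
  define I2 where "I2 = {..<m} \<times> {j}"
  let ?Z = "\<lambda>I \<omega>. restrict (\<lambda>r. (case r of (i, j) \<Rightarrow> Y i j) \<omega>) I"
  let ?P = "\<lambda>I. PiM I (\<lambda>_::nat \<times> nat. borel :: real measure)"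
  \<comment> \<open>Reassembles the full array from its two independent blocks.\<close>
  define comb where "comb x x' = (\<lambda>r. if r \<in> I1 then x r else x' r)" for x x' :: "nat \<times> nat \<Rightarrow> real"
  define A where "A = {x \<in> space (?P I1 \<Otimes>\<^sub>M ?P I2). bad_column m p z c \<eta> t j \<tau> (comb (fst x) (snd x))}"
  have ind: "indep_var (?P I1) (?Z I1) (?P I2) (?Z I2)"
    by (rule indep_var_restrict[OF Y_indep]) (auto simp: I1_def I2_def)
  have comb_meas: "(\<lambda>x. comb (fst x) (snd x) (i, l)) \<in> borel_measurable (?P I1 \<Otimes>\<^sub>M ?P I2)" if "i < m" "l < p" for i l
  proof (cases "(i, l) \<in> I1")
    case True
    then have "(\<lambda>x. fst x (i, l)) \<in> borel_measurable (?P I1 \<Otimes>\<^sub>M ?P I2)"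
      by (intro measurable_compose[OF measurable_fst measurable_component_singleton])
    then show ?thesis using True by (simp add: comb_def)
  next
    case False
    then have "(i, l) \<in> I2" using that by (auto simp: I1_def I2_def)
    then have "(\<lambda>x. snd x (i, l)) \<in> borel_measurable (?P I1 \<Otimes>\<^sub>M ?P I2)"
      by (intro measurable_compose[OF measurable_snd measurable_component_singleton])
    then show ?thesis using False by (simp add: comb_def)
  qed
  have A: "A \<in> sets (?P I1 \<Otimes>\<^sub>M ?P I2)"
    unfolding A_def using \<open>j < p\<close>
    by (intro bad_column_measurable comb_meas) auto
  have space: "?Z I \<omega> \<in> space (?P I)" for I \<omega> by (simp add: space_PiM)
  have eq: "(?Z I1 \<omega>, ?Z I2 \<omega>) \<in> A \<longleftrightarrow> bad_column m p z c \<eta> t j \<tau> (Yarr \<omega>)" for \<omega>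
  proof -
    have "bad_column m p z c \<eta> t j \<tau> (comb (?Z I1 \<omega>) (?Z I2 \<omega>)) = bad_column m p z c \<eta> t j \<tau> (Yarr \<omega>)"
      using \<open>j < p\<close> by (intro bad_column_cong) (auto simp: comb_def I1_def I2_def)
    then show ?thesis unfolding A_def using space by (simp add: space_pair_measure)
  qed
  have "prob {\<omega> \<in> space M. (?Z I1 \<omega>, ?Z I2 \<omega>) \<in> A} \<le> \<delta>"
  proof (rule indep_var_freeze[OF ind A \<delta>])
    fix \<omega> assume "\<omega> \<in> space M"
    define x where "x = ?Z I1 \<omega>"
    define q where "q j' i = x (i, j') / sqrt (real p)" for j' i
    interpret sample_form m "\<lambda>i k. \<tau> (i, k)" q
      unfolding sample_form_def by (rule \<tau>)
    define B where "B = loo_form m (\<lambda>i k. \<tau> (i, k)) q ({..<p} - {j}) z"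
    have B: "psd_form m B" unfolding B_def by (rule loo_form_psd[OF z])
    have iff: "(x, ?Z I2 \<omega>') \<in> A \<longleftrightarrow> good_form m c \<eta> B \<and> rform m B (\<lambda>i. Y i j \<omega>') (\<lambda>i. Y i j \<omega>') < t * real m" for \<omega>'
    proof -
      let ?y = "comb x (?Z I2 \<omega>')"
      let ?B' = "loo_form m (\<lambda>i k. \<tau> (i, k)) (\<lambda>j i. ?y (i, j) / sqrt (real p)) ({..<p} - {j}) z"
      have B': "?B' i k = B i k" if "i < m" for i k
        unfolding B_def using that by (intro loo_form_cong) (auto simp: q_def comb_def I1_def)
      have "rform m B (\<lambda>i. ?y (i, j)) (\<lambda>i. ?y (i, j)) = rform m B (\<lambda>i. Y i j \<omega>') (\<lambda>i. Y i j \<omega>')"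
        by (intro rform_cong) (auto simp: comb_def I1_def I2_def)
      then show ?thesis
        unfolding A_def bad_column_def Let_def using good_form_cong[OF B'] rform_cong_matrix[OF B'] space
        by (simp add: space_pair_measure x_def)
    qed
    show "prob {\<omega>' \<in> space M. (x, ?Z I2 \<omega>') \<in> A} \<le> \<delta>" unfolding iff
    proof (cases "good_form m c \<eta> B")
      case False
      then show "prob {\<omega>' \<in> space M. good_form m c \<eta> B \<and> rform m B (\<lambda>i. Y i j \<omega>') (\<lambda>i. Y i j \<omega>') < t * real m} \<le> \<delta>"
        using \<delta> by simp
    next
      case True
      let ?col = "\<lambda>\<omega>. \<lambda>i\<in>{..<m}. Y i j \<omega>"
      have col [measurable]: "?col \<in> M \<rightarrow>\<^sub>M PiM {..<m} (\<lambda>_. borel)"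
        by (intro measurable_restrict) (auto simp: Y_rv)
      have sets: "{x \<in> space (PiM {..<m} (\<lambda>_. borel)). rform m B x x < t * real m} \<in> sets (PiM {..<m} (\<lambda>_. borel :: real measure))"
      proof -
        have "(\<lambda>x. rform m B x x) \<in> borel_measurable (PiM {..<m} (\<lambda>_. borel :: real measure))"
          unfolding rform_def
          by (intro borel_measurable_sum borel_measurable_times borel_measurable_const measurable_component_singleton) auto
        then show ?thesis by measurable
      qed
      have sp: "space (law.PD m) = space (PiM {..<m} (\<lambda>_. borel :: real measure))"
        by (simp add: space_PiM law_def)
      have "prob {\<omega>' \<in> space M. rform m B (\<lambda>i. Y i j \<omega>') (\<lambda>i. Y i j \<omega>') < t * real m}
        = measure (distr M (PiM {..<m} (\<lambda>_. borel)) ?col) {x \<in> space (PiM {..<m} (\<lambda>_. borel)). rform m B x x < t * real m}"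
      proof (subst measure_distr[OF col sets], rule arg_cong[of _ _ prob])
        have "rform m B (?col \<omega>') (?col \<omega>') = rform m B (\<lambda>i. Y i j \<omega>') (\<lambda>i. Y i j \<omega>')" for \<omega>'
          by (intro rform_cong) auto
        moreover have "?col \<omega>' \<in> space (PiM {..<m} (\<lambda>_. borel :: real measure))" for \<omega>'
          by (simp add: space_PiM)
        ultimately show "{\<omega>' \<in> space M. rform m B (\<lambda>i. Y i j \<omega>') (\<lambda>i. Y i j \<omega>') < t * real m}
          = ?col -` {x \<in> space (PiM {..<m} (\<lambda>_. borel)). rform m B x x < t * real m} \<inter> space M" by auto
      qed
      also have "\<dots> \<le> \<delta>"
        unfolding column_law[OF \<open>m > 0\<close>] sp[symmetric] by (rule tail[OF \<open>m > 0\<close> B True])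
      finally show "prob {\<omega>' \<in> space M. good_form m c \<eta> B \<and> rform m B (\<lambda>i. Y i j \<omega>') (\<lambda>i. Y i j \<omega>') < t * real m} \<le> \<delta>"
        using True by simp
    qed
  qed
  then show ?thesis unfolding eq .
qed

text \<open>Freezing T as well, by its independence of Y.\<close>

lemma bad_column_prob:
  assumes "m > 0" "j < n m" "Im z > 0"
  shows "prob {\<omega> \<in> space M. bad_column m (n m) z c \<eta> t j (Tarr m \<omega>) (Yarr \<omega>)} \<le> \<delta>"
    and "{\<omega> \<in> space M. bad_column m (n m) z c \<eta> t j (Tarr m \<omega>) (Yarr \<omega>)} \<in> events"
proof -
  let ?P = "PiM UNIV (\<lambda>_::nat \<times> nat. borel :: real measure)"
  \<comment> \<open>The array in the form used by the independence hypothesis; its entries beyond m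
    do not affect the event.\<close>
  define X where "X \<omega> = (\<lambda>(i, k). if i < m \<and> k < m then T m i k \<omega> else 0)" for \<omega>
  define A where "A = {x \<in> space (?P \<Otimes>\<^sub>M ?P). bad_column m (n m) z c \<eta> t j (fst x) (snd x)}"
  have A: "A \<in> sets (?P \<Otimes>\<^sub>M ?P)"
    unfolding A_def using assms(2)
    by (intro bad_column_measurable measurable_compose[OF measurable_fst measurable_component_singleton]
      measurable_compose[OF measurable_snd measurable_component_singleton]) auto
  have ind: "indep_var ?P X ?P Yarr" using T_indep[of m] unfolding X_def .
  have mem: "(X \<omega>, Yarr \<omega>') \<in> A \<longleftrightarrow> bad_column m (n m) z c \<eta> t j (X \<omega>) (Yarr \<omega>')" for \<omega> \<omega>'
    unfolding A_def by (simp add: space_pair_measure space_PiM)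
  have iff: "bad_column m (n m) z c \<eta> t j (Tarr m \<omega>) (Yarr \<omega>) \<longleftrightarrow> (X \<omega>, Yarr \<omega>) \<in> A" for \<omega>
    unfolding mem using assms(2) by (intro bad_column_cong) (auto simp: X_def)
  have [measurable]: "X \<in> M \<rightarrow>\<^sub>M ?P" using ind by (rule indep_var_rv1)
  show "{\<omega> \<in> space M. bad_column m (n m) z c \<eta> t j (Tarr m \<omega>) (Yarr \<omega>)} \<in> events"
    unfolding iff using A by measurable
  show "prob {\<omega> \<in> space M. bad_column m (n m) z c \<eta> t j (Tarr m \<omega>) (Yarr \<omega>)} \<le> \<delta>"
    unfolding iff
  proof (rule indep_var_freeze[OF ind A \<delta>])
    fix \<omega> assume \<omega>: "\<omega> \<in> space M"
    have "psd_form m (\<lambda>i k. X \<omega> (i, k))"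
      by (rule psd_form_cong[OF _ T_psd[OF \<omega>]]) (simp add: X_def)
    then show "prob {\<omega>' \<in> space M. (X \<omega>, Yarr \<omega>') \<in> A} \<le> \<delta>"
      unfolding mem by (rule bad_column_fixed) (use assms in auto)
  qed
qed

text \<open>Markov's inequality for the number of bad columns; the dependence between the events for
  different columns does not matter.\<close>

lemma many_bad_columns_prob:
  assumes "m > 0" "Im z > 0" "\<theta> > 0"
  defines "S \<equiv> {\<omega> \<in> space M. \<theta> * real (n m) \<le> real (card {j. j < n m \<and> bad_column m (n m) z c \<eta> t j (Tarr m \<omega>) (Yarr \<omega>)})}"
  shows "prob S \<le> \<delta> / \<theta>" "S \<in> events"
proof -
  define E where "E j = {\<omega> \<in> space M. bad_column m (n m) z c \<eta> t j (Tarr m \<omega>) (Yarr \<omega>)}" for j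
  have E: "prob (E j) \<le> \<delta>" "E j \<in> events" if "j < n m" for j
    using bad_column_prob[OF assms(1) that assms(2)] unfolding E_def by auto
  have card: "real (card {j. j < n m \<and> bad_column m (n m) z c \<eta> t j (Tarr m \<omega>) (Yarr \<omega>)}) = (\<Sum>j<n m. indicator (E j) \<omega>)"
    if "\<omega> \<in> space M" for \<omega>
  proof -
    have "(\<Sum>j<n m. indicator (E j) \<omega> :: real) = (\<Sum>j\<in>{j \<in> {..<n m}. \<omega> \<in> E j}. 1)"
      by (subst sum.inter_filter) (auto simp: indicator_def of_bool_def)
    then show ?thesis using that by (simp add: E_def)
  qed
  have S_eq: "S = {\<omega> \<in> space M. \<theta> * real (n m) \<le> (\<Sum>j<n m. indicator (E j) \<omega>)}"
    unfolding S_def using card by auto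
  have meas [measurable]: "(\<lambda>\<omega>. \<Sum>j<n m. indicator (E j) \<omega> :: real) \<in> borel_measurable M"
    using E(2) by (intro borel_measurable_sum borel_measurable_indicator) auto
  show S: "S \<in> events" unfolding S_eq by measurable
  have int: "integrable M (\<lambda>\<omega>. \<Sum>j<n m. indicator (E j) \<omega> :: real)"
    using E(2) by (intro Bochner_Integration.integrable_sum integrable_real_indicator) (auto simp: emeasure_eq_measure)
  have "\<theta> * real (n m) * prob S = expectation (\<lambda>\<omega>. \<theta> * real (n m) * indicator S \<omega>)"
    using S by simp
  also have "\<dots> \<le> expectation (\<lambda>\<omega>. \<Sum>j<n m. indicator (E j) \<omega>)"
  proof (rule integral_mono_AE[OF _ int])
    show "integrable M (\<lambda>\<omega>. \<theta> * real (n m) * indicator S \<omega>)"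
      using S by (intro integrable_mult_right integrable_real_indicator) (auto simp: emeasure_eq_measure)
    show "AE \<omega> in M. \<theta> * real (n m) * indicator S \<omega> \<le> (\<Sum>j<n m. indicator (E j) \<omega>)"
      by (rule AE_I2) (auto simp: S_eq indicator_def sum_nonneg)
  qed
  also have "\<dots> = (\<Sum>j<n m. prob (E j))"
    using E(2) by (subst Bochner_Integration.integral_sum) (auto simp: emeasure_eq_measure)
  also have "\<dots> \<le> (\<Sum>j<n m. \<delta>)" using E(1) by (intro sum_mono) auto
  also have "\<dots> = real (n m) * \<delta>" by simp
  finally have "real (n m) * (\<theta> * prob S) \<le> real (n m) * \<delta>" by (simp add: mult_ac)
  then have "\<theta> * prob S \<le> \<delta>" using n_pos[of m] by simp
  then show "prob S \<le> \<delta> / \<theta>" using \<open>\<theta> > 0\<close> by (simp add: field_simps)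
qed

end
end

section \<open>Typical outcomes, empirical spectra and uniform convergence\<close>

text \<open>Otherwise almost every outcome is eventually in \<open>A m\<close>, and dominated
  convergence sends the probabilities to 1. This combines almost sure limits with error
  probabilities that are only bounded, not summable.\<close>

lemma (in prob_space) frequently_escape:
  assumes A: "\<And>m. A m \<in> events" "\<And>m. prob (A m) \<le> p" "p < 1" and P: "AE \<omega> in M. P \<omega>"
  obtains \<omega> where "\<omega> \<in> space M" "P \<omega>" "\<exists>\<^sub>F m :: nat in sequentially. \<omega> \<notin> A m"
proof (rule ccontr)
  assume *: "\<not> thesis"
  have "AE \<omega> in M. (\<lambda>m. indicator (A m) \<omega> :: real) \<longlonglongrightarrow> 1"
    using P
  proof (rule AE_mp, intro AE_I2 impI)
    fix \<omega> assume "\<omega> \<in> space M" "P \<omega>"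
    then have "\<forall>\<^sub>F m in sequentially. \<omega> \<in> A m" using * that by (auto simp: frequently_def)
    then have "\<forall>\<^sub>F m in sequentially. indicator (A m) \<omega> = (1::real)" by eventually_elim simp
    then show "(\<lambda>m. indicator (A m) \<omega> :: real) \<longlonglongrightarrow> 1" by (rule tendsto_eventually)
  qed
  then have "(\<lambda>m. expectation (\<lambda>\<omega>. indicator (A m) \<omega>)) \<longlonglongrightarrow> expectation (\<lambda>\<omega>. 1 :: real)"
    using A(1) by (intro integral_dominated_convergence[where w = "\<lambda>_. 1"]) (auto simp: indicator_def)
  then have "(\<lambda>m. prob (A m)) \<longlonglongrightarrow> 1" using A(1) by (simp add: prob_space)
  then have "1 \<le> p" by (rule tendsto_upperbound) (use A(2) in auto)
  then show False using A(3) by simp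
qed

text \<open>Polya's argument on the half-line: a finite grid on a compact interval where F is
  uniformly continuous, monotonicity between grid points, closeness to 1 beyond. Everything vanishes
  on the negative axis, so F may jump at 0.\<close>

lemma uniform_convergence_of_dfs:
  fixes F :: "real \<Rightarrow> real" and G :: "nat \<Rightarrow> real \<Rightarrow> real"
  assumes F: "mono F" "\<And>x. F x \<le> 1" "(F \<longlongrightarrow> 1) at_top" "\<And>x. x < 0 \<Longrightarrow> F x = 0" "continuous_on {0..} F"
    and G: "\<And>n. mono (G n)" "\<And>n x. G n x \<le> 1" "\<And>n x. x < 0 \<Longrightarrow> G n x = 0"
    and conv: "\<And>x. 0 \<le> x \<Longrightarrow> (\<lambda>n. G n x) \<longlonglongrightarrow> F x"
  shows "uniform_limit UNIV G F sequentially"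
  unfolding uniform_limit_iff
proof (intro allI impI)
  fix e :: real assume "0 < e"
  define d where "d = e / 4"
  have d: "0 < d" using \<open>0 < e\<close> by (simp add: d_def)
  have "\<forall>\<^sub>F x in at_top. 1 - d < F x" using order_tendstoD(1)[OF F(3), of "1 - d"] d by simp
  then have "\<forall>\<^sub>F x in at_top. 1 - d < F x \<and> 0 < x" using eventually_gt_at_top[of 0] by eventually_elim simp
  then obtain K where K: "0 < K" "1 - d < F K" by (auto simp: eventually_at_top_linorder)
  have "uniformly_continuous_on {0..K} F"
    using F(5) by (intro compact_uniformly_continuous) (auto elim: continuous_on_subset)
  then obtain r where r: "0 < r" "\<And>x x'. x \<in> {0..K} \<Longrightarrow> x' \<in> {0..K} \<Longrightarrow> dist x' x < r \<Longrightarrow> dist (F x') (F x) < d"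
    using d unfolding uniformly_continuous_on_def by meson
  obtain N where N: "K / r < real N" using reals_Archimedean2 by blast
  have "0 < K / r" using K r by simp
  then have N0: "0 < N" using N by (cases N) auto
  have h: "K / real N < r" using N N0 r by (simp add: field_simps)
  define g where "g i = real i * (K / real N)" for i
  have g: "0 \<le> g i" "i \<le> N \<Longrightarrow> g i \<le> K" for i
    using K N0 by (auto simp: g_def field_simps)
  have gN: "g N = K" using N0 by (simp add: g_def)
  have step: "\<bar>F (g (Suc i)) - F (g i)\<bar> < d" if "i < N" for i
  proof -
    have "g (Suc i) - g i = K / real N" unfolding g_def by (simp add: distrib_right add_divide_distrib)
    moreover have "0 < K / real N" using K N0 by simp
    ultimately have "dist (g (Suc i)) (g i) < r" using h by (simp add: dist_real_def)
    then show ?thesis using r(2)[of "g i" "g (Suc i)"] g that by (simp add: dist_real_def)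
  qed
  have "\<forall>\<^sub>F n in sequentially. \<forall>i\<in>{..N}. \<bar>G n (g i) - F (g i)\<bar> < d"
  proof (rule eventually_ball_finite)
    show "\<forall>i\<in>{..N}. \<forall>\<^sub>F n in sequentially. \<bar>G n (g i) - F (g i)\<bar> < d"
      using tendstoD[OF conv d] g by (simp add: dist_real_def)
  qed simp
  then show "\<forall>\<^sub>F n in sequentially. \<forall>x\<in>UNIV. dist (G n x) (F x) < e"
  proof eventually_elim
    case (elim n)
    have "\<bar>G n x - F x\<bar> < e" for x
    proof (cases "x < 0")
      case True
      then show ?thesis using F(4) G(3) \<open>0 < e\<close> by simp
    next
      case False
      show ?thesis
      proof (cases "x < K")
        case True
        define w where "w = K / real N"
        have w: "0 < w" "\<And>i. g i = real i * w" using K N0 by (simp_all add: w_def g_def)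
        define i where "i = nat \<lfloor>x / w\<rfloor>"
        have "0 \<le> x / w" using False w(1) by simp
        then have i: "real i \<le> x / w" "x / w < real i + 1"
          unfolding i_def by linarith+
        then have "real i * w \<le> x" "x < (real i + 1) * w"
          using w(1) by (simp_all only: pos_le_divide_eq pos_divide_less_eq)
        then have gi: "g i \<le> x" "x \<le> g (Suc i)" unfolding w(2) by (simp_all add: add.commute)
        have "g i < g N" using gi True gN by simp
        then have "i < N" using w(1) unfolding w(2) by simp
        have "G n (g i) \<le> G n x" "G n x \<le> G n (g (Suc i))" "F (g i) \<le> F x" "F x \<le> F (g (Suc i))"
          using gi G(1) F(1) by (auto simp: mono_def)
        moreover have "\<bar>G n (g i) - F (g i)\<bar> < d" "\<bar>G n (g (Suc i)) - F (g (Suc i))\<bar> < d"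
          using elim \<open>i < N\<close> by auto
        ultimately show ?thesis using step[OF \<open>i < N\<close>] d unfolding d_def by linarith
      next
        case False
        then have "G n K \<le> G n x" "F K \<le> F x" using G(1) F(1) by (auto simp: mono_def)
        moreover have "\<bar>G n K - F K\<bar> < d" using elim gN by force
        ultimately show ?thesis using K(2) F(2)[of x] G(2)[of n x] d unfolding d_def by linarith
      qed
    qed
    then show ?case by (simp add: dist_real_def)
  qed
qed

text \<open>Weak convergence speaks of continuity points only; these are dense because a monotone
  function has countably many discontinuities.\<close>

lemma mono_continuity_point:
  fixes F :: "real \<Rightarrow> real"
  assumes "mono F" "a < b"
  obtains x where "a < x" "x < b" "isCont F x"
proof -
  have "countable {x. \<not> isCont F x}" using mono_ctble_discont[OF assms(1)] .
  moreover have "uncountable {a<..<b}" using assms(2) by (simp add: uncountable_open_interval)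
  ultimately have "\<not> {a<..<b} \<subseteq> {x. \<not> isCont F x}" using countable_subset by blast
  then show ?thesis using that by auto
qed

lemma Mmat_samp_mat:
  "Mmat Y T m p \<omega> = Matrix.mat m m (\<lambda>(i, k). samp_mat m (\<lambda>i k. T m i k \<omega>) (\<lambda>j i. Y i j \<omega> / sqrt (real p)) {..<p} i k)"
proof (rule eq_matI)
  fix i k assume "i < dim_row (Matrix.mat m m (\<lambda>(i, k). samp_mat m (\<lambda>i k. T m i k \<omega>) (\<lambda>j i. Y i j \<omega> / sqrt (real p)) {..<p} i k))"
    "k < dim_col (Matrix.mat m m (\<lambda>(i, k). samp_mat m (\<lambda>i k. T m i k \<omega>) (\<lambda>j i. Y i j \<omega> / sqrt (real p)) {..<p} i k))"
  then have ik: "i < m" "k < m" by auto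
  have "Mmat Y T m p \<omega> $$ (i, k) = (1 / real p) * (\<Sum>l<m. (\<Sum>j<p. Y i j \<omega> * Y l j \<omega>) * T m l k \<omega>)"
    using ik by (simp add: Mmat_def Ymat_def Tmat_def scalar_prod_def atLeast0LessThan)
  also have "\<dots> = (\<Sum>l<m. \<Sum>j<p. Y i j \<omega> / sqrt (real p) * (Y l j \<omega> / sqrt (real p) * T m l k \<omega>))"
    by (simp add: sum_distrib_left sum_distrib_right field_simps)
  also have "\<dots> = samp_mat m (\<lambda>i k. T m i k \<omega>) (\<lambda>j i. Y i j \<omega> / sqrt (real p)) {..<p} i k"
    unfolding samp_mat_def sum_distrib_left by (rule sum.swap)
  finally show "Mmat Y T m p \<omega> $$ (i, k) = Matrix.mat m m (\<lambda>(i, k). samp_mat m (\<lambda>i k. T m i k \<omega>) (\<lambda>j i. Y i j \<omega> / sqrt (real p)) {..<p} i k) $$ (i, k)"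
    using ik by simp
qed (auto simp: Mmat_def Ymat_def Tmat_def)

lemma smoothed_zero_count:
  assumes "\<And>e. e \<in> set es \<Longrightarrow> (0::real) \<le> e"
  shows "(\<lambda>k. \<Sum>e\<leftarrow>es. (1 / real (Suc k))\<^sup>2 / (e\<^sup>2 + (1 / real (Suc k))\<^sup>2)) \<longlonglongrightarrow> real (length (filter (\<lambda>e. e \<le> 0) es))"
  using assms
proof (induction es)
  case (Cons e es)
  have "(\<lambda>k. (1 / real (Suc k))\<^sup>2 / (e\<^sup>2 + (1 / real (Suc k))\<^sup>2)) \<longlonglongrightarrow> (if e \<le> 0 then 1 else 0)"
  proof (cases "e \<le> 0")
    case True
    then have "e = 0" using Cons.prems[of e] by simp
    then show ?thesis by simp
  next
    case False
    have "(\<lambda>k. (1 / real (Suc k))\<^sup>2 / (e\<^sup>2 + (1 / real (Suc k))\<^sup>2)) \<longlonglongrightarrow> 0\<^sup>2 / (e\<^sup>2 + 0\<^sup>2)"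
      using False by (intro tendsto_intros LIMSEQ_Suc[OF lim_1_over_n]) auto
    then show ?thesis using False by simp
  qed
  from tendsto_add[OF this Cons.IH] Cons.prems show ?case by (cases "e \<le> 0") simp_all
qed simp

context sample_model
begin

abbreviation "Tf m \<omega> \<equiv> (\<lambda>i k. T m i k \<omega>)"
abbreviation "qf m \<omega> \<equiv> (\<lambda>j i. Y i j \<omega> / sqrt (real (n m)))"
abbreviation "spec m \<omega> \<equiv> esd (Mmat Y T m (n m) \<omega>)"

lemma sample_form: "\<omega> \<in> space M \<Longrightarrow> sample_form m (Tf m \<omega>)"
  unfolding sample_form_def by (rule T_psd)

lemma spec_eigenvalues:
  assumes "\<omega> \<in> space M"
  obtains es where "length es = m" "\<And>e. e \<in> set es \<Longrightarrow> 0 \<le> e"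
    "\<And>x. spec m \<omega> x = real (length (filter (\<lambda>e. e \<le> x) es)) / real m"
    "\<And>z. Im z > 0 \<Longrightarrow> smooth_count m (Tf m \<omega>) (qf m \<omega>) {..<n m} z = (\<Sum>e\<leftarrow>es. (Im z)\<^sup>2 / ((e - Re z)\<^sup>2 + (Im z)\<^sup>2))"
proof -
  interpret S: sample_form m "Tf m \<omega>" "qf m \<omega>" by (rule sample_form[OF assms])
  obtain es where es: "length es = m" "\<And>e. e \<in> set es \<Longrightarrow> 0 \<le> e"
    "char_poly (Matrix.mat m m (\<lambda>(i, k). samp_mat m (Tf m \<omega>) (qf m \<omega>) {..<n m} i k)) = (\<Prod>e\<leftarrow>es. [:- e, 1:])"
    "\<And>z. Im z > 0 \<Longrightarrow> smooth_count m (Tf m \<omega>) (qf m \<omega>) {..<n m} z = (\<Sum>e\<leftarrow>es. (Im z)\<^sup>2 / ((e - Re z)\<^sup>2 + (Im z)\<^sup>2))"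
    using S.smooth_count_eigenvalues[of "{..<n m}"] by blast
  have "spec m \<omega> x = real (length (filter (\<lambda>e. e \<le> x) es)) / real m" for x
    using esd_linear_factors[of "Mmat Y T m (n m) \<omega>" es x] es(1,3) unfolding Mmat_samp_mat by simp
  then show ?thesis using that es by blast
qed

lemma spec_mono: "\<omega> \<in> space M \<Longrightarrow> mono (spec m \<omega>)"
proof -
  assume \<omega>: "\<omega> \<in> space M"
  obtain es where es: "\<And>x. spec m \<omega> x = real (length (filter (\<lambda>e. e \<le> x) es)) / real m"
    using spec_eigenvalues[OF \<omega>, of m] by blast
  have "length (filter (\<lambda>e. e \<le> x) es) \<le> length (filter (\<lambda>e. e \<le> y) es)" if "x \<le> y" for x y
    using that by (induction es) auto
  then show ?thesis unfolding mono_def es by (auto intro!: divide_right_mono)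
qed

lemma spec_bounds:
  assumes "\<omega> \<in> space M"
  shows "0 \<le> spec m \<omega> x" "spec m \<omega> x \<le> 1" "x < 0 \<Longrightarrow> spec m \<omega> x = 0"
proof -
  obtain es where es: "length es = m" "\<And>e. e \<in> set es \<Longrightarrow> 0 \<le> e"
    "\<And>x. spec m \<omega> x = real (length (filter (\<lambda>e. e \<le> x) es)) / real m"
    using spec_eigenvalues[OF assms, of m] by metis
  show "0 \<le> spec m \<omega> x" unfolding es(3) by simp
  have "length (filter (\<lambda>e. e \<le> x) es) \<le> m" using length_filter_le[of _ es] es(1) by simp
  then show "spec m \<omega> x \<le> 1" unfolding es(3) by (cases "m = 0") (simp_all add: divide_le_eq_1)
  assume "x < 0"
  then have "filter (\<lambda>e. e \<le> x) es = []" using es(2) by (force simp: filter_empty_conv)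
  then show "spec m \<omega> x = 0" unfolding es(3) by simp
qed

text \<open>M has rank at most n. Here this is obtained from the smoothed count on the imaginary
  axis, which tends to the number of zero eigenvalues.\<close>

lemma spec_zero_ge:
  assumes "\<omega> \<in> space M" "m > 0"
  shows "1 - real (n m) / real m \<le> spec m \<omega> 0"
proof -
  interpret S: sample_form m "Tf m \<omega>" "qf m \<omega>" by (rule sample_form[OF assms(1)])
  obtain es where es: "\<And>e. e \<in> set es \<Longrightarrow> 0 \<le> e"
    "\<And>x. spec m \<omega> x = real (length (filter (\<lambda>e. e \<le> x) es)) / real m"
    "\<And>z. Im z > 0 \<Longrightarrow> smooth_count m (Tf m \<omega>) (qf m \<omega>) {..<n m} z = (\<Sum>e\<leftarrow>es. (Im z)\<^sup>2 / ((e - Re z)\<^sup>2 + (Im z)\<^sup>2))"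
    using spec_eigenvalues[OF assms(1), of m] by metis
  have "real m - real (n m) \<le> (\<Sum>e\<leftarrow>es. (1 / real (Suc k))\<^sup>2 / (e\<^sup>2 + (1 / real (Suc k))\<^sup>2))" for k
    using S.smooth_count_zero_ge[of "{..<n m}" "Complex 0 (1 / real (Suc k))"] es(3)[of "Complex 0 (1 / real (Suc k))"] by simp
  then have "real m - real (n m) \<le> real (length (filter (\<lambda>e. e \<le> 0) es))"
    by (intro tendsto_lowerbound[OF smoothed_zero_count[OF es(1)]]) auto
  then have "(real m - real (n m)) / real m \<le> real (length (filter (\<lambda>e. e \<le> 0) es)) / real m"
    by (intro divide_right_mono) auto
  then show ?thesis unfolding es(2) using assms(2) by (simp add: diff_divide_distrib)
qed

text \<open>Each eigenvalue in ]l, u] lies within d of Re z, so its Poisson weight is at least the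
  stated fraction.\<close>

lemma smooth_count_ge_spec:
  assumes "\<omega> \<in> space M" "m > 0" "Im z > 0" "Re z - d \<le> l" "l \<le> u" "u \<le> Re z + d"
  shows "(Im z)\<^sup>2 / (d\<^sup>2 + (Im z)\<^sup>2) * (real m * (spec m \<omega> u - spec m \<omega> l)) \<le> smooth_count m (Tf m \<omega>) (qf m \<omega>) {..<n m} z"
proof -
  obtain es where es: "\<And>x. spec m \<omega> x = real (length (filter (\<lambda>e. e \<le> x) es)) / real m"
    "\<And>z. Im z > 0 \<Longrightarrow> smooth_count m (Tf m \<omega>) (qf m \<omega>) {..<n m} z = (\<Sum>e\<leftarrow>es. (Im z)\<^sup>2 / ((e - Re z)\<^sup>2 + (Im z)\<^sup>2))"
    using spec_eigenvalues[OF assms(1), of m] by metis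
  let ?g = "(Im z)\<^sup>2 / (d\<^sup>2 + (Im z)\<^sup>2)"
  have "?g * (real (length (filter (\<lambda>e. e \<le> u) es)) - real (length (filter (\<lambda>e. e \<le> l) es)))
      \<le> (\<Sum>e\<leftarrow>es. (Im z)\<^sup>2 / ((e - Re z)\<^sup>2 + (Im z)\<^sup>2))"
  proof (induction es)
    case (Cons e es)
    have "?g * ((if e \<le> u then 1 else 0) - (if e \<le> l then 1 else 0)) \<le> (Im z)\<^sup>2 / ((e - Re z)\<^sup>2 + (Im z)\<^sup>2)"
    proof (cases "l < e \<and> e \<le> u")
      case True
      then have "\<bar>e - Re z\<bar> \<le> \<bar>d\<bar>" using assms by auto
      then have "(e - Re z)\<^sup>2 \<le> d\<^sup>2" by (simp add: abs_le_square_iff)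
      then have "?g \<le> (Im z)\<^sup>2 / ((e - Re z)\<^sup>2 + (Im z)\<^sup>2)"
        using assms(3) by (intro divide_left_mono mult_pos_pos) (auto simp: add_nonneg_pos)
      then show ?thesis using True by simp
    next
      case False
      then have "(if e \<le> u then 1 else 0) - (if e \<le> l then 1 else 0) = (0::real)" using assms(5) by auto
      then show ?thesis by simp
    qed
    moreover have "?g * (real (length (filter (\<lambda>e. e \<le> u) (e # es))) - real (length (filter (\<lambda>e. e \<le> l) (e # es))))
      = ?g * ((if e \<le> u then 1 else 0) - (if e \<le> l then 1 else 0))
        + ?g * (real (length (filter (\<lambda>e. e \<le> u) es)) - real (length (filter (\<lambda>e. e \<le> l) es)))"
      by (simp only: distrib_left[symmetric]) simp
    ultimately show ?case using Cons by simp
  qed simp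
  then show ?thesis unfolding es(1) es(2)[OF assms(3)] using assms(2) by (simp add: right_diff_distrib)
qed

text \<open>Markov's inequality: the expected squared norm of all columns together is m times the
  second moment of an entry.\<close>

lemma large_trace_prob:
  assumes C: "8 * (1 + (expectation (Y 0 0))\<^sup>2) \<le> C" and "m > 0"
  defines "S \<equiv> {\<omega> \<in> space M. C * real m \<le> (\<Sum>j<n m. \<Sum>i<m. (qf m \<omega> j i)\<^sup>2)}"
  shows "prob S \<le> 1 / 8" "S \<in> events"
proof -
  let ?v = "1 + (expectation (Y 0 0))\<^sup>2"
  have v: "0 < ?v" by (simp add: add_pos_nonneg)
  have q: "(qf m \<omega> j i)\<^sup>2 = (Y i j \<omega>)\<^sup>2 / real (n m)" for \<omega> j i by (simp add: power_divide)
  have int: "integrable M (\<lambda>\<omega>. \<Sum>j<n m. \<Sum>i<m. (qf m \<omega> j i)\<^sup>2)"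
    unfolding q by (intro Bochner_Integration.integrable_sum integrable_divide Y_sq_integrable)
  have [measurable]: "(\<lambda>\<omega>. \<Sum>j<n m. \<Sum>i<m. (qf m \<omega> j i)\<^sup>2) \<in> borel_measurable M"
    using int by (rule borel_measurable_integrable)
  show S: "S \<in> events" unfolding S_def by measurable
  have "C * real m * prob S = expectation (\<lambda>\<omega>. C * real m * indicator S \<omega>)" using S by simp
  also have "\<dots> \<le> expectation (\<lambda>\<omega>. \<Sum>j<n m. \<Sum>i<m. (qf m \<omega> j i)\<^sup>2)"
  proof (rule integral_mono_AE[OF _ int])
    show "integrable M (\<lambda>\<omega>. C * real m * indicator S \<omega>)"
      using S by (intro integrable_mult_right integrable_real_indicator) (auto simp: emeasure_eq_measure)
    show "AE \<omega> in M. C * real m * indicator S \<omega> \<le> (\<Sum>j<n m. \<Sum>i<m. (qf m \<omega> j i)\<^sup>2)"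
      by (rule AE_I2) (auto simp: S_def indicator_def intro!: sum_nonneg)
  qed
  also have "\<dots> = (\<Sum>j<n m. \<Sum>i<m. expectation (\<lambda>\<omega>. (Y i j \<omega>)\<^sup>2 / real (n m)))"
    unfolding q by (simp only: Bochner_Integration.integral_sum Bochner_Integration.integrable_sum integrable_divide Y_sq_integrable)
  also have "\<dots> = real m * ?v" using n_pos[of m] by (simp add: Y_sq_expectation field_simps)
  also have "\<dots> \<le> real m * (C / 8)" using C by (intro mult_left_mono) auto
  finally have "real m * (C * prob S) \<le> real m * (C / 8)" by (simp add: mult_ac)
  then have "C * prob S \<le> C * (1 / 8)" using \<open>m > 0\<close> by simp
  moreover have "C > 0" by (rule less_le_trans[OF _ C]) (use v in simp)
  ultimately show "prob S \<le> 1 / 8" by (simp only: mult_le_cancel_left_pos)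
qed

text \<open>The two exceptional events have probability at most 1/8 each for every size, so
  \<open>frequently_escape\<close> applies to their union. Sizes are \<open>Suc m\<close> because
  the tail bounds concern positive sizes.\<close>

lemma typical_outcome:
  assumes tail: "\<And>m B. m > 0 \<Longrightarrow> psd_form m B \<Longrightarrow> good_form m c \<eta> B \<Longrightarrow>
      law.PD.prob m {x \<in> space (law.PD m). rform m B x x < t * real m} \<le> \<theta> / 8"
    and "\<theta> > 0" "Im z > 0" and C: "8 * (1 + (expectation (Y 0 0))\<^sup>2) \<le> C" and P: "AE \<omega> in M. P \<omega>"
  obtains \<omega> where "\<omega> \<in> space M" "P \<omega>"
    "\<exists>\<^sub>F m in sequentially. (\<Sum>j<n (Suc m). \<Sum>i<Suc m. (qf (Suc m) \<omega> j i)\<^sup>2) \<le> C * real (Suc m)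
      \<and> real (card {j. j < n (Suc m) \<and> bad_column (Suc m) (n (Suc m)) z c \<eta> t j (Tarr (Suc m) \<omega>) (Yarr \<omega>)}) \<le> \<theta> * real (n (Suc m))"
proof -
  define A1 where "A1 m = {\<omega> \<in> space M. C * real (Suc m) \<le> (\<Sum>j<n (Suc m). \<Sum>i<Suc m. (qf (Suc m) \<omega> j i)\<^sup>2)}" for m
  define A2 where "A2 m = {\<omega> \<in> space M. \<theta> * real (n (Suc m)) \<le> real (card {j. j < n (Suc m) \<and> bad_column (Suc m) (n (Suc m)) z c \<eta> t j (Tarr (Suc m) \<omega>) (Yarr \<omega>)})}" for m
  have A1: "prob (A1 m) \<le> 1 / 8" "A1 m \<in> events" for m
    unfolding A1_def by (rule large_trace_prob[OF C]; simp)+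
  have A2: "prob (A2 m) \<le> (\<theta> / 8) / \<theta>" "A2 m \<in> events" for m
    unfolding A2_def using assms by (intro many_bad_columns_prob[OF tail]; simp)+
  have "prob (A1 m \<union> A2 m) \<le> 1 / 4" for m
  proof -
    have "prob (A1 m \<union> A2 m) \<le> prob (A1 m) + prob (A2 m)" by (rule measure_Un_le[OF A1(2) A2(2)])
    moreover have "prob (A2 m) \<le> 1 / 8" using A2(1)[of m] \<open>\<theta> > 0\<close> by simp
    ultimately show ?thesis using A1(1)[of m] by linarith
  qed
  then obtain \<omega> where \<omega>: "\<omega> \<in> space M" "P \<omega>" "\<exists>\<^sub>F m in sequentially. \<omega> \<notin> A1 m \<union> A2 m"
    using frequently_escape[of "\<lambda>m. A1 m \<union> A2 m" "1 / 4" P] A1 A2 P by auto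
  show ?thesis
  proof (rule that[OF \<omega>(1,2)])
    show "\<exists>\<^sub>F m in sequentially. (\<Sum>j<n (Suc m). \<Sum>i<Suc m. (qf (Suc m) \<omega> j i)\<^sup>2) \<le> C * real (Suc m)
      \<and> real (card {j. j < n (Suc m) \<and> bad_column (Suc m) (n (Suc m)) z c \<eta> t j (Tarr (Suc m) \<omega>) (Yarr \<omega>)}) \<le> \<theta> * real (n (Suc m))"
      using \<omega>(3) by (rule frequently_elim1) (use \<omega>(1) in \<open>auto simp: A1_def A2_def not_le less_imp_le simp del: sum.lessThan_Suc\<close>)
  qed
qed

lemma good_column_lower:
  assumes "\<not> bad_column m (n m) z c \<eta> t j (Tarr m \<omega>) (Yarr \<omega>)"
    and "good_form m c \<eta> (loo_form m (Tf m \<omega>) (qf m \<omega>) ({..<n m} - {j}) z)"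
  shows "t * real m / real (n m) \<le> rform m (loo_form m (Tf m \<omega>) (qf m \<omega>) ({..<n m} - {j}) z) (qf m \<omega> j) (qf m \<omega> j)"
proof -
  let ?B = "loo_form m (Tf m \<omega>) (qf m \<omega>) ({..<n m} - {j}) z"
  have "t * real m \<le> rform m ?B (\<lambda>i. Y i j \<omega>) (\<lambda>i. Y i j \<omega>)"
    using assms unfolding bad_column_def Let_def by simp
  also have "\<dots> = real (n m) * rform m ?B (qf m \<omega> j) (qf m \<omega> j)"
    unfolding rform_def sum_distrib_left using n_pos[of m]
    by (intro sum.cong refl) (simp add: field_simps)
  finally show ?thesis using n_pos[of m] by (simp add: field_simps)
qed

end

lemma frequently_eventually_ex:
  assumes "\<exists>\<^sub>F x in F. P x" "\<forall>\<^sub>F x in F. Q x"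
  obtains x where "P x" "Q x"
proof (rule ccontr)
  assume *: "\<not> thesis"
  have "\<forall>\<^sub>F x in F. \<not> P x" using assms(2) by eventually_elim (use * that in blast)
  then show False using assms(1) by (simp add: frequently_def)
qed

lemma jump_if_not_isCont:
  fixes F :: "real \<Rightarrow> real"
  assumes "mono F" "\<not> isCont F x"
  obtains a where "0 < a" "\<And>l u. l < x \<Longrightarrow> x < u \<Longrightarrow> a \<le> F u - F l"
proof (rule ccontr)
  assume *: "\<not> thesis"
  have "isCont F x"
    unfolding isCont_def tendsto_iff
  proof (intro allI impI)
    fix e :: real assume "0 < e"
    have "\<exists>l u. l < x \<and> x < u \<and> F u - F l < e"
    proof (rule ccontr)
      assume "\<not> ?thesis"
      then have "\<And>l u. l < x \<Longrightarrow> x < u \<Longrightarrow> e \<le> F u - F l" by (meson not_le)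
      with \<open>0 < e\<close> show False using * that by blast
    qed
    then obtain l u where lu: "l < x" "x < u" "F u - F l < e" by blast
    have "\<forall>\<^sub>F t in at x. t \<in> {l<..<u}"
      using lu by (intro eventually_at_in_open') auto
    then show "\<forall>\<^sub>F t in at x. dist (F t) (F x) < e"
    proof eventually_elim
      case (elim t)
      then have "F l \<le> F t" "F t \<le> F u" "F l \<le> F x" "F x \<le> F u"
        using assms(1) lu by (auto simp: mono_def)
      then show ?case using lu(3) unfolding dist_real_def by linarith
    qed
  qed
  then show False using assms(2) by simp
qed

context sample_model
begin

text \<open>The fourth power of each eigenvalue of T is at most tr T^4 \<le> C m, so T has norm at
  most (C m)^(1/4). That is o(m), and B inherits it through domination by T.\<close>

lemma regular_good_form:
  assumes \<omega>: "\<omega> \<in> space M" and z: "Im z > 0" and C: "C > 0"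
    and tr1: "mtrace (Tmat T m \<omega> ^\<^sub>m 1) \<le> C * real m" and tr4: "mtrace (Tmat T m \<omega> ^\<^sub>m 4) \<le> C * real m"
    and \<eta>: "(C * real m) powr (1/4) * (C * real m) \<le> \<eta> * (real m)\<^sup>2" "((C * real m) powr (1/4))\<^sup>2 * real m \<le> \<eta> * (real m)\<^sup>2"
    and c: "c * real m \<le> (\<Sum>i<m. loo_form m (Tf m \<omega>) (qf m \<omega>) J z i i)"
  shows "good_form m c \<eta> (loo_form m (Tf m \<omega>) (qf m \<omega>) J z)"
proof -
  interpret S: sample_form m "Tf m \<omega>" "qf m \<omega>" by (rule sample_form[OF \<omega>])
  obtain b t where "eigenbasis m (Tf m \<omega>) b t" using S.exists_eigenbasis by blast
  then interpret E: eigenbasis m "Tf m \<omega>" b t .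
  define \<tau> where "\<tau> = (C * real m) powr (1/4)"
  have \<tau>: "0 \<le> \<tau>" by (simp add: \<tau>_def)
  have Tmat: "Tmat T m \<omega> = Matrix.mat m m (\<lambda>(i, k). Tf m \<omega> i k)" by (simp add: Tmat_def)
  have t_le: "t k \<le> \<tau>" if "k < m" for k
  proof -
    have t0: "0 \<le> t k" using E.eigenvalue_nonneg[OF that] .
    have "t k ^ 4 \<le> (\<Sum>k<m. t k ^ 4)"
      using that E.eigenvalue_nonneg by (intro member_le_sum) auto
    also have "\<dots> \<le> C * real m" using tr4 unfolding Tmat E.trace_power .
    finally have "(t k ^ 4) powr (1/4) \<le> \<tau>" unfolding \<tau>_def using t0 by (intro powr_mono2) auto
    moreover have "(t k ^ 4) powr (1/4) = t k"
    proof (cases "t k = 0")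
      case False
      then have pow: "t k ^ 4 = t k powr real 4" using t0 by (intro powr_realpow[symmetric]) auto
      show ?thesis unfolding pow powr_powr using False t0 by simp
    qed simp
    ultimately show ?thesis by simp
  qed
  have "(\<Sum>k<m. T m k k \<omega>) = mtrace (Tmat T m \<omega> ^\<^sub>m 1)"
    by (simp add: mtrace_def Tmat_def)
  then have "\<tau> * (\<Sum>k<m. T m k k \<omega>) \<le> \<tau> * (C * real m)" using tr1 \<tau> by (intro mult_left_mono) auto
  then have "\<tau> * (\<Sum>k<m. T m k k \<omega>) \<le> \<eta> * (real m)\<^sup>2" using \<eta>(1) unfolding \<tau>_def by linarith
  then show ?thesis
    using \<eta>(2) c E.rform_le_norm_sq[OF t_le] \<tau> by (intro S.loo_form_good[OF z, of \<tau>]) (auto simp: \<tau>_def)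
qed

end

section \<open>The limit law: no positive atoms, and its mass at 0\<close>

locale sample_limit = sample_model M Y T n
  for M :: "'a measure" and Y :: "nat \<Rightarrow> nat \<Rightarrow> 'a \<Rightarrow> real" and T :: "nat \<Rightarrow> nat \<Rightarrow> nat \<Rightarrow> 'a \<Rightarrow> real" and n :: "nat \<Rightarrow> nat" +
  fixes y :: real and \<mu> :: "nat \<Rightarrow> real" and F :: "real \<Rightarrow> real"
  assumes y_pos: "y > 0"
    and ratio: "(\<lambda>m. real m / real (n m)) \<longlonglongrightarrow> y"
    and T_moments: "\<And>k. k \<ge> 1 \<Longrightarrow> (AE \<omega> in M. (\<lambda>m. mtrace (Tmat T m \<omega> ^\<^sub>m k) / real m) \<longlonglongrightarrow> \<mu> k)"
    and F_df: "is_df F"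
    and F_lim: "AE \<omega> in M. weak_conv (\<lambda>m. spec (Suc m) \<omega>) F"
begin

lemma F_mono: "mono F" using F_df by (simp add: is_df_def)

definition limit_outcome :: "'a \<Rightarrow> bool" where
  "limit_outcome \<omega> \<longleftrightarrow> (\<forall>k\<ge>1. (\<lambda>m. mtrace (Tmat T m \<omega> ^\<^sub>m k) / real m) \<longlonglongrightarrow> \<mu> k) \<and> weak_conv (\<lambda>m. spec (Suc m) \<omega>) F"

lemma AE_limit_outcome: "AE \<omega> in M. limit_outcome \<omega>"
proof -
  have "AE \<omega> in M. \<forall>k. k \<ge> 1 \<longrightarrow> (\<lambda>m. mtrace (Tmat T m \<omega> ^\<^sub>m k) / real m) \<longlonglongrightarrow> \<mu> k"
    unfolding AE_all_countable using T_moments by (auto intro: AE_I2)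
  then show ?thesis using F_lim unfolding limit_outcome_def by eventually_elim auto
qed

lemma eventually_columns_le: "\<forall>\<^sub>F m in sequentially. real (n (Suc m)) \<le> 2 / y * real (Suc m)"
proof -
  have "\<forall>\<^sub>F m in sequentially. y / 2 < real (Suc m) / real (n (Suc m))"
    using order_tendstoD(1)[OF LIMSEQ_Suc[OF ratio], of "y / 2"] y_pos by simp
  then show ?thesis
  proof eventually_elim
    case (elim m)
    then have "y / 2 * real (n (Suc m)) < real (Suc m)"
      using n_pos[of "Suc m"] by (simp add: pos_less_divide_eq)
    then show ?case using y_pos by (simp add: field_simps)
  qed
qed

lemma eventually_trace_le:
  assumes "limit_outcome \<omega>" "k \<ge> 1" "\<mu> k < C"
  shows "\<forall>\<^sub>F m in sequentially. mtrace (Tmat T (Suc m) \<omega> ^\<^sub>m k) \<le> C * real (Suc m)"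
proof -
  have "(\<lambda>m. mtrace (Tmat T (Suc m) \<omega> ^\<^sub>m k) / real (Suc m)) \<longlonglongrightarrow> \<mu> k"
    using assms LIMSEQ_Suc unfolding limit_outcome_def by blast
  then have "\<forall>\<^sub>F m in sequentially. mtrace (Tmat T (Suc m) \<omega> ^\<^sub>m k) / real (Suc m) < C"
    by (rule order_tendstoD(2)[OF _ assms(3)])
  then show ?thesis by eventually_elim (simp add: pos_divide_less_eq)
qed

lemma eventually_size_conditions:
  assumes "C > 0" "\<eta> > 0"
  shows "\<forall>\<^sub>F m in sequentially. (C * real (Suc m)) powr (1/4) * (C * real (Suc m)) \<le> \<eta> * (real (Suc m))\<^sup>2
    \<and> ((C * real (Suc m)) powr (1/4))\<^sup>2 * real (Suc m) \<le> \<eta> * (real (Suc m))\<^sup>2"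
proof -
  have "\<forall>\<^sub>F m in sequentially. (C * real (Suc m)) powr (1/4) * (C * real (Suc m)) \<le> \<eta> * (real (Suc m))\<^sup>2"
    using assms by real_asymp
  moreover have "\<forall>\<^sub>F m in sequentially. ((C * real (Suc m)) powr (1/4))\<^sup>2 * real (Suc m) \<le> \<eta> * (real (Suc m))\<^sup>2"
    using assms by real_asymp
  ultimately show ?thesis by eventually_elim simp
qed

definition moment_bound :: real where
  "moment_bound = 8 * (1 + (expectation (Y 0 0))\<^sup>2) + \<bar>\<mu> 1\<bar> + \<bar>\<mu> 4\<bar> + 1"

lemma moment_bound: "0 < moment_bound" "8 * (1 + (expectation (Y 0 0))\<^sup>2) \<le> moment_bound"
  "\<mu> 1 < moment_bound" "\<mu> 4 < moment_bound"
proof -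
  have "0 \<le> 8 * (1 + (expectation (Y 0 0))\<^sup>2)" by simp
  then show "0 < moment_bound" "8 * (1 + (expectation (Y 0 0))\<^sup>2) \<le> moment_bound"
    "\<mu> 1 < moment_bound" "\<mu> 4 < moment_bound"
    unfolding moment_bound_def by linarith+
qed

lemma quadratic_tail:
  assumes "c > 0" "\<theta> > 0"
  obtains t \<eta> where "t > 0" "\<eta> > 0" "\<And>m B. m > 0 \<Longrightarrow> psd_form m B \<Longrightarrow> good_form m c \<eta> B \<Longrightarrow>
      law.PD.prob m {x \<in> space (law.PD m). rform m B x x < t * real m} \<le> \<theta> / 8"
proof -
  define mu where "mu = expectation (Y 0 0)"
  have e: "integral\<^sup>L law f = expectation (\<lambda>\<omega>. f (Y 0 0 \<omega>))" "integrable law f \<longleftrightarrow> integrable M (\<lambda>\<omega>. f (Y 0 0 \<omega>))"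
    if "f \<in> borel_measurable borel" for f :: "real \<Rightarrow> real"
    unfolding law_def using that Y_rv[of 0 0] by (auto simp: integral_distr integrable_distr_eq)
  show ?thesis
  proof (rule law.quadratic_form_lower_tail[of mu c "\<theta> / 8"])
    show "integrable law (\<lambda>x. x)" "law.expectation (\<lambda>x. x) = mu"
      using Y_int by (simp_all add: e mu_def)
    show "integrable law (\<lambda>x. (x - mu)\<^sup>2)" "law.expectation (\<lambda>x. (x - mu)\<^sup>2) = 1"
      using Y_var Y_var1 by (simp_all add: e mu_def)
  qed (use assms that in auto)
qed

text \<open>The order of the constants is the point: the jump a fixes c, which together with
  \<theta> fixes t, and only then is \<epsilon> chosen. At one typical large size the jump makes the
  count at least \<kappa> m, hence B good for every removed column, hence most \<beta>_j of size
  O(\<epsilon>), so that the count at r > 0 is smaller than \<kappa> m.\<close>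

lemma no_positive_atom:
  assumes r: "r > 0"
  shows "isCont F r"
proof (rule ccontr)
  assume "\<not> isCont F r"
  then obtain a where a: "0 < a" "\<And>l u. l < r \<Longrightarrow> r < u \<Longrightarrow> a \<le> F u - F l"
    using jump_if_not_isCont[OF F_mono] by blast
  define C where "C = moment_bound"
  note C = moment_bound[folded C_def]
  \<comment> \<open>Half of the jump survives for large m, and the Poisson weight near r is at least
    1/2.\<close>
  define \<kappa> where "\<kappa> = a / 4"
  define a0 where "a0 = r * \<kappa> / 2"
  \<comment> \<open>With r + 1 in place of r + \<epsilon>, so that c does not depend on
    \<epsilon>.\<close>
  define c where "c = a0\<^sup>2 / (C * (r + 1))"
  define \<theta> where "\<theta> = r * \<kappa> * y / (8 * (r + 1))"
  have \<kappa>: "\<kappa> > 0" using a by (simp add: \<kappa>_def)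
  have a0: "a0 > 0" using \<kappa> r by (simp add: a0_def)
  have c: "c > 0" using a0 C r by (simp add: c_def)
  have \<theta>: "\<theta> > 0" using \<kappa> r y_pos by (simp add: \<theta>_def)
  obtain t \<eta> where t: "t > 0" "\<eta> > 0" and tail: "\<And>m B. m > 0 \<Longrightarrow> psd_form m B \<Longrightarrow> good_form m c \<eta> B \<Longrightarrow>
      law.PD.prob m {x \<in> space (law.PD m). rform m B x x < t * real m} \<le> \<theta> / 8"
    using quadratic_tail[OF c \<theta>] by blast
  \<comment> \<open>Makes the three terms of \<open>smooth_count_pos_bound\<close> at most 1/4, 1/4
    and 1/8 of r \<kappa> m; the second of these is due to \<theta>.\<close>
  define \<epsilon> where "\<epsilon> = min 1 (min (r * \<kappa> / 8) (r * \<kappa> * y\<^sup>2 * t / 16))"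
  have \<epsilon>: "\<epsilon> > 0" "\<epsilon> \<le> 1" "\<epsilon> \<le> r * \<kappa> / 8" "\<epsilon> \<le> r * \<kappa> * y\<^sup>2 * t / 16"
    unfolding \<epsilon>_def using r \<kappa> t y_pos by auto
  define z where "z = Complex r \<epsilon>"
  have z: "Im z > 0" "Re z = r" "Im z = \<epsilon>" using \<epsilon> by (simp_all add: z_def)
  have z_norm: "cmod z \<le> r + 1"
    using cmod_le[of z] \<epsilon> r unfolding z by simp
  obtain \<omega> where \<omega>: "\<omega> \<in> space M" "limit_outcome \<omega>"
    "\<exists>\<^sub>F m in sequentially. (\<Sum>j<n (Suc m). \<Sum>i<Suc m. (qf (Suc m) \<omega> j i)\<^sup>2) \<le> C * real (Suc m)
      \<and> real (card {j. j < n (Suc m) \<and> bad_column (Suc m) (n (Suc m)) z c \<eta> t j (Tarr (Suc m) \<omega>) (Yarr \<omega>)}) \<le> \<theta> * real (n (Suc m))"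
    using typical_outcome[OF tail \<theta> z(1) C(2) AE_limit_outcome] by blast
  obtain l where l: "r - \<epsilon> < l" "l < r" "isCont F l"
    using mono_continuity_point[OF F_mono, of "r - \<epsilon>" r] \<epsilon> by auto
  obtain u where u: "r < u" "u < r + \<epsilon>" "isCont F u"
    using mono_continuity_point[OF F_mono, of r "r + \<epsilon>"] \<epsilon> by auto
  have "(\<lambda>m. spec (Suc m) \<omega> u - spec (Suc m) \<omega> l) \<longlonglongrightarrow> F u - F l"
    using \<omega>(2) l u unfolding limit_outcome_def weak_conv_def by (intro tendsto_diff) auto
  then have ev1: "\<forall>\<^sub>F m in sequentially. a / 2 < spec (Suc m) \<omega> u - spec (Suc m) \<omega> l"
    by (rule order_tendstoD(1)) (use a(1) a(2)[OF l(2) u(1)] in linarith)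
  \<comment> \<open>Large enough m to absorb the unit of the count lost on removing a
    column.\<close>
  have ev2: "\<forall>\<^sub>F m in sequentially. 4 / \<kappa> \<le> real (Suc m)" by real_asymp
  have "\<forall>\<^sub>F m in sequentially. a / 2 < spec (Suc m) \<omega> u - spec (Suc m) \<omega> l \<and> 4 / \<kappa> \<le> real (Suc m)
    \<and> mtrace (Tmat T (Suc m) \<omega> ^\<^sub>m 1) \<le> C * real (Suc m) \<and> mtrace (Tmat T (Suc m) \<omega> ^\<^sub>m 4) \<le> C * real (Suc m)
    \<and> real (n (Suc m)) \<le> 2 / y * real (Suc m)
    \<and> ((C * real (Suc m)) powr (1/4) * (C * real (Suc m)) \<le> \<eta> * (real (Suc m))\<^sup>2
    \<and> ((C * real (Suc m)) powr (1/4))\<^sup>2 * real (Suc m) \<le> \<eta> * (real (Suc m))\<^sup>2)"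
    by (intro eventually_conj ev1 ev2 eventually_columns_le eventually_trace_le[OF \<omega>(2)] eventually_size_conditions C t) auto
  from frequently_eventually_ex[OF \<omega>(3) this] obtain m0 where
    m0: "(\<Sum>j<n (Suc m0). \<Sum>i<Suc m0. (qf (Suc m0) \<omega> j i)\<^sup>2) \<le> C * real (Suc m0)"
      "real (card {j. j < n (Suc m0) \<and> bad_column (Suc m0) (n (Suc m0)) z c \<eta> t j (Tarr (Suc m0) \<omega>) (Yarr \<omega>)}) \<le> \<theta> * real (n (Suc m0))"
      "a / 2 < spec (Suc m0) \<omega> u - spec (Suc m0) \<omega> l" "4 / \<kappa> \<le> real (Suc m0)"
      "mtrace (Tmat T (Suc m0) \<omega> ^\<^sub>m 1) \<le> C * real (Suc m0)" "mtrace (Tmat T (Suc m0) \<omega> ^\<^sub>m 4) \<le> C * real (Suc m0)"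
      "real (n (Suc m0)) \<le> 2 / y * real (Suc m0)"
      "(C * real (Suc m0)) powr (1/4) * (C * real (Suc m0)) \<le> \<eta> * (real (Suc m0))\<^sup>2"
      "((C * real (Suc m0)) powr (1/4))\<^sup>2 * real (Suc m0) \<le> \<eta> * (real (Suc m0))\<^sup>2"
    by blast
  define m where "m = Suc m0"
  note m = m0[folded m_def]
  have m_pos: "m > 0" by (simp add: m_def)
  interpret S: sample_form m "Tf m \<omega>" "qf m \<omega>" by (rule sample_form[OF \<omega>(1)])
  define G where "G = smooth_count m (Tf m \<omega>) (qf m \<omega>) {..<n m} z"
  have \<kappa>m: "4 \<le> \<kappa> * real m" using m(4) \<kappa> by (simp add: pos_divide_le_eq mult.commute)
  have G: "\<kappa> * real m \<le> G"
  proof -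
    have half: "\<epsilon>\<^sup>2 / (\<epsilon>\<^sup>2 + \<epsilon>\<^sup>2) = 1 / 2" using \<epsilon> by simp
    have "(Im z)\<^sup>2 / (\<epsilon>\<^sup>2 + (Im z)\<^sup>2) * (real m * (spec m \<omega> u - spec m \<omega> l)) \<le> G"
      unfolding G_def by (rule smooth_count_ge_spec[OF \<omega>(1) m_pos z(1)]) (use l u z in auto)
    then have "1 / 2 * (real m * (spec m \<omega> u - spec m \<omega> l)) \<le> G" unfolding z(3) half .
    moreover have "real m * (a / 2) \<le> real m * (spec m \<omega> u - spec m \<omega> l)"
      using m(3) by (intro mult_left_mono) auto
    moreover have "\<kappa> * real m = 1 / 2 * (real m * (a / 2))" by (simp add: \<kappa>_def)
    ultimately show ?thesis by linarith
  qed
  define E where "E = {j. j < n m \<and> bad_column m (n m) z c \<eta> t j (Tarr m \<omega>) (Yarr \<omega>)}"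
  have "r * G \<le> real (n m) * (\<epsilon>\<^sup>2 / (t * real m / real (n m))) + real (card E) * cmod z + \<epsilon> * real m"
  proof -
    have "t * real m / real (n m) \<le> rform m (loo_form m (Tf m \<omega>) (qf m \<omega>) ({..<n m} - {j}) z) (qf m \<omega> j) (qf m \<omega> j)"
      if j: "j \<in> {..<n m}" "j \<notin> E" for j
    proof (rule good_column_lower)
      show "\<not> bad_column m (n m) z c \<eta> t j (Tarr m \<omega>) (Yarr \<omega>)" using j by (simp add: E_def)
      have "a0 * real m \<le> r * smooth_count m (Tf m \<omega>) (qf m \<omega>) ({..<n m} - {j}) z - \<epsilon> * real m"
      proof -
        have "\<kappa> * real m - 1 \<le> smooth_count m (Tf m \<omega>) (qf m \<omega>) ({..<n m} - {j}) z"
          using S.smooth_count_remove[of "{..<n m}" j z] j z(1) G unfolding G_def by simp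
        then have "r * (\<kappa> * real m - 1) \<le> r * smooth_count m (Tf m \<omega>) (qf m \<omega>) ({..<n m} - {j}) z"
          using r by (intro mult_left_mono) auto
        moreover have "r * 4 \<le> r * (\<kappa> * real m)" using \<kappa>m r by (intro mult_left_mono) auto
        moreover have "\<epsilon> * real m \<le> r * \<kappa> / 8 * real m" using \<epsilon> by (intro mult_right_mono) auto
        moreover define X where "X = r * (\<kappa> * real m)"
        ultimately have "X - r \<le> r * smooth_count m (Tf m \<omega>) (qf m \<omega>) ({..<n m} - {j}) z" "4 * r \<le> X"
          "\<epsilon> * real m \<le> X / 8" "a0 * real m = X / 2"
          by (simp_all add: a0_def right_diff_distrib)
        then show ?thesis using r by argo
      qed
      moreover have "(\<Sum>j'\<in>{..<n m} - {j}. \<Sum>i<m. (qf m \<omega> j' i)\<^sup>2) \<le> C * real m"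
        by (rule order_trans[OF sum_mono2 m(1)]) (auto intro!: sum_nonneg)
      ultimately have "a0\<^sup>2 / (C * (r + \<epsilon>)) * real m \<le> (\<Sum>i<m. loo_form m (Tf m \<omega>) (qf m \<omega>) ({..<n m} - {j}) z i i)"
        using S.loo_form_trace_pos[of "{..<n m} - {j}" z C a0] z r C a0 m_pos by simp
      moreover have "c * real m \<le> a0\<^sup>2 / (C * (r + \<epsilon>)) * real m"
        unfolding c_def using C r \<epsilon> by (intro mult_right_mono divide_left_mono mult_left_mono mult_pos_pos) auto
      ultimately show "good_form m c \<eta> (loo_form m (Tf m \<omega>) (qf m \<omega>) ({..<n m} - {j}) z)"
        using m by (intro regular_good_form[OF \<omega>(1) z(1) C(1)]) auto
    qed
    moreover have "0 < t * real m / real (n m)" using t m_pos n_pos[of m] by simp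
    ultimately show ?thesis
      using S.smooth_count_pos_bound[of "{..<n m}" z "t * real m / real (n m)" E] r z
      unfolding G_def by (simp add: E_def subset_iff)
  qed
  also have "real (n m) * (\<epsilon>\<^sup>2 / (t * real m / real (n m))) \<le> r * \<kappa> / 4 * real m"
  proof -
    have "real (n m) * (\<epsilon>\<^sup>2 / (t * real m / real (n m))) = (real (n m))\<^sup>2 * (\<epsilon>\<^sup>2 / (t * real m))"
      using n_pos[of m] by (simp add: power2_eq_square)
    also have "\<dots> \<le> (2 / y * real m)\<^sup>2 * (\<epsilon>\<^sup>2 / (t * real m))"
      using m(7) t by (intro mult_right_mono power_mono) auto
    also have "\<dots> = 4 * real m / (y\<^sup>2 * t) * \<epsilon>\<^sup>2"
      using m_pos y_pos t by (simp add: power2_eq_square field_simps)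
    also have "\<epsilon>\<^sup>2 \<le> r * \<kappa> * y\<^sup>2 * t / 16"
    proof -
      have "\<epsilon>\<^sup>2 \<le> \<epsilon> * 1" unfolding power2_eq_square using \<epsilon> by (intro mult_left_mono) auto
      then show ?thesis using \<epsilon>(4) by simp
    qed
    then have "4 * real m / (y\<^sup>2 * t) * \<epsilon>\<^sup>2 \<le> 4 * real m / (y\<^sup>2 * t) * (r * \<kappa> * y\<^sup>2 * t / 16)"
      using t by (intro mult_left_mono) auto
    also have "\<dots> = r * \<kappa> / 4 * real m" using y_pos t by (simp add: field_simps)
    finally show ?thesis .
  qed
  also have "real (card E) * cmod z \<le> r * \<kappa> / 4 * real m"
  proof -
    have "real (card E) * cmod z \<le> (\<theta> * (2 / y * real m)) * (r + 1)"
    proof (intro mult_mono z_norm)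
      have "real (card E) \<le> \<theta> * real (n m)" using m(2) unfolding E_def .
      also have "\<dots> \<le> \<theta> * (2 / y * real m)" using m(7) \<theta> by (intro mult_left_mono) auto
      finally show "real (card E) \<le> \<theta> * (2 / y * real m)" .
    qed (use \<theta> y_pos in auto)
    also have "\<dots> = r * \<kappa> / 4 * real m" using y_pos r by (simp add: \<theta>_def field_simps)
    finally show ?thesis .
  qed
  also have "\<epsilon> * real m \<le> r * \<kappa> / 8 * real m" using \<epsilon> by (intro mult_right_mono) auto
  finally have "r * G \<le> 5 / 8 * (r * (\<kappa> * real m))" by (simp add: algebra_simps)
  moreover have "r * (\<kappa> * real m) \<le> r * G" using G r by (intro mult_left_mono) auto
  moreover have "0 < r * (\<kappa> * real m)" using r \<kappa> m_pos by simp
  ultimately show False by linarith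
qed

text \<open>If F 0 exceeded the bound, the count at i \<epsilon> would be at least \<kappa> m. Few
  eigenvalues of T are small, so tr B is of order m with a constant free of \<epsilon>, and most
  \<beta>_j are O(\<epsilon>). The real part of the leave-one-out identity then leaves a count of at
  most m - n plus small terms, i.e. F 0 close to at most 1 - 1/y.\<close>

lemma mass_at_zero:
  assumes \<mu>_pos: "\<And>k. k \<ge> 1 \<Longrightarrow> 0 < \<mu> k"
    and Carleman: "\<not> summable (\<lambda>k. \<mu> (2 * Suc k) powr (- 1 / real (2 * Suc k)))"
    and N: "real_distribution N"
    and N_moments: "\<And>k. k \<ge> 1 \<Longrightarrow> integrable N (\<lambda>x. x ^ k) \<and> (\<integral>x. x ^ k \<partial>N) = \<mu> k"
    and N0: "measure N {0} = 0"
  shows "F 0 \<le> max 0 (1 - 1 / y)"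
proof (rule ccontr)
  assume contra: "\<not> F 0 \<le> max 0 (1 - 1 / y)"
  \<comment> \<open>The errors will add up to 4 \<gamma> (one in \<kappa>, one from n / m, one from
    the typical and one from the exceptional columns), so an eighth of the gap suffices.\<close>
  define \<gamma> where "\<gamma> = (F 0 - max 0 (1 - 1 / y)) / 8"
  have \<gamma>: "\<gamma> > 0" using contra unfolding \<gamma>_def by (simp add: not_le del: max_less_iff_conj)
  have F0: "8 * \<gamma> \<le> F 0" "8 * \<gamma> \<le> F 0 - (1 - 1 / y)"
  proof -
    have "8 * \<gamma> = F 0 - max 0 (1 - 1 / y)" by (simp add: \<gamma>_def)
    then show "8 * \<gamma> \<le> F 0" "8 * \<gamma> \<le> F 0 - (1 - 1 / y)"
      using max.cobounded1[of 0 "1 - 1 / y"] max.cobounded2[of "1 - 1 / y" 0] by linarith+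
  qed
  have F0_le: "F 0 \<le> 1"
  proof (rule tendsto_lowerbound)
    show "(F \<longlongrightarrow> 1) at_top" using F_df by (simp add: is_df_def)
    show "\<forall>\<^sub>F x in at_top. F 0 \<le> F x"
      using eventually_ge_at_top[of 0] by eventually_elim (use F_mono in \<open>auto simp: mono_def\<close>)
  qed simp
  define \<kappa> where "\<kappa> = F 0 - \<gamma>"
  have \<kappa>: "\<kappa> > 0" and \<kappa>4: "\<kappa> / 4 > 0" using \<gamma> F0 by (simp_all add: \<kappa>_def)
  obtain s where s: "s > 0" and small: "\<forall>t. (\<forall>m k. k < m \<longrightarrow> 0 \<le> t m k) \<longrightarrow>
      (\<forall>p\<ge>1. (\<lambda>m. (\<Sum>k<m. t m k ^ p) / real m) \<longlonglongrightarrow> \<mu> p) \<longrightarrow>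
      (\<forall>\<^sub>F m in sequentially. (\<Sum>k<m. s / (t m k + s)) \<le> \<kappa> / 4 * real m)"
    by (rule few_small_eigenvalues[OF \<mu>_pos Carleman N N_moments N0 \<kappa>4])
  define C where "C = moment_bound"
  note C = moment_bound[folded C_def]
  define c where "c = s * \<kappa> / 2"
  define \<theta> where "\<theta> = \<gamma> * y / 2"
  have c: "c > 0" using s \<kappa> by (simp add: c_def)
  have \<theta>: "\<theta> > 0" using \<gamma> y_pos by (simp add: \<theta>_def)
  obtain t \<eta> where t: "t > 0" "\<eta> > 0" and tail: "\<And>m B. m > 0 \<Longrightarrow> psd_form m B \<Longrightarrow> good_form m c \<eta> B \<Longrightarrow>
      law.PD.prob m {x \<in> space (law.PD m). rform m B x x < t * real m} \<le> \<theta> / 8"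
    using quadratic_tail[OF c \<theta>] by blast
  define \<epsilon> where "\<epsilon> = \<gamma> * y\<^sup>2 * t / 4"
  have \<epsilon>: "\<epsilon> > 0" using \<gamma> t y_pos by (simp add: \<epsilon>_def)
  define z where "z = Complex 0 \<epsilon>"
  have z: "Im z > 0" "Re z = 0" "Im z = \<epsilon>" using \<epsilon> by (simp_all add: z_def)
  obtain \<omega> where \<omega>: "\<omega> \<in> space M" "limit_outcome \<omega>"
    "\<exists>\<^sub>F m in sequentially. (\<Sum>j<n (Suc m). \<Sum>i<Suc m. (qf (Suc m) \<omega> j i)\<^sup>2) \<le> C * real (Suc m)
      \<and> real (card {j. j < n (Suc m) \<and> bad_column (Suc m) (n (Suc m)) z c \<eta> t j (Tarr (Suc m) \<omega>) (Yarr \<omega>)}) \<le> \<theta> * real (n (Suc m))"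
    using typical_outcome[OF tail \<theta> z(1) C(2) AE_limit_outcome] by blast
  have "\<forall>m. \<exists>b tt. eigenbasis m (Tf m \<omega>) b tt"
    using psd_form.exists_eigenbasis[OF T_psd[OF \<omega>(1)]] by blast
  then obtain b tt where basis: "\<And>m. eigenbasis m (Tf m \<omega>) (b m) (tt m)" by metis
  have tr: "mtrace (Tmat T m \<omega> ^\<^sub>m p) = (\<Sum>k<m. tt m k ^ p)" for m p
    using eigenbasis.trace_power[OF basis, of m p] by (simp add: Tmat_def)
  have "\<forall>m k. k < m \<longrightarrow> 0 \<le> tt m k" using eigenbasis.eigenvalue_nonneg[OF basis] by blast
  moreover have "\<forall>p\<ge>1. (\<lambda>m. (\<Sum>k<m. tt m k ^ p) / real m) \<longlonglongrightarrow> \<mu> p"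
    using \<omega>(2) unfolding limit_outcome_def tr by blast
  ultimately have "\<forall>\<^sub>F m in sequentially. (\<Sum>k<m. s / (tt m k + s)) \<le> \<kappa> / 4 * real m"
    using small[rule_format, of tt] by blast
  then have ev_small: "\<forall>\<^sub>F m in sequentially. (\<Sum>k<Suc m. s / (tt (Suc m) k + s)) \<le> \<kappa> / 4 * real (Suc m)"
    by (subst eventually_sequentially_Suc)
  \<comment> \<open>A window short against \<epsilon>, on which the Poisson weight is at least 1 /
    (1 + \<gamma> / 2): unlike for a positive atom, a fixed fraction of F 0 would not be
    enough.\<close>
  define d where "d = \<epsilon> * sqrt (\<gamma> / 2)"
  have d: "d > 0" "d\<^sup>2 = \<epsilon>\<^sup>2 * (\<gamma> / 2)" using \<epsilon> \<gamma> by (simp_all add: d_def power_mult_distrib)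
  obtain u where u: "0 < u" "u < d" "isCont F u"
    using mono_continuity_point[OF F_mono, of 0 d] d by auto
  have "(\<lambda>m. spec (Suc m) \<omega> u) \<longlonglongrightarrow> F u"
    using \<omega>(2) u unfolding limit_outcome_def weak_conv_def by auto
  moreover have "F 0 \<le> F u" using F_mono u by (simp add: mono_def)
  ultimately have ev1: "\<forall>\<^sub>F m in sequentially. F 0 - \<gamma> / 2 < spec (Suc m) \<omega> u"
    using \<gamma> by (intro order_tendstoD(1)) auto
  have ev2: "\<forall>\<^sub>F m in sequentially. 4 / \<kappa> \<le> real (Suc m)" by real_asymp
  have "(\<lambda>m. 1 / (real (Suc m) / real (n (Suc m)))) \<longlonglongrightarrow> 1 / y"
    using y_pos by (intro tendsto_divide tendsto_const LIMSEQ_Suc[OF ratio]) auto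
  then have "\<forall>\<^sub>F m in sequentially. 1 / y - \<gamma> < 1 / (real (Suc m) / real (n (Suc m)))"
    using \<gamma> by (intro order_tendstoD(1)) auto
  then have ev3: "\<forall>\<^sub>F m in sequentially. (1 / y - \<gamma>) * real (Suc m) \<le> real (n (Suc m))"
    by eventually_elim (simp add: pos_less_divide_eq)
  have "\<forall>\<^sub>F m in sequentially. F 0 - \<gamma> / 2 < spec (Suc m) \<omega> u \<and> 4 / \<kappa> \<le> real (Suc m)
    \<and> (1 / y - \<gamma>) * real (Suc m) \<le> real (n (Suc m)) \<and> (\<Sum>k<Suc m. s / (tt (Suc m) k + s)) \<le> \<kappa> / 4 * real (Suc m)
    \<and> mtrace (Tmat T (Suc m) \<omega> ^\<^sub>m 1) \<le> C * real (Suc m) \<and> mtrace (Tmat T (Suc m) \<omega> ^\<^sub>m 4) \<le> C * real (Suc m)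
    \<and> real (n (Suc m)) \<le> 2 / y * real (Suc m)
    \<and> ((C * real (Suc m)) powr (1/4) * (C * real (Suc m)) \<le> \<eta> * (real (Suc m))\<^sup>2
    \<and> ((C * real (Suc m)) powr (1/4))\<^sup>2 * real (Suc m) \<le> \<eta> * (real (Suc m))\<^sup>2)"
    by (intro eventually_conj ev1 ev2 ev3 ev_small eventually_columns_le eventually_trace_le[OF \<omega>(2)] eventually_size_conditions C t) auto
  from frequently_eventually_ex[OF \<omega>(3) this] obtain m0 where
    m0: "(\<Sum>j<n (Suc m0). \<Sum>i<Suc m0. (qf (Suc m0) \<omega> j i)\<^sup>2) \<le> C * real (Suc m0)"
      "real (card {j. j < n (Suc m0) \<and> bad_column (Suc m0) (n (Suc m0)) z c \<eta> t j (Tarr (Suc m0) \<omega>) (Yarr \<omega>)}) \<le> \<theta> * real (n (Suc m0))"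
      "F 0 - \<gamma> / 2 < spec (Suc m0) \<omega> u" "4 / \<kappa> \<le> real (Suc m0)"
      "(1 / y - \<gamma>) * real (Suc m0) \<le> real (n (Suc m0))" "(\<Sum>k<Suc m0. s / (tt (Suc m0) k + s)) \<le> \<kappa> / 4 * real (Suc m0)"
      "mtrace (Tmat T (Suc m0) \<omega> ^\<^sub>m 1) \<le> C * real (Suc m0)" "mtrace (Tmat T (Suc m0) \<omega> ^\<^sub>m 4) \<le> C * real (Suc m0)"
      "real (n (Suc m0)) \<le> 2 / y * real (Suc m0)"
      "(C * real (Suc m0)) powr (1/4) * (C * real (Suc m0)) \<le> \<eta> * (real (Suc m0))\<^sup>2"
      "((C * real (Suc m0)) powr (1/4))\<^sup>2 * real (Suc m0) \<le> \<eta> * (real (Suc m0))\<^sup>2"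
    by blast
  define m where "m = Suc m0"
  note m = m0[folded m_def]
  have m_pos: "m > 0" by (simp add: m_def)
  interpret S: sample_form m "Tf m \<omega>" "qf m \<omega>" by (rule sample_form[OF \<omega>(1)])
  define G where "G = smooth_count m (Tf m \<omega>) (qf m \<omega>) {..<n m} z"
  have \<kappa>m: "4 \<le> \<kappa> * real m" using m(4) \<kappa> by (simp add: pos_divide_le_eq mult.commute)
  have G: "\<kappa> * real m \<le> G"
  proof -
    have g: "\<epsilon>\<^sup>2 / (d\<^sup>2 + \<epsilon>\<^sup>2) = 1 / (1 + \<gamma> / 2)"
    proof -
      have "d\<^sup>2 + \<epsilon>\<^sup>2 = \<epsilon>\<^sup>2 * (1 + \<gamma> / 2)" unfolding d(2) by (simp add: distrib_left)
      then show ?thesis using \<epsilon> by simp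
    qed
    have "(Im z)\<^sup>2 / (d\<^sup>2 + (Im z)\<^sup>2) * (real m * (spec m \<omega> u - spec m \<omega> (- d))) \<le> G"
      unfolding G_def by (rule smooth_count_ge_spec[OF \<omega>(1) m_pos z(1)]) (use u d z in auto)
    moreover have "spec m \<omega> (- d) = 0" using spec_bounds(3)[OF \<omega>(1)] d by simp
    ultimately have *: "1 / (1 + \<gamma> / 2) * (real m * spec m \<omega> u) \<le> G" unfolding z(3) g by simp
    have "\<kappa> * (1 + \<gamma> / 2) \<le> F 0 - \<gamma> / 2"
    proof -
      have "\<kappa> * (\<gamma> / 2) \<le> 1 * (\<gamma> / 2)" using \<gamma> F0_le by (intro mult_right_mono) (auto simp: \<kappa>_def)
      then show ?thesis by (simp add: \<kappa>_def distrib_left)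
    qed
    then have "\<kappa> \<le> (F 0 - \<gamma> / 2) / (1 + \<gamma> / 2)" using \<gamma> by (subst pos_le_divide_eq) auto
    also have "\<dots> \<le> spec m \<omega> u / (1 + \<gamma> / 2)" using m(3) \<gamma> by (intro divide_right_mono) auto
    finally have "\<kappa> * real m \<le> spec m \<omega> u / (1 + \<gamma> / 2) * real m" by (intro mult_right_mono) auto
    then show ?thesis using * by (simp add: mult.commute)
  qed
  define E where "E = {j. j < n m \<and> bad_column m (n m) z c \<eta> t j (Tarr m \<omega>) (Yarr \<omega>)}"
  have "G \<le> real m - real (n m) + real (n m) * (\<epsilon> / (t * real m / real (n m))) + real (card E)"
  proof -
    have "t * real m / real (n m) \<le> rform m (loo_form m (Tf m \<omega>) (qf m \<omega>) ({..<n m} - {j}) z) (qf m \<omega> j) (qf m \<omega> j)"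
      if j: "j \<in> {..<n m}" "j \<notin> E" for j
    proof (rule good_column_lower)
      show "\<not> bad_column m (n m) z c \<eta> t j (Tarr m \<omega>) (Yarr \<omega>)" using j by (simp add: E_def)
      define B where "B = (\<Sum>i<m. loo_form m (Tf m \<omega>) (qf m \<omega>) ({..<n m} - {j}) z i i)"
      have "\<kappa> * real m - 1 \<le> smooth_count m (Tf m \<omega>) (qf m \<omega>) ({..<n m} - {j}) z"
        using S.smooth_count_remove[of "{..<n m}" j z] j z(1) G unfolding G_def by simp
      also have "\<dots> \<le> B / s + (\<Sum>k<m. s / (tt m k + s))"
        unfolding B_def by (rule S.loo_form_trace_zero[OF z(1) s basis])
      finally have "\<kappa> * real m - 1 \<le> B / s + \<kappa> / 4 * real m" using m(6) by linarith
      moreover have "\<kappa> / 4 * real m = (\<kappa> * real m) / 4" "\<kappa> / 2 * real m = (\<kappa> * real m) / 2" by simp_all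
      ultimately have "\<kappa> / 2 * real m \<le> B / s" using \<kappa>m by argo
      then have "c * real m \<le> B" using s by (simp add: c_def pos_le_divide_eq mult_ac)
      then show "good_form m c \<eta> (loo_form m (Tf m \<omega>) (qf m \<omega>) ({..<n m} - {j}) z)"
        unfolding B_def using m by (intro regular_good_form[OF \<omega>(1) z(1) C(1)]) auto
    qed
    moreover have "0 < t * real m / real (n m)" using t m_pos n_pos[of m] by simp
    ultimately show ?thesis
      using S.smooth_count_zero_bound[of "{..<n m}" z "t * real m / real (n m)" E] z
      unfolding G_def by (simp add: E_def subset_iff)
  qed
  also have "real (n m) * (\<epsilon> / (t * real m / real (n m))) \<le> \<gamma> * real m"
  proof -
    have "real (n m) * (\<epsilon> / (t * real m / real (n m))) = (real (n m))\<^sup>2 * (\<epsilon> / (t * real m))"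
      using n_pos[of m] by (simp add: power2_eq_square)
    also have "\<dots> \<le> (2 / y * real m)\<^sup>2 * (\<epsilon> / (t * real m))"
      using m(9) t \<epsilon> by (intro mult_right_mono power_mono) auto
    also have "\<dots> = \<gamma> * real m"
      using m_pos y_pos t by (simp add: \<epsilon>_def power2_eq_square field_simps)
    finally show ?thesis .
  qed
  also have "real (card E) \<le> \<gamma> * real m"
  proof -
    have "real (card E) \<le> \<theta> * real (n m)" using m(2) unfolding E_def .
    also have "\<dots> \<le> \<theta> * (2 / y * real m)" using m(9) \<theta> by (intro mult_left_mono) auto
    also have "\<dots> = \<gamma> * real m" using y_pos by (simp add: \<theta>_def)
    finally show ?thesis .
  qed
  finally have "\<kappa> * real m \<le> real m - (1 / y - \<gamma>) * real m + \<gamma> * real m + \<gamma> * real m"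
    using G m(5) by linarith
  also have "\<dots> = (1 - 1 / y + 3 * \<gamma>) * real m" by (simp add: algebra_simps)
  finally have "\<kappa> \<le> 1 - 1 / y + 3 * \<gamma>" using m_pos by simp
  then show False using F0 \<gamma> unfolding \<kappa>_def by linarith
qed

text \<open>Weak convergence alone does not control the value at the possible discontinuity 0. From
  above, right continuity of F and continuity points to the right of 0 suffice; from below, the rank
  bound 1 - n / m matches the assumed bound on F 0.\<close>

lemma spec_zero_tendsto:
  assumes F0: "F 0 \<le> max 0 (1 - 1 / y)" and \<omega>: "\<omega> \<in> space M" "limit_outcome \<omega>"
  shows "(\<lambda>m. spec (Suc m) \<omega> 0) \<longlonglongrightarrow> F 0"
proof (rule order_tendstoI)
  fix a assume a: "a < F 0"
  show "\<forall>\<^sub>F m in sequentially. a < spec (Suc m) \<omega> 0"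
  proof (cases "a < 0")
    case True
    then show ?thesis using less_le_trans[OF _ spec_bounds(1)[OF \<omega>(1)]] by (simp add: always_eventually)
  next
    case False
    then have lt: "a < 1 - 1 / y" using a F0 by linarith
    have "(\<lambda>m. 1 - 1 / (real (Suc m) / real (n (Suc m)))) \<longlonglongrightarrow> 1 - 1 / y"
      using y_pos by (intro tendsto_diff tendsto_divide tendsto_const LIMSEQ_Suc[OF ratio]) auto
    then have "\<forall>\<^sub>F m in sequentially. a < 1 - 1 / (real (Suc m) / real (n (Suc m)))"
      by (rule order_tendstoD(1)[OF _ lt])
    then show ?thesis
      by eventually_elim (rule less_le_trans[OF _ spec_zero_ge[OF \<omega>(1)]], simp_all)
  qed
next
  fix a assume a: "F 0 < a"
  have "(F \<longlongrightarrow> F 0) (at_right 0)" using F_df by (simp add: is_df_def continuous_within)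
  then have "\<forall>\<^sub>F x in at_right 0. F x < a" by (rule order_tendstoD(2)[OF _ a])
  then obtain b where b: "0 < b" "\<And>x. 0 < x \<Longrightarrow> x < b \<Longrightarrow> F x < a"
    by (auto simp: eventually_at_right_field)
  obtain u where u: "0 < u" "u < b" "isCont F u"
    using mono_continuity_point[OF F_mono, of 0 b] b by auto
  have "(\<lambda>m. spec (Suc m) \<omega> u) \<longlonglongrightarrow> F u"
    using \<omega>(2) u unfolding limit_outcome_def weak_conv_def by auto
  then have "\<forall>\<^sub>F m in sequentially. spec (Suc m) \<omega> u < a"
    by (rule order_tendstoD(2)) (use b(2)[OF u(1,2)] in simp)
  then show "\<forall>\<^sub>F m in sequentially. spec (Suc m) \<omega> 0 < a"
  proof eventually_elim
    case (elim m)
    have "spec (Suc m) \<omega> 0 \<le> spec (Suc m) \<omega> u"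
      using spec_mono[OF \<omega>(1)] u by (simp add: mono_def)
    then show ?case using elim by simp
  qed
qed

text \<open>Off 0 weak convergence is pointwise since F has no positive atom; at 0 the previous
  lemma serves, and F is continuous on the closed half-line by right continuity.\<close>

lemma spec_uniform_limit:
  assumes F0: "F 0 \<le> max 0 (1 - 1 / y)" and \<omega>: "\<omega> \<in> space M" "limit_outcome \<omega>"
  shows "uniform_limit UNIV (\<lambda>m. spec (Suc m) \<omega>) F sequentially"
proof (rule uniform_convergence_of_dfs)
  have conv: "(\<lambda>m. spec (Suc m) \<omega> x) \<longlonglongrightarrow> F x" if "isCont F x" for x
    using \<omega>(2) that unfolding limit_outcome_def weak_conv_def by auto
  have F: "(F \<longlongrightarrow> 0) at_bot" "(F \<longlongrightarrow> 1) at_top" "continuous (at_right x) F" for x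
    using F_df by (auto simp: is_df_def)
  show "mono F" by (rule F_mono)
  show "(F \<longlongrightarrow> 1) at_top" by (rule F)
  show "F x \<le> 1" for x
    by (rule tendsto_lowerbound[OF F(2)])
      (use F_mono in \<open>auto simp: mono_def intro: eventually_mono[OF eventually_ge_at_top[of x]]\<close>)
  show "F x = 0" if neg: "x < 0" for x
  proof (rule antisym)
    show "0 \<le> F x"
      by (rule tendsto_upperbound[OF F(1)])
        (use F_mono in \<open>auto simp: mono_def intro: eventually_mono[OF eventually_le_at_bot[of x]]\<close>)
    obtain x' where x': "x < x'" "x' < 0" "isCont F x'"
      using mono_continuity_point[OF F_mono neg] by blast
    have "(\<lambda>m. spec (Suc m) \<omega> x') \<longlonglongrightarrow> F x'" by (rule conv[OF x'(3)])
    moreover have "(\<lambda>m. spec (Suc m) \<omega> x') = (\<lambda>m. 0)" using spec_bounds(3)[OF \<omega>(1) x'(2)] by simp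
    ultimately have "F x' = 0" by (simp add: LIMSEQ_const_iff)
    then show "F x \<le> 0" using F_mono x'(1) unfolding mono_def by (metis less_imp_le)
  qed
  show "continuous_on {0..} F"
    unfolding continuous_on_eq_continuous_within
  proof
    fix x :: real assume "x \<in> {0..}"
    show "continuous (at x within {0..}) F"
    proof (cases "x = 0")
      case True
      have "at (0::real) within {0..} = at_right 0"
        by (rule at_within_nhd[of _ UNIV]) auto
      then show ?thesis using F(3)[of 0] True by simp
    next
      case False
      then show ?thesis using no_positive_atom[of x] \<open>x \<in> {0..}\<close> by (auto intro: continuous_at_imp_continuous_at_within)
    qed
  qed
  show "mono (spec (Suc m) \<omega>)" "spec (Suc m) \<omega> x \<le> 1" "x < 0 \<Longrightarrow> spec (Suc m) \<omega> x = 0" for m x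
    using spec_mono[OF \<omega>(1)] spec_bounds[OF \<omega>(1)] by auto
  show "(\<lambda>m. spec (Suc m) \<omega> x) \<longlonglongrightarrow> F x" if "0 \<le> x" for x
    using that spec_zero_tendsto[OF F0 \<omega>] conv[OF no_positive_atom[of x]] by (cases "x = 0") auto
qed

end

section \<open>Translation to matrices and conclusion\<close>

lemma rform_scalar_prod:
  fixes A :: "real mat"
  assumes "A \<in> carrier_mat m m"
  shows "rform m (\<lambda>i k. A $$ (i, k)) x x = vec m x \<bullet> (A *\<^sub>v vec m x)"
  using assms by (auto simp: rform_def scalar_prod_def sum_distrib_left atLeast0LessThan mult.assoc intro!: sum.cong)

theorem theorem2:
  fixes M :: "'a measure"
    and Y :: "nat \<Rightarrow> nat \<Rightarrow> 'a \<Rightarrow> real"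
    and T :: "nat \<Rightarrow> nat \<Rightarrow> nat \<Rightarrow> 'a \<Rightarrow> real"
    and n :: "nat \<Rightarrow> nat"
    and y :: real
    and \<mu> :: "nat \<Rightarrow> real"
    and N :: "real measure"
    and H F :: "real \<Rightarrow> real"
  assumes P: "prob_space M"
    and Y_rv: "\<And>i j. Y i j \<in> borel_measurable M"
    and Y_indep: "prob_space.indep_vars M (\<lambda>_. borel) (\<lambda>(i, j). Y i j) UNIV"
    and Y_ident: "\<And>i j. distr M borel (Y i j) = distr M borel (Y 0 0)"
    and Y_int: "integrable M (Y 0 0)"
    and Y_var: "integrable M (\<lambda>\<omega>. \<bar>Y 0 0 \<omega> - prob_space.expectation M (Y 0 0)\<bar>\<^sup>2)"
    and Y_var1: "prob_space.expectation M (\<lambda>\<omega>. \<bar>Y 0 0 \<omega> - prob_space.expectation M (Y 0 0)\<bar>\<^sup>2) = 1"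
    and n_pos: "\<And>m. n m > 0"
    and y_pos: "y > 0"
    and ratio: "(\<lambda>m. real m / real (n m)) \<longlonglongrightarrow> y"
    and T_rv: "\<And>m i j. T m i j \<in> borel_measurable M"
    and T_sym: "\<And>m \<omega>. \<omega> \<in> space M \<Longrightarrow> transpose_mat (Tmat T m \<omega>) = Tmat T m \<omega>"
    and T_psd: "\<And>m \<omega> v. \<omega> \<in> space M \<Longrightarrow> v \<in> carrier_vec m \<Longrightarrow> v \<bullet> (Tmat T m \<omega> *\<^sub>v v) \<ge> 0"
    and T_indep: "\<And>m. prob_space.indep_var M
        (Pi\<^sub>M UNIV (\<lambda>_. borel)) (\<lambda>\<omega> (i, j). if i < m \<and> j < m then T m i j \<omega> else 0)
        (Pi\<^sub>M UNIV (\<lambda>_. borel)) (\<lambda>\<omega> (i, j). Y i j \<omega>)"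
    and mu_pos: "\<And>k. k \<ge> 1 \<Longrightarrow> \<mu> k > 0"
    and T_moments: "\<And>k. k \<ge> 1 \<Longrightarrow>
        (AE \<omega> in M. (\<lambda>m. mtrace (Tmat T m \<omega> ^\<^sub>m k) / real m) \<longlonglongrightarrow> \<mu> k)"
    and carleman: "\<not> summable (\<lambda>k. \<mu> (2 * Suc k) powr (- 1 / real (2 * Suc k)))"
    and N_dist: "real_distribution N"
    and H_def: "H = cdf N"
    and H_moments: "\<And>k. k \<ge> 1 \<Longrightarrow> integrable N (\<lambda>x. x ^ k) \<and> (\<integral>x. x ^ k \<partial>N) = \<mu> k"
    and F_df: "is_df F"
    and F_lim: "AE \<omega> in M. weak_conv (\<lambda>m. esd (Mmat Y T (Suc m) (n (Suc m)) \<omega>)) F"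
  shows "(\<forall>x>0. isCont F x) \<and>
    (measure N {0} = 0 \<longrightarrow>
      (AE \<omega> in M. uniform_limit UNIV (\<lambda>m. esd (Mmat Y T (Suc m) (n (Suc m)) \<omega>)) F sequentially))"
proof -
  interpret prob_space M by (rule P)
  have psd: "psd_form m (\<lambda>i k. T m i k \<omega>)" if \<omega>: "\<omega> \<in> space M" for m \<omega>
  proof
    fix i k assume "i < m" "k < m"
    then show "T m i k \<omega> = T m k i \<omega>"
      using arg_cong[OF T_sym[OF \<omega>, of m], of "\<lambda>A. A $$ (k, i)"] by (simp add: Tmat_def)
  next
    fix x
    have "rform m (\<lambda>i k. T m i k \<omega>) x x = rform m (\<lambda>i k. Tmat T m \<omega> $$ (i, k)) x x"
      unfolding rform_def by (intro sum.cong refl) (simp add: Tmat_def)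
    also have "\<dots> = vec m x \<bullet> (Tmat T m \<omega> *\<^sub>v vec m x)"
      by (rule rform_scalar_prod) (simp add: Tmat_def)
    finally show "0 \<le> rform m (\<lambda>i k. T m i k \<omega>) x x"
      using T_psd[OF \<omega>, of "vec m x"] by simp
  qed
  interpret sample_limit M Y T n y \<mu> F
    by (intro sample_limit.intro sample_model.intro sample_model_axioms.intro sample_limit_axioms.intro)
      (fact P Y_rv Y_indep Y_ident Y_int Y_var Y_var1 n_pos psd T_indep y_pos ratio T_moments F_df F_lim)+
  show ?thesis
  proof (intro conjI allI impI)
    show "isCont F x" if "x > 0" for x using that by (rule no_positive_atom)
    assume "measure N {0} = 0"
    then have F0: "F 0 \<le> max 0 (1 - 1 / y)"
      using mu_pos carleman N_dist H_moments by (intro mass_at_zero) auto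
    show "AE \<omega> in M. uniform_limit UNIV (\<lambda>m. spec (Suc m) \<omega>) F sequentially"
      using AE_limit_outcome AE_space by eventually_elim (rule spec_uniform_limit[OF F0])
  qed
qed

end
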